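(* Let $H$ be a Hopf algebra over a field $\Bbbk$ and $\mathscr C$ a category of left $H$-modules with finite duality as in the context. Suppose that $P\in\mathscr A(H)\cap\mathscr M(H)$ and that $\Phi_P:H^*_{\mathscr C}\to H$ is injective. Then: (a) If $V\in\mathscr C$ and $V\otimes_{D(V)}V^\star$ is a simple $H$-bimodule, then it is isomorphic to $H_{V,P}$ as a left $H$-module, where $H$ acts on $V\otimes_{D(V)}V^\star$ via $\diamond$ and on $H_{V,P}\subset H$ via $\mathrm{ad}$. (b) $H_{\mathscr C,P}=\bigoplus_{[V]\in\mathrm{Iso}^\circ\mathscr C}H_{V,P}$ if $\mathscr C$ is semisimple and $V\otimes_{D(V)}V^\star$ is simple as an $H$-bimodule for each simple $V\in\mathscr C$. (c) If $P\in\mathscr M_0(H)$, then $\mathrm{ch}_{\mathscr C}:K_0(\mathscr C^{fin})\to Z(H)$, $|V|\mapsto c_V=\Phi_P(z_V)$, is injective.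
   Context: The left (resp. right) action of $H=(H,m,\Delta,\varepsilon,S)$ is denoted $\triangleright$ (resp. $\triangleleft$), and $\Delta(h)=h_{(1)}\otimes h_{(2)}$ in Sweedler notation. $\mathscr C$ is a full abelian tensor subcategory of left $H$-modules, closed under submodules, with a finite duality functor: a (contravariant, additive) functor ${}^\star$ from $\mathscr C$ to right $H$-modules, acting on morphisms by transposition, such that $V^\star$ is a right $H$-submodule of $V^*=\mathrm{Hom}_\Bbbk(V,\Bbbk)$ (where $\langle v,f\triangleleft h\rangle_V=\langle h\triangleright v,f\rangle_V$, with $\langle\cdot,\cdot\rangle_V$ the evaluation pairing), with $V^\star=V^*$ iff $V$ is finite dimensional, the evaluation pairing on $V\otimes V^\star$ is non-degenerate, and there is a natural pairing-compatible isomorphism $(V\otimes V')^\star\cong V'{}^\star\otimes V^\star$. $D(V):=\mathrm{End}_HV^\star=(\mathrm{End}_HV)^{op}$. $\mathscr C^{fin}$ is the full subcategory of finite dimensional objects, $K_0(\mathscr C^{fin})$ its Grothendieck group, $|V|$ the class of $V$. $\mathrm{Iso}^\circ\mathscr C$ is the set of isomorphism classes of simple objects. $H^*=\mathrm{Hom}_\Bbbk(H,\Bbbk)$ is an $H$-bimodule via $(h\triangleright\xi\triangleleft h')(x)=\xi(h'xh)$ and an algebra via $(\phi\cdot\xi)(h)=\phi(h_{(1)})\xi(h_{(2)})$. $V\otimes_{D(V)}V^\star$ is an $H$-bimodule via $h\triangleright(v\otimes f)\triangleleft h'=(h\triangleright v)\otimes(f\triangleleft h')$. $\beta_V:V\otimes_{D(V)}V^\star\to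 H^*$, $\beta_V(v\otimes f)(h)=\langle h\triangleright v,f\rangle_V$; $H_V^*=\mathrm{Im}\,\beta_V$; $H^*_{\mathscr C}=\sum_{V\in\mathscr C}H^*_V$ (a subalgebra of $H^*$). For $V\in\mathscr C^{fin}$, $z_V\in H^*_V$ is given by $z_V(h)=$ trace of $h$ on $V$. For an $H$-bimodule $B$: $B^H=\{b: h\triangleright b=b\triangleleft h\ \forall h\in H\}$; $(\mathrm{ad}\,h)(b)=h_{(1)}\triangleright b\triangleleft S(h_{(2)})$; $h\diamond b=S^2(h_{(2)})\triangleright b\triangleleft S(h_{(1)})$. $Z(H)$ is the center of $H$. Fix a completion $H\widehat\otimes H$ of $H\otimes H$ (an algebra containing $H\otimes H$, to which the usual operations extend) such that $(f\otimes1)(H\widehat\otimes H)\subset H$ for all $f\in H^*_{\mathscr C}$, where $f\otimes1$ extends $a\otimes b\mapsto f(a)b$ and satisfies $(f\otimes1)((a\otimes b)X(c\otimes d))=b\cdot((c\triangleright f\triangleleft a)\otimes1)(X)\cdot d$ for $a,b,c,d\in H$. For $P\in H\widehat\otimes H$ let $\Phi_P(f)=(f\otimes1)(P)$, $f\in H^*_{\mathscr C}$; set $H_{V,P}=\Phi_P(H^*_V)$ and $H_{\mathscr C,P}=\Phi_P(H^*_{\mathscr C})$. $\mathscr A(H)$ is the set of $P\in H\widehat\otimes H$ with $P\cdot(S^2\otimes1)(\Delta(h))=\Delta(h)\cdot P$ for all $h\in H$ (for such $P$, $\Phi_P$ maps $(H^*_{\mathscr C})^H$ into $Z(H)$ and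 $|V|\mapsto c_V$ is a well-defined group homomorphism). $\mathscr M(H)$ is the set of $P\in H\widehat\otimes H$ such that $\Phi_P(H^*_V)\cdot\Phi_P(H^*_{V'})\subset\Phi_P(H^*_V\cdot H^*_{V'})$ for all $V,V'\in\mathscr C$. $\mathscr M_0(H)$ is the set of $P\in\mathscr M(H)$ such that $\Phi_P$ restricts to a homomorphism of algebras $(H^*_{\mathscr C})^H\to Z(H)$.
   Formalization: Part (c) is stated only for fields of characteristic 0: in characteristic p > 0 it always fails, since the trivial module gives p|k| non-zero in the Grothendieck group while its image p·c_k is 0. *)

theory Defs
  imports
    Complex_Main
    "HOL-Algebra.Module"
    "HOL-Algebra.Generated_Groups"
    "HOL-Algebra.Free_Abelian_Groups"
    "HOL-Library.Function_Algebras"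
begin

section \<open>Vector spaces with a carrier\<close>

text \<open>
  The ground field is a type of class \<^class>\<open>field\<close>, and the Hopf algebra and the completion of its
  tensor square are types of class \<^class>\<open>ring_1\<close>.  Vector spaces which vary (modules, dual spaces,
  tensor products) are records of type \<open>module\<close> from \<open>HOL-Algebra\<close>; their ring fields \<open>mult\<close> and
  \<open>one\<close> carry no information.
\<close>

definition ground_ring :: "'k::field ring" where
  "ground_ring = \<lparr>carrier = UNIV, monoid.mult = (*), monoid.one = 1, ring.zero = 0, ring.add = (+)\<rparr>"

definition space_of :: "('k \<Rightarrow> 'b::ab_group_add \<Rightarrow> 'b) \<Rightarrow> ('k, 'b) module" where
  "space_of s = \<lparr>carrier = UNIV, monoid.mult = undefined, monoid.one = undefined, ring.zero = 0, ring.add = (+), smult = s\<rparr>"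

abbreviation ground_space :: "('k::field, 'k) module" where
  "ground_space \<equiv> space_of (*)"

definition fun_scale :: "'k::field \<Rightarrow> ('b \<Rightarrow> 'k) \<Rightarrow> ('b \<Rightarrow> 'k)" where
  "fun_scale c f = (\<lambda>x. c * f x)"

definition linear_maps ::
  "('k::field, 'm, 'y) module_scheme \<Rightarrow> ('k, 'n, 'z) module_scheme \<Rightarrow> ('m \<Rightarrow> 'n) set" where
  "linear_maps M N = {\<phi> \<in> hom (add_monoid M) (add_monoid N).
     \<forall>c. \<forall>v\<in>carrier M. \<phi> (c \<odot>\<^bsub>M\<^esub> v) = c \<odot>\<^bsub>N\<^esub> \<phi> v}"

text \<open>
  \<open>Hom\<^sub>\<Bbbk>(V, \<Bbbk>)\<close>.  Functionals are extended by zero off the carrier, so that they form a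
  space under pointwise operations and are determined by their values on the carrier.
\<close>

definition dual_space :: "('k::field, 'v, 'z) module_scheme \<Rightarrow> ('k, 'v \<Rightarrow> 'k) module" where
  "dual_space V = (space_of fun_scale)
     \<lparr>carrier := {f \<in> linear_maps V ground_space. \<forall>v. v \<notin> carrier V \<longrightarrow> f v = 0}\<rparr>"

definition transpose_map ::
  "('k::field, 'v, 'z) module_scheme \<Rightarrow> ('v \<Rightarrow> 'w) \<Rightarrow> ('w \<Rightarrow> 'k) \<Rightarrow> ('v \<Rightarrow> 'k)" where
  "transpose_map V \<phi> f = (\<lambda>v. if v \<in> carrier V then f (\<phi> v) else 0)"

definition lin_comb :: "('k::field, 'v, 'z) module_scheme \<Rightarrow> 'v set \<Rightarrow> ('v \<Rightarrow> 'k) \<Rightarrow> 'v" where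
  "lin_comb V B c = finsum V (\<lambda>b. c b \<odot>\<^bsub>V\<^esub> b) B"

definition finite_basis :: "('k::field, 'v, 'z) module_scheme \<Rightarrow> 'v set \<Rightarrow> bool" where
  "finite_basis V B \<longleftrightarrow> finite B \<and> B \<subseteq> carrier V \<and>
     bij_betw (lin_comb V B) (B \<rightarrow>\<^sub>E UNIV) (carrier V)"

definition fin_dim :: "('k::field, 'v, 'z) module_scheme \<Rightarrow> bool" where
  "fin_dim V \<longleftrightarrow> (\<exists>B. finite_basis V B)"

definition trace_on :: "('k::field, 'v, 'z) module_scheme \<Rightarrow> ('v \<Rightarrow> 'v) \<Rightarrow> 'k" where
  "trace_on V \<phi> = (let B = (SOME B. finite_basis V B)
     in \<Sum>b\<in>B. inv_into (B \<rightarrow>\<^sub>E UNIV) (lin_comb V B) (\<phi> b) b)"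

text \<open>
  \<open>X = \<Oplus>\<^bsub>i\<in>I\<^esub> U\<^sub>i\<close> inside \<open>M\<close>: the canonical map from the external direct sum
  (finitely supported families) is an isomorphism onto \<open>X\<close>.
\<close>

definition is_internal_direct_sum ::
  "('k::field, 'm, 'z) module_scheme \<Rightarrow> 'i set \<Rightarrow> ('i \<Rightarrow> 'm set) \<Rightarrow> 'm set \<Rightarrow> bool" where
  "is_internal_direct_sum M I U X \<longleftrightarrow>
     X \<subseteq> carrier M \<and> (\<forall>i\<in>I. submodule (U i) ground_ring M) \<and>
     (\<lambda>u. gfinprod (add_monoid M) u I)
       \<in> iso (sum_group I (\<lambda>i. add_monoid (M\<lparr>carrier := U i\<rparr>))) (add_monoid (M\<lparr>carrier := X\<rparr>))"


section \<open>Quotients of free abelian groups, and tensor products\<close>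

text \<open>
  The map induced on a quotient of a free abelian group by a map \<open>b\<close> from the generators to
  the abelian group \<open>G\<close>.  It is meaningful only if the induced map on the free group is constant
  on the coset.
\<close>

definition coset_lift ::
  "('g, 'z) monoid_scheme \<Rightarrow> ('a \<Rightarrow> 'g) \<Rightarrow> ('a \<Rightarrow>\<^sub>0 int) set \<Rightarrow> 'g" where
  "coset_lift G b A = the_elem
     ((\<lambda>x. finprod G (\<lambda>p. b p [^]\<^bsub>G\<^esub> Poly_Mapping.lookup x p) (Poly_Mapping.keys x)) ` A)"

type_synonym ('a, 'b) tensor = "(('a \<times> 'b) \<Rightarrow>\<^sub>0 int) set"

text \<open>
  The tensor product of \<open>M\<close> and \<open>N\<close> balanced over a set \<open>D\<close> of pairs \<open>(d, d')\<close>, where \<open>d\<close>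
  acts on \<open>M\<close> (from the right) and \<open>d'\<close> is the action of the same scalar on \<open>N\<close> (from the left).
\<close>

definition tensor_relators ::
  "('k, 'm, 'y) module_scheme \<Rightarrow> ('k, 'n, 'z) module_scheme \<Rightarrow> (('m \<Rightarrow> 'm) \<times> ('n \<Rightarrow> 'n)) set
     \<Rightarrow> (('m \<times> 'n) \<Rightarrow>\<^sub>0 int) set" where
  "tensor_relators M N D =
     {frag_of (x \<oplus>\<^bsub>M\<^esub> y, z) - frag_of (x, z) - frag_of (y, z) | x y z.
        x \<in> carrier M \<and> y \<in> carrier M \<and> z \<in> carrier N} \<union>
     {frag_of (x, y \<oplus>\<^bsub>N\<^esub> z) - frag_of (x, y) - frag_of (x, z) | x y z.
        x \<in> carrier M \<and> y \<in> carrier N \<and> z \<in> carrier N} \<union>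
     {frag_of (d x, y) - frag_of (x, d' y) | d d' x y.
        (d, d') \<in> D \<and> x \<in> carrier M \<and> y \<in> carrier N}"

definition tensor_subgroup ::
  "('k, 'm, 'y) module_scheme \<Rightarrow> ('k, 'n, 'z) module_scheme \<Rightarrow> (('m \<Rightarrow> 'm) \<times> ('n \<Rightarrow> 'n)) set
     \<Rightarrow> (('m \<times> 'n) \<Rightarrow>\<^sub>0 int) set" where
  "tensor_subgroup M N D =
     generate (free_Abelian_group (carrier M \<times> carrier N)) (tensor_relators M N D)"

definition tensor_group ::
  "('k, 'm, 'y) module_scheme \<Rightarrow> ('k, 'n, 'z) module_scheme \<Rightarrow> (('m \<Rightarrow> 'm) \<times> ('n \<Rightarrow> 'n)) set
     \<Rightarrow> ('m, 'n) tensor monoid" where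
  "tensor_group M N D =
     free_Abelian_group (carrier M \<times> carrier N) Mod tensor_subgroup M N D"

definition pure_tensor ::
  "('k, 'm, 'y) module_scheme \<Rightarrow> ('k, 'n, 'z) module_scheme \<Rightarrow> (('m \<Rightarrow> 'm) \<times> ('n \<Rightarrow> 'n)) set
     \<Rightarrow> 'm \<Rightarrow> 'n \<Rightarrow> ('m, 'n) tensor" where
  "pure_tensor M N D x y =
     tensor_subgroup M N D #>\<^bsub>free_Abelian_group (carrier M \<times> carrier N)\<^esub> frag_of (x, y)"

definition tensor_over ::
  "('k, 'm, 'y) module_scheme \<Rightarrow> ('k, 'n, 'z) module_scheme \<Rightarrow> (('m \<Rightarrow> 'm) \<times> ('n \<Rightarrow> 'n)) set
     \<Rightarrow> ('k, ('m, 'n) tensor) module" where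
  "tensor_over M N D = \<lparr>carrier = carrier (tensor_group M N D),
     monoid.mult = undefined, monoid.one = undefined,
     ring.zero = \<one>\<^bsub>tensor_group M N D\<^esub>, ring.add = mult (tensor_group M N D),
     smult = (\<lambda>c. coset_lift (tensor_group M N D) (\<lambda>(x, y). pure_tensor M N D (c \<odot>\<^bsub>M\<^esub> x) y))\<rparr>"

definition tensor_lift ::
  "('k, 'p, 'z) module_scheme \<Rightarrow> ('m \<Rightarrow> 'n \<Rightarrow> 'p) \<Rightarrow> ('m, 'n) tensor \<Rightarrow> 'p" where
  "tensor_lift P b = coset_lift (add_monoid P) (\<lambda>(x, y). b x y)"

definition scalar_pairs ::
  "('k, 'm, 'y) module_scheme \<Rightarrow> ('k, 'n, 'z) module_scheme \<Rightarrow> (('m \<Rightarrow> 'm) \<times> ('n \<Rightarrow> 'n)) set" where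
  "scalar_pairs M N = {(smult M c, smult N c) | c. True}"

definition tensor ::
  "('k, 'm, 'y) module_scheme \<Rightarrow> ('k, 'n, 'z) module_scheme \<Rightarrow> ('k, ('m, 'n) tensor) module" where
  "tensor M N = tensor_over M N (scalar_pairs M N)"

definition ptensor ::
  "('k, 'm, 'y) module_scheme \<Rightarrow> ('k, 'n, 'z) module_scheme \<Rightarrow> 'm \<Rightarrow> 'n \<Rightarrow> ('m, 'n) tensor" where
  "ptensor M N = pure_tensor M N (scalar_pairs M N)"


section \<open>Hopf algebras\<close>

record ('k, 'h) hopf =
  hscale :: "'k \<Rightarrow> 'h \<Rightarrow> 'h"
  comult :: "'h \<Rightarrow> ('h, 'h) tensor"
  counit :: "'h \<Rightarrow> 'k"
  antipode :: "'h \<Rightarrow> 'h"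

abbreviation hspace :: "('k::field, 'h::ring_1) hopf \<Rightarrow> ('k, 'h) module" where
  "hspace H \<equiv> space_of (hscale H)"

abbreviation hsquare :: "('k::field, 'h::ring_1) hopf \<Rightarrow> ('k, ('h, 'h) tensor) module" where
  "hsquare H \<equiv> tensor (hspace H) (hspace H)"

abbreviation hcube ::
  "('k::field, 'h::ring_1) hopf \<Rightarrow> ('k, ('h, ('h, 'h) tensor) tensor) module" where
  "hcube H \<equiv> tensor (hspace H) (hsquare H)"

abbreviation htens :: "('k::field, 'h::ring_1) hopf \<Rightarrow> 'h \<Rightarrow> 'h \<Rightarrow> ('h, 'h) tensor" where
  "htens H \<equiv> ptensor (hspace H) (hspace H)"

definition hsquare_mult ::
  "('k::field, 'h::ring_1) hopf \<Rightarrow> ('h, 'h) tensor \<Rightarrow> ('h, 'h) tensor \<Rightarrow> ('h, 'h) tensor" where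
  "hsquare_mult H X Y = tensor_lift (hsquare H)
     (\<lambda>a b. tensor_lift (hsquare H) (\<lambda>c d. htens H (a * c) (b * d)) Y) X"

text \<open>
  \<open>sweedler H M b h\<close> is \<open>\<Sum> b(h\<^sub>(\<^sub>1\<^sub>), h\<^sub>(\<^sub>2\<^sub>))\<close>, for a \<open>\<Bbbk>\<close>-bilinear \<open>b\<close> with values in \<open>M\<close>.
\<close>

definition sweedler ::
  "('k::field, 'h::ring_1) hopf \<Rightarrow> ('k, 'm, 'z) module_scheme \<Rightarrow> ('h \<Rightarrow> 'h \<Rightarrow> 'm) \<Rightarrow> 'h \<Rightarrow> 'm" where
  "sweedler H M b h = tensor_lift M b (comult H h)"

locale hopf_algebra =
  fixes H :: "('k::field, 'h::ring_1) hopf"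
  assumes hscale_space: "vector_space (hscale H)"
    and hscale_mult_left: "hscale H c x * y = hscale H c (x * y)"
    and hscale_mult_right: "x * hscale H c y = hscale H c (x * y)"
    and comult_linear: "comult H \<in> linear_maps (hspace H) (hsquare H)"
    and counit_linear: "counit H \<in> linear_maps (hspace H) ground_space"
    and coassoc:
      "sweedler H (hcube H)
         (\<lambda>x y. sweedler H (hcube H) (\<lambda>a b. ptensor (hspace H) (hsquare H) a (htens H b y)) x) h =
       sweedler H (hcube H) (\<lambda>x y. ptensor (hspace H) (hsquare H) x (comult H y)) h"
    and counit_left: "sweedler H (hspace H) (\<lambda>x y. hscale H (counit H x) y) h = h"
    and counit_right: "sweedler H (hspace H) (\<lambda>x y. hscale H (counit H y) x) h = h"
    and comult_mult: "comult H (x * y) = hsquare_mult H (comult H x) (comult H y)"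
    and comult_one: "comult H 1 = htens H 1 1"
    and counit_mult: "counit H (x * y) = counit H x * counit H y"
    and counit_one: "counit H 1 = 1"
    and antipode_linear: "antipode H \<in> linear_maps (hspace H) (hspace H)"
    and antipode_left:
      "sweedler H (hspace H) (\<lambda>x y. antipode H x * y) h = hscale H (counit H h) 1"
    and antipode_right:
      "sweedler H (hspace H) (\<lambda>x y. x * antipode H y) h = hscale H (counit H h) 1"

definition center :: "'h::ring_1 set" where
  "center = {z. \<forall>h. h * z = z * h}"


section \<open>Modules and bimodules\<close>

text \<open>
  The first argument of a left action and the second argument of a right action is the element
  of the algebra.
\<close>

definition left_module ::
  "('k::field, 'h::ring_1) hopf \<Rightarrow> ('k, 'm, 'z) module_scheme \<Rightarrow> ('h \<Rightarrow> 'm \<Rightarrow> 'm) \<Rightarrow> bool" where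
  "left_module H M l \<longleftrightarrow> Module.module ground_ring M \<and>
     (\<forall>h. l h \<in> linear_maps M M) \<and>
     (\<forall>v\<in>carrier M. (\<forall>h h'. l (h + h') v = l h v \<oplus>\<^bsub>M\<^esub> l h' v) \<and>
        (\<forall>c h. l (hscale H c h) v = c \<odot>\<^bsub>M\<^esub> l h v) \<and>
        (\<forall>h h'. l (h * h') v = l h (l h' v)) \<and> l 1 v = v)"

definition module_homs ::
  "('k::field, 'm, 'y) module_scheme \<Rightarrow> ('h \<Rightarrow> 'm \<Rightarrow> 'm)
     \<Rightarrow> ('k, 'n, 'z) module_scheme \<Rightarrow> ('h \<Rightarrow> 'n \<Rightarrow> 'n) \<Rightarrow> ('m \<Rightarrow> 'n) set" where
  "module_homs M l N l' = {\<phi> \<in> linear_maps M N. \<forall>h. \<forall>v\<in>carrier M. \<phi> (l h v) = l' h (\<phi> v)}"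

definition module_isos ::
  "('k::field, 'm, 'y) module_scheme \<Rightarrow> ('h \<Rightarrow> 'm \<Rightarrow> 'm)
     \<Rightarrow> ('k, 'n, 'z) module_scheme \<Rightarrow> ('h \<Rightarrow> 'n \<Rightarrow> 'n) \<Rightarrow> ('m \<Rightarrow> 'n) set" where
  "module_isos M l N l' = {\<phi> \<in> module_homs M l N l'. bij_betw \<phi> (carrier M) (carrier N)}"

definition left_submodule ::
  "'m set \<Rightarrow> ('k::field, 'm, 'z) module_scheme \<Rightarrow> ('h \<Rightarrow> 'm \<Rightarrow> 'm) \<Rightarrow> bool" where
  "left_submodule U M l \<longleftrightarrow> submodule U ground_ring M \<and> (\<forall>h. \<forall>u\<in>U. l h u \<in> U)"

definition simple_module :: "('k::field, 'm, 'z) module_scheme \<Rightarrow> ('h \<Rightarrow> 'm \<Rightarrow> 'm) \<Rightarrow> bool" where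
  "simple_module M l \<longleftrightarrow> carrier M \<noteq> {\<zero>\<^bsub>M\<^esub>} \<and>
     (\<forall>U. left_submodule U M l \<longrightarrow> U = {\<zero>\<^bsub>M\<^esub>} \<or> U = carrier M)"

definition simple_bimodule ::
  "('k::field, 'm, 'z) module_scheme \<Rightarrow> ('h \<Rightarrow> 'm \<Rightarrow> 'm) \<Rightarrow> ('m \<Rightarrow> 'h \<Rightarrow> 'm) \<Rightarrow> bool" where
  "simple_bimodule M l r \<longleftrightarrow> carrier M \<noteq> {\<zero>\<^bsub>M\<^esub>} \<and>
     (\<forall>U. left_submodule U M l \<and> (\<forall>h. \<forall>u\<in>U. r u h \<in> U) \<longrightarrow> U = {\<zero>\<^bsub>M\<^esub>} \<or> U = carrier M)"

definition semisimple_module :: "('k::field, 'm, 'z) module_scheme \<Rightarrow> ('h \<Rightarrow> 'm \<Rightarrow> 'm) \<Rightarrow> bool" where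
  "semisimple_module M l \<longleftrightarrow> (\<exists>\<S>.
     (\<forall>U\<in>\<S>. left_submodule U M l \<and> simple_module (M\<lparr>carrier := U\<rparr>) l) \<and>
     is_internal_direct_sum M \<S> (\<lambda>U. U) (carrier M))"

text \<open>\<open>(ad h)(b) = h\<^sub>(\<^sub>1\<^sub>) \<triangleright> b \<triangleleft> S(h\<^sub>(\<^sub>2\<^sub>))\<close> and \<open>h \<diamondop> b = S\<^sup>2(h\<^sub>(\<^sub>2\<^sub>)) \<triangleright> b \<triangleleft> S(h\<^sub>(\<^sub>1\<^sub>))\<close>.\<close>

definition ad_action ::
  "('k::field, 'h::ring_1) hopf \<Rightarrow> ('k, 'm, 'z) module_scheme \<Rightarrow> ('h \<Rightarrow> 'm \<Rightarrow> 'm) \<Rightarrow> ('m \<Rightarrow> 'h \<Rightarrow> 'm)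
     \<Rightarrow> 'h \<Rightarrow> 'm \<Rightarrow> 'm" where
  "ad_action H M l r h b = sweedler H M (\<lambda>x y. r (l x b) (antipode H y)) h"

definition diamond_action ::
  "('k::field, 'h::ring_1) hopf \<Rightarrow> ('k, 'm, 'z) module_scheme \<Rightarrow> ('h \<Rightarrow> 'm \<Rightarrow> 'm) \<Rightarrow> ('m \<Rightarrow> 'h \<Rightarrow> 'm)
     \<Rightarrow> 'h \<Rightarrow> 'm \<Rightarrow> 'm" where
  "diamond_action H M l r h b =
     sweedler H M (\<lambda>x y. r (l (antipode H (antipode H y)) b) (antipode H x)) h"


section \<open>Tensor categories of modules with finite duality\<close>

record ('k, 'h, 'v) hmod = "('k, 'v) module" +
  lact :: "'h \<Rightarrow> 'v \<Rightarrow> 'v"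

abbreviation hom_H :: "('k::field, 'h, 'v) hmod \<Rightarrow> ('k, 'h, 'v) hmod \<Rightarrow> ('v \<Rightarrow> 'v) set" where
  "hom_H V W \<equiv> module_homs V (lact V) W (lact W)"

definition isomorphic :: "('k::field, 'h, 'v) hmod \<Rightarrow> ('k, 'h, 'w) hmod \<Rightarrow> bool" where
  "isomorphic V W \<longleftrightarrow> module_isos V (lact V) W (lact W) \<noteq> {}"

abbreviation simple_hmod :: "('k::field, 'h, 'v) hmod \<Rightarrow> bool" where
  "simple_hmod V \<equiv> simple_module V (lact V)"

definition hmod_of :: "('k, 'v) module \<Rightarrow> ('h \<Rightarrow> 'v \<Rightarrow> 'v) \<Rightarrow> ('k, 'h, 'v) hmod" where
  "hmod_of M l = module.extend M \<lparr>lact = l\<rparr>"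

definition trivial_hmod :: "('k::field, 'h::ring_1) hopf \<Rightarrow> ('k, 'h, 'k) hmod" where
  "trivial_hmod H = hmod_of ground_space (\<lambda>h x. counit H h * x)"

definition sum_hmod ::
  "('k::field, 'h, 'v) hmod \<Rightarrow> ('k, 'h, 'w) hmod \<Rightarrow> ('k, 'h, 'v \<times> 'w) hmod" where
  "sum_hmod V W = \<lparr>carrier = carrier V \<times> carrier W,
     monoid.mult = undefined, monoid.one = undefined, ring.zero = (\<zero>\<^bsub>V\<^esub>, \<zero>\<^bsub>W\<^esub>),
     ring.add = (\<lambda>(v, w) (v', w'). (v \<oplus>\<^bsub>V\<^esub> v', w \<oplus>\<^bsub>W\<^esub> w')),
     smult = (\<lambda>c (v, w). (c \<odot>\<^bsub>V\<^esub> v, c \<odot>\<^bsub>W\<^esub> w)),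
     lact = (\<lambda>h (v, w). (lact V h v, lact W h w))\<rparr>"

text \<open>\<open>h \<triangleright> (v \<otimes> w) = (h\<^sub>(\<^sub>1\<^sub>) \<triangleright> v) \<otimes> (h\<^sub>(\<^sub>2\<^sub>) \<triangleright> w)\<close>\<close>

definition tensor_hmod ::
  "('k::field, 'h::ring_1) hopf \<Rightarrow> ('k, 'h, 'v) hmod \<Rightarrow> ('k, 'h, 'w) hmod
     \<Rightarrow> ('k, 'h, ('v, 'w) tensor) hmod" where
  "tensor_hmod H V W = hmod_of (tensor V W)
     (\<lambda>h. tensor_lift (tensor V W)
        (\<lambda>v w. sweedler H (tensor V W) (\<lambda>x y. ptensor V W (lact V x v) (lact W y w)) h))"

text \<open>
  A full abelian tensor subcategory of left \<open>H\<close>-modules is given by its set \<open>\<C>\<close> of objects.  The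
  objects have their carriers in an arbitrary but fixed type \<open>'v\<close>, and closure under the
  categorical operations is understood up to isomorphism.
\<close>

locale module_category = hopf_algebra H
  for H :: "('k::field, 'h::ring_1) hopf" +
  fixes \<C> :: "('k, 'h, 'v) hmod set"
  assumes object: "V \<in> \<C> \<Longrightarrow> left_module H V (lact V)"
    and closed_submodule: "V \<in> \<C> \<Longrightarrow> left_submodule U V (lact V) \<Longrightarrow> V\<lparr>carrier := U\<rparr> \<in> \<C>"
    and closed_quotient: "V \<in> \<C> \<Longrightarrow> left_submodule U V (lact V) \<Longrightarrow>
      \<exists>Q\<in>\<C>. \<exists>\<pi>\<in>hom_H V Q. \<pi> ` carrier V = carrier Q \<and> {v \<in> carrier V. \<pi> v = \<zero>\<^bsub>Q\<^esub>} = U"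
    and closed_sum: "V \<in> \<C> \<Longrightarrow> W \<in> \<C> \<Longrightarrow> \<exists>X\<in>\<C>. isomorphic (sum_hmod V W) X"
    and closed_unit: "\<exists>X\<in>\<C>. isomorphic (trivial_hmod H) X"
    and closed_tensor: "V \<in> \<C> \<Longrightarrow> W \<in> \<C> \<Longrightarrow> \<exists>X\<in>\<C>. isomorphic (tensor_hmod H V W) X"

text \<open>\<open>\<langle>v, f \<triangleleft> h\<rangle> = \<langle>h \<triangleright> v, f\<rangle>\<close>\<close>

definition dual_act :: "('k::field, 'h, 'v) hmod \<Rightarrow> ('v \<Rightarrow> 'k) \<Rightarrow> 'h \<Rightarrow> ('v \<Rightarrow> 'k)" where
  "dual_act V f h = transpose_map V (lact V h) f"

definition star_space ::
  "(('k::field, 'h, 'v) hmod \<Rightarrow> ('v \<Rightarrow> 'k) set) \<Rightarrow> ('k, 'h, 'v) hmod \<Rightarrow> ('k, 'v \<Rightarrow> 'k) module" where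
  "star_space star V = (dual_space V)\<lparr>carrier := star V\<rparr>"

text \<open>
  In \<open>star_tensor\<close>, \<open>\<psi>\<close> identifies the object \<open>X\<close> with \<open>V \<otimes> W\<close>, and the pairing of \<open>V \<otimes> W\<close>
  with \<open>W\<^sup>\<star> \<otimes> V\<^sup>\<star>\<close> is the nested one.  As \<open>\<theta>\<close> is determined by
  the pairing, its naturality in \<open>V\<close> and \<open>W\<close> is automatic, and so is its compatibility with the
  right action \<open>(g \<otimes> f) \<triangleleft> h = (g \<triangleleft> h\<^sub>(\<^sub>2\<^sub>)) \<otimes> (f \<triangleleft> h\<^sub>(\<^sub>1\<^sub>))\<close>.
\<close>

locale duality_category = module_category H \<C>
  for H :: "('k::field, 'h::ring_1) hopf" and \<C> :: "('k, 'h, 'v) hmod set" +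
  fixes star :: "('k, 'h, 'v) hmod \<Rightarrow> ('v \<Rightarrow> 'k) set"
  assumes star_submodule: "V \<in> \<C> \<Longrightarrow> submodule (star V) ground_ring (dual_space V)"
    and star_right_act: "V \<in> \<C> \<Longrightarrow> f \<in> star V \<Longrightarrow> dual_act V f h \<in> star V"
    and star_functorial:
      "V \<in> \<C> \<Longrightarrow> W \<in> \<C> \<Longrightarrow> \<phi> \<in> hom_H V W \<Longrightarrow> f \<in> star W \<Longrightarrow> transpose_map V \<phi> f \<in> star V"
    and star_full_iff: "V \<in> \<C> \<Longrightarrow> star V = carrier (dual_space V) \<longleftrightarrow> fin_dim V"
    and star_nondegenerate: "V \<in> \<C> \<Longrightarrow> v \<in> carrier V \<Longrightarrow> \<forall>f\<in>star V. f v = 0 \<Longrightarrow> v = \<zero>\<^bsub>V\<^esub>"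
    and star_tensor:
      "V \<in> \<C> \<Longrightarrow> W \<in> \<C> \<Longrightarrow> X \<in> \<C> \<Longrightarrow>
       \<psi> \<in> module_isos (tensor_hmod H V W) (lact (tensor_hmod H V W)) X (lact X) \<Longrightarrow>
       \<exists>\<theta>\<in>linear_maps (tensor (star_space star W) (star_space star V)) (star_space star X).
         bij_betw \<theta> (carrier (tensor (star_space star W) (star_space star V))) (star X) \<and>
         (\<forall>v\<in>carrier V. \<forall>w\<in>carrier W. \<forall>f\<in>star V. \<forall>g\<in>star W.
            \<theta> (ptensor (star_space star W) (star_space star V) g f) (\<psi> (ptensor V W v w)) = f v * g w)"

definition semisimple_category :: "('k::field, 'h, 'v) hmod set \<Rightarrow> bool" where
  "semisimple_category \<C> \<longleftrightarrow> (\<forall>V\<in>\<C>. semisimple_module V (lact V))"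

definition iso_class :: "('k::field, 'h, 'v) hmod set \<Rightarrow> ('k, 'h, 'v) hmod \<Rightarrow> ('k, 'h, 'v) hmod set" where
  "iso_class \<C> V = {W \<in> \<C>. isomorphic V W}"

definition simple_iso_classes :: "('k::field, 'h, 'v) hmod set \<Rightarrow> ('k, 'h, 'v) hmod set set" where
  "simple_iso_classes \<C> = {iso_class \<C> V | V. V \<in> \<C> \<and> simple_hmod V}"

definition class_rep :: "('k, 'h, 'v) hmod set \<Rightarrow> ('k, 'h, 'v) hmod" where
  "class_rep c = (SOME V. V \<in> c)"


section \<open>The bimodule of matrix coefficients\<close>

text \<open>
  \<open>V \<otimes>\<^bsub>D(V)\<^esub> V\<^sup>\<star>\<close>, where \<open>d \<in> D(V) = (End\<^sub>H V)\<^sup>o\<^sup>p\<close> acts on \<open>V\<close> from the right as the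
  endomorphism \<open>d\<close> and on \<open>V\<^sup>\<star>\<close> from the left as its transpose.
\<close>

definition endo_pairs ::
  "('k::field, 'h, 'v) hmod \<Rightarrow> (('v \<Rightarrow> 'v) \<times> (('v \<Rightarrow> 'k) \<Rightarrow> ('v \<Rightarrow> 'k))) set" where
  "endo_pairs V = {(d, transpose_map V d) | d. d \<in> hom_H V V}"

abbreviation coeff_tensor ::
  "(('k::field, 'h, 'v) hmod \<Rightarrow> ('v \<Rightarrow> 'k) set) \<Rightarrow> ('k, 'h, 'v) hmod \<Rightarrow> 'v \<Rightarrow> ('v \<Rightarrow> 'k)
     \<Rightarrow> ('v, 'v \<Rightarrow> 'k) tensor" where
  "coeff_tensor star V \<equiv> pure_tensor V (star_space star V) (endo_pairs V)"

definition coeff_space ::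
  "(('k::field, 'h, 'v) hmod \<Rightarrow> ('v \<Rightarrow> 'k) set) \<Rightarrow> ('k, 'h, 'v) hmod
     \<Rightarrow> ('k, ('v, 'v \<Rightarrow> 'k) tensor) module" where
  "coeff_space star V = tensor_over V (star_space star V) (endo_pairs V)"

definition coeff_lact ::
  "(('k::field, 'h, 'v) hmod \<Rightarrow> ('v \<Rightarrow> 'k) set) \<Rightarrow> ('k, 'h, 'v) hmod
     \<Rightarrow> 'h \<Rightarrow> ('v, 'v \<Rightarrow> 'k) tensor \<Rightarrow> ('v, 'v \<Rightarrow> 'k) tensor" where
  "coeff_lact star V h =
     tensor_lift (coeff_space star V) (\<lambda>v f. coeff_tensor star V (lact V h v) f)"

definition coeff_ract ::
  "(('k::field, 'h, 'v) hmod \<Rightarrow> ('v \<Rightarrow> 'k) set) \<Rightarrow> ('k, 'h, 'v) hmod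
     \<Rightarrow> ('v, 'v \<Rightarrow> 'k) tensor \<Rightarrow> 'h \<Rightarrow> ('v, 'v \<Rightarrow> 'k) tensor" where
  "coeff_ract star V x h =
     tensor_lift (coeff_space star V) (\<lambda>v f. coeff_tensor star V v (dual_act V f h)) x"

definition simple_coeff_bimodule ::
  "(('k::field, 'h, 'v) hmod \<Rightarrow> ('v \<Rightarrow> 'k) set) \<Rightarrow> ('k, 'h, 'v) hmod \<Rightarrow> bool" where
  "simple_coeff_bimodule star V \<longleftrightarrow>
     simple_bimodule (coeff_space star V) (coeff_lact star V) (coeff_ract star V)"

definition \<beta> ::
  "(('k::field, 'h, 'v) hmod \<Rightarrow> ('v \<Rightarrow> 'k) set) \<Rightarrow> ('k, 'h, 'v) hmod
     \<Rightarrow> ('v, 'v \<Rightarrow> 'k) tensor \<Rightarrow> 'h \<Rightarrow> 'k" where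
  "\<beta> star V = tensor_lift (space_of fun_scale) (\<lambda>v f h. f (lact V h v))"

definition Hst ::
  "(('k::field, 'h, 'v) hmod \<Rightarrow> ('v \<Rightarrow> 'k) set) \<Rightarrow> ('k, 'h, 'v) hmod \<Rightarrow> ('h \<Rightarrow> 'k) set" where
  "Hst star V = \<beta> star V ` carrier (coeff_space star V)"

definition HstC ::
  "('k::field, 'h, 'v) hmod set \<Rightarrow> (('k, 'h, 'v) hmod \<Rightarrow> ('v \<Rightarrow> 'k) set) \<Rightarrow> ('h \<Rightarrow> 'k) set" where
  "HstC \<C> star = Modules.module.span fun_scale (\<Union>V\<in>\<C>. Hst star V)"

text \<open>\<open>(h \<triangleright> \<xi> \<triangleleft> h')(x) = \<xi>(h' x h)\<close>\<close>

definition Hst_act :: "'h::ring_1 \<Rightarrow> ('h \<Rightarrow> 'k) \<Rightarrow> 'h \<Rightarrow> ('h \<Rightarrow> 'k)" where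
  "Hst_act h \<xi> h' = (\<lambda>x. \<xi> (h' * x * h))"

definition HstC_inv ::
  "('k::field, 'h::ring_1, 'v) hmod set \<Rightarrow> (('k, 'h, 'v) hmod \<Rightarrow> ('v \<Rightarrow> 'k) set) \<Rightarrow> ('h \<Rightarrow> 'k) set" where
  "HstC_inv \<C> star = {\<xi> \<in> HstC \<C> star. \<forall>h. Hst_act h \<xi> 1 = Hst_act 1 \<xi> h}"

definition conv ::
  "('k::field, 'h::ring_1) hopf \<Rightarrow> ('h \<Rightarrow> 'k) \<Rightarrow> ('h \<Rightarrow> 'k) \<Rightarrow> ('h \<Rightarrow> 'k)" where
  "conv H \<phi> \<xi> = sweedler H ground_space (\<lambda>x y. \<phi> x * \<xi> y)"

definition trace_character :: "('k::field, 'h, 'v) hmod \<Rightarrow> 'h \<Rightarrow> 'k" where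
  "trace_character V h = trace_on V (lact V h)"


section \<open>Completions of the tensor square\<close>

record ('k, 'h, 'c) completion =
  cscale :: "'k \<Rightarrow> 'c \<Rightarrow> 'c"
  incl :: "('h, 'h) tensor \<Rightarrow> 'c"
  slice :: "('h \<Rightarrow> 'k) \<Rightarrow> 'c \<Rightarrow> 'h"

text \<open>\<open>slice T f\<close> is \<open>f \<otimes> 1\<close>, defined on the completion for \<open>f \<in> H\<^sup>*\<^sub>\<C>\<close> and with values in \<open>H\<close>.\<close>

locale tensor_completion = duality_category H \<C> star
  for H :: "('k::field, 'h::ring_1) hopf" and \<C> :: "('k, 'h, 'v) hmod set"
    and star :: "('k, 'h, 'v) hmod \<Rightarrow> ('v \<Rightarrow> 'k) set" +
  fixes T :: "('k, 'h, 'c::ring_1) completion"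
  assumes cscale_space: "vector_space (cscale T)"
    and cscale_mult_left: "cscale T c X * Y = cscale T c (X * Y)"
    and cscale_mult_right: "X * cscale T c Y = cscale T c (X * Y)"
    and incl_linear: "incl T \<in> linear_maps (hsquare H) (space_of (cscale T))"
    and incl_inj: "inj_on (incl T) (carrier (hsquare H))"
    and incl_mult: "A \<in> carrier (hsquare H) \<Longrightarrow> B \<in> carrier (hsquare H) \<Longrightarrow>
      incl T (hsquare_mult H A B) = incl T A * incl T B"
    and incl_one: "incl T (htens H 1 1) = 1"
    and slice_linear: "f \<in> HstC \<C> star \<Longrightarrow> slice T f \<in> linear_maps (space_of (cscale T)) (hspace H)"
    and slice_add: "f \<in> HstC \<C> star \<Longrightarrow> g \<in> HstC \<C> star \<Longrightarrow>
      slice T (f + g) X = slice T f X + slice T g X"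
    and slice_scale: "f \<in> HstC \<C> star \<Longrightarrow> slice T (fun_scale c f) X = hscale H c (slice T f X)"
    and slice_incl: "f \<in> HstC \<C> star \<Longrightarrow> slice T f (incl T (htens H a b)) = hscale H (f a) b"
    and slice_bimodule: "f \<in> HstC \<C> star \<Longrightarrow>
      slice T f (incl T (htens H a b) * X * incl T (htens H a' b')) =
        b * slice T (Hst_act a' f a) X * b'"

definition \<Phi> :: "('k, 'h, 'c) completion \<Rightarrow> 'c \<Rightarrow> ('h \<Rightarrow> 'k) \<Rightarrow> 'h" where
  "\<Phi> T P f = slice T f P"

definition adapted :: "('k::field, 'h::ring_1) hopf \<Rightarrow> ('k, 'h, 'c::ring_1) completion \<Rightarrow> 'c set" where
  "adapted H T = {P. \<forall>h.
     P * incl T (sweedler H (hsquare H) (\<lambda>x y. htens H (antipode H (antipode H x)) y) h) =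
     incl T (comult H h) * P}"

definition multiplicative ::
  "('k::field, 'h::ring_1) hopf \<Rightarrow> ('k, 'h, 'v) hmod set \<Rightarrow> (('k, 'h, 'v) hmod \<Rightarrow> ('v \<Rightarrow> 'k) set)
     \<Rightarrow> ('k, 'h, 'c) completion \<Rightarrow> 'c set" where
  "multiplicative H \<C> star T = {P. \<forall>V\<in>\<C>. \<forall>W\<in>\<C>.
     Modules.module.span (hscale H) {a * b | a b. a \<in> \<Phi> T P ` Hst star V \<and> b \<in> \<Phi> T P ` Hst star W} \<subseteq>
     \<Phi> T P ` Modules.module.span fun_scale {conv H f g | f g. f \<in> Hst star V \<and> g \<in> Hst star W}}"

text \<open>The unit of the convolution algebra is the counit.\<close>

definition multiplicative0 ::
  "('k::field, 'h::ring_1) hopf \<Rightarrow> ('k, 'h, 'v) hmod set \<Rightarrow> (('k, 'h, 'v) hmod \<Rightarrow> ('v \<Rightarrow> 'k) set)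
     \<Rightarrow> ('k, 'h, 'c) completion \<Rightarrow> 'c set" where
  "multiplicative0 H \<C> star T = {P \<in> multiplicative H \<C> star T.
     \<Phi> T P ` HstC_inv \<C> star \<subseteq> center \<and> \<Phi> T P (counit H) = 1 \<and>
     (\<forall>f\<in>HstC_inv \<C> star. \<forall>g\<in>HstC_inv \<C> star.
        \<Phi> T P (f + g) = \<Phi> T P f + \<Phi> T P g \<and>
        \<Phi> T P (conv H f g) = \<Phi> T P f * \<Phi> T P g \<and>
        (\<forall>c. \<Phi> T P (fun_scale c f) = hscale H c (\<Phi> T P f)))}"

definition HVP ::
  "('k::field, 'h::ring_1) hopf \<Rightarrow> (('k, 'h, 'v) hmod \<Rightarrow> ('v \<Rightarrow> 'k) set)
     \<Rightarrow> ('k, 'h, 'c) completion \<Rightarrow> 'c \<Rightarrow> ('k, 'h, 'v) hmod \<Rightarrow> ('k, 'h) module" where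
  "HVP H star T P V = (hspace H)\<lparr>carrier := \<Phi> T P ` Hst star V\<rparr>"


section \<open>The Grothendieck group of the finite dimensional objects\<close>

definition fin_objects :: "('k::field, 'h, 'v) hmod set \<Rightarrow> ('k, 'h, 'v) hmod set" where
  "fin_objects \<C> = {V \<in> \<C>. fin_dim V}"

definition short_exact ::
  "('k::field, 'h, 'v) hmod \<Rightarrow> ('k, 'h, 'v) hmod \<Rightarrow> ('k, 'h, 'v) hmod \<Rightarrow> bool" where
  "short_exact U V W \<longleftrightarrow> (\<exists>\<phi>\<in>hom_H U V. \<exists>\<psi>\<in>hom_H V W. inj_on \<phi> (carrier U) \<and>
     \<phi> ` carrier U = {v \<in> carrier V. \<psi> v = \<zero>\<^bsub>W\<^esub>} \<and> \<psi> ` carrier V = carrier W)"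

definition K0 :: "('k::field, 'h, 'v) hmod set \<Rightarrow> (('k, 'h, 'v) hmod \<Rightarrow>\<^sub>0 int) set monoid" where
  "K0 \<C> = free_Abelian_group (fin_objects \<C>) Mod
     generate (free_Abelian_group (fin_objects \<C>))
       {frag_of V - frag_of U - frag_of W | U V W.
          U \<in> fin_objects \<C> \<and> V \<in> fin_objects \<C> \<and> W \<in> fin_objects \<C> \<and> short_exact U V W}"

definition center_group :: "('k::field, 'h::ring_1) hopf \<Rightarrow> 'h monoid" where
  "center_group H = \<lparr>carrier = center, monoid.mult = (+), monoid.one = 0\<rparr>"

text \<open>The map \<open>|V| \<mapsto> c\<^sub>V = \<Phi>\<^sub>P(z\<^sub>V)\<close>.\<close>

definition ch ::
  "('k::field, 'h::ring_1) hopf \<Rightarrow> ('k, 'h, 'c) completion \<Rightarrow> 'c \<Rightarrow> (('k, 'h, 'v) hmod \<Rightarrow>\<^sub>0 int) set \<Rightarrow> 'h" where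
  "ch H T P = coset_lift (center_group H) (\<lambda>V. \<Phi> T P (trace_character V))"

end

theory Submission
  imports Defs
begin

text \<open>
  Spelled out in \<open>H\<close>, adaptedness of \<open>P\<close> gives
  \<open>\<Sum> (S h\<^sub>1 \<otimes> 1) P (S\<^sup>2 h\<^sub>2 \<otimes> 1) = \<Sum> (1 \<otimes> h\<^sub>1) P (1 \<otimes> S h\<^sub>2)\<close>: insert \<open>h\<^sub>3\<close> and \<open>S h\<^sub>4\<close> to the right of
  \<open>P\<close>, move \<open>\<Delta>\<close> across \<open>P\<close>, and cancel \<open>S h\<^sub>1\<close> against \<open>h\<^sub>2\<close>.  Slicing with a functional, this says that
  \<open>\<Phi>\<^sub>P\<close> intertwines \<open>\<diamondop>\<close> and \<open>ad\<close>.  As the kernel of \<open>\<beta>\<^sub>V\<close> is a proper subbimodule, (a) follows.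

  For (b) and (c) the point is that the coefficient spaces \<open>H\<^sup>*\<^sub>V\<close> of pairwise non-isomorphic simple
  modules are independent in \<open>H\<^sup>*\<close>: as a left module \<open>H\<^sup>*\<^sub>V\<close> is a sum of copies of \<open>V\<close>.  In (c) the
  character of \<open>V\<close> lies in \<open>H\<^sup>*\<^sub>V\<close> and takes the value \<open>dim V \<noteq> 0\<close> at \<open>1\<close>, and composition series reduce
  every class in \<open>K\<^sub>0\<close> to a combination of simple ones, so a class with vanishing character is zero.
\<close>

section \<open>Quotients of free abelian groups\<close>

text \<open>Elements of tensor products and of \<open>K0\<close> are cosets without normal form, and
  maps out of them are read off with \<open>the_elem\<close>. Hence every formula in Sweedler
  notation needs a proof that the underlying map is balanced, and identities are checked on pure
  tensors only. In (a) the quotient \<open>V \<otimes> V\<^sup>\<star>\<close> over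
  \<open>D(V)\<close> is handled through \<beta>, which is injective there, so that equations are
  compared as functions on \<open>H\<close>. Independence in (b) and (c) uses only the left action
  on functions and no structure of endomorphism rings: two coefficient spaces that meet share a
  cyclic submodule, and a simple submodule inside it is recognised from both sides. In (c) the value
  \<open>dim V\<close> at 1 is an element of the field, which is where \<open>CHAR('k) = 0\<close>
  enters: in characteristic p, p times the class of the unit object is nonzero, dimension being
  additive, while its character vanishes. Lengths are bounded by the size of finite spanning
  families, and traces, defined by a chosen basis, are compared by the rule that the traces of
  \<open>\<sigma> \<rho>\<close> and \<open>\<rho> \<sigma>\<close> agree.\<close>

abbreviation "keys \<equiv> Poly_Mapping.keys"
abbreviation "lookup \<equiv> Poly_Mapping.lookup"

lemma keys_diff_subset:
  "keys x \<subseteq> S \<Longrightarrow> keys y \<subseteq> S \<Longrightarrow> keys (x - y :: _ \<Rightarrow>\<^sub>0 int) \<subseteq> S"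
  using keys_diff[of x y] by blast

text \<open>The extension of \<open>b\<close> to the free abelian group. \<open>coset_lift\<close>
  takes the image of a coset under exactly this map and extracts its element.\<close>

definition frag_lift :: "('g, 'z) monoid_scheme \<Rightarrow> ('a \<Rightarrow> 'g) \<Rightarrow> ('a \<Rightarrow>\<^sub>0 int) \<Rightarrow> 'g" where
  "frag_lift G b x = finprod G (\<lambda>p. b p [^]\<^bsub>G\<^esub> lookup x p) (keys x)"

text \<open>Extra indices contribute factors with exponent 0. This puts elements with different
  supports over a common index set, as additivity requires.\<close>

lemma (in comm_group) frag_lift_superset:
  assumes "b \<in> S \<rightarrow> carrier G" "finite K" "keys x \<subseteq> K" "K \<subseteq> S"
  shows "frag_lift G b x = finprod G (\<lambda>p. b p [^] lookup x p) K"
  unfolding frag_lift_def using assms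
  by (intro finprod_mono_neutral_cong_left) (auto simp: in_keys_iff Pi_iff subset_iff)

lemma (in comm_group) frag_lift_hom:
  assumes b: "b \<in> S \<rightarrow> carrier G"
  shows "frag_lift G b \<in> hom (free_Abelian_group S) G"
proof (rule homI)
  fix x y assume xy: "x \<in> carrier (free_Abelian_group S)" "y \<in> carrier (free_Abelian_group S)"
  let ?K = "keys x \<union> keys y"
  have K: "finite ?K" "?K \<subseteq> S" using xy by auto
  have c: "\<And>p. p \<in> ?K \<Longrightarrow> b p \<in> carrier G" using K b by auto
  have "frag_lift G b (x + y) = finprod G (\<lambda>p. b p [^] lookup (x + y) p) ?K"
    using K Poly_Mapping.keys_add[of x y] by (intro frag_lift_superset[OF b]) auto
  also have "\<dots> = finprod G (\<lambda>p. b p [^] lookup x p \<otimes> b p [^] lookup y p) ?K"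
    by (rule finprod_cong') (use c in \<open>auto simp: lookup_add int_pow_mult\<close>)
  also have "\<dots> = frag_lift G b x \<otimes> frag_lift G b y"
    using c frag_lift_superset[OF b, of ?K x] frag_lift_superset[OF b, of ?K y] K
    by (subst finprod_multf) (auto simp: Pi_iff)
  finally show "frag_lift G b (x \<otimes>\<^bsub>free_Abelian_group S\<^esub> y) = frag_lift G b x \<otimes> frag_lift G b y"
    by simp
next
  fix x assume "x \<in> carrier (free_Abelian_group S)"
  then show "frag_lift G b x \<in> carrier G"
    unfolding frag_lift_def using b by (intro finprod_closed) auto
qed

lemma (in comm_group) frag_lift_of:
  assumes "b p \<in> carrier G"
  shows "frag_lift G b (frag_of p) = b p"
  unfolding frag_lift_def using assms by (simp add: Pi_iff)

lemma (in comm_group) frag_lift_diff: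
  assumes "b \<in> S \<rightarrow> carrier G" "x \<in> carrier (free_Abelian_group S)" "y \<in> carrier (free_Abelian_group S)"
  shows "frag_lift G b (x - y) = frag_lift G b x \<otimes> inv (frag_lift G b y)"
proof -
  interpret h: group_hom "free_Abelian_group S" G "frag_lift G b"
    using frag_lift_hom[OF assms(1)] by (simp add: group_hom_def group_hom_axioms_def is_group)
  have "frag_lift G b (x \<otimes>\<^bsub>free_Abelian_group S\<^esub> inv\<^bsub>free_Abelian_group S\<^esub> y) = frag_lift G b x \<otimes> inv (frag_lift G b y)"
    using assms h.hom_mult h.hom_inv h.G.inv_closed by presburger
  then show ?thesis using assms by simp
qed

lemma coset_lift_alt: "coset_lift G b A = the_elem (frag_lift G b ` A)"
  by (simp add: coset_lift_def frag_lift_def)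

text \<open>Serves both kinds of quotient in the development: tensor products, with
  \<open>tensor_relators\<close>, and the Grothendieck group, with
  \<open>exact_relators\<close>.\<close>

locale free_quotient =
  fixes S :: "'a set" and rel :: "('a \<Rightarrow>\<^sub>0 int) set"
  assumes rel: "rel \<subseteq> carrier (free_Abelian_group S)"
begin

abbreviation "F \<equiv> free_Abelian_group S"
abbreviation "R \<equiv> generate F rel"
abbreviation "cls x \<equiv> R #>\<^bsub>F\<^esub> x"

lemma normal_R: "R \<lhd> F"
  using rel by (simp add: abelian_free_Abelian_group comm_group.normal_iff_subgroup group.generate_is_subgroup)

lemma comm_quotient: "comm_group (F Mod R)"
proof -
  interpret comm_group F by (rule abelian_free_Abelian_group)
  interpret normal R F by (rule normal_R)
  show ?thesis
    using abelian_FactGroup is_subgroup by blast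
qed

lemma coset_mult: "x \<in> carrier F \<Longrightarrow> y \<in> carrier F \<Longrightarrow>
    (cls x) \<otimes>\<^bsub>F Mod R\<^esub> (cls y) = cls (x + y)"
  using normal.rcos_sum[OF normal_R, of x y] by (simp add: FactGroup_def)

lemma coset_in: "x \<in> carrier F \<Longrightarrow> cls x \<in> carrier (F Mod R)"
  by (auto simp: FactGroup_def RCOSETS_def)

lemma cls_zero: "cls 0 = \<one>\<^bsub>F Mod R\<^esub>"
  by (simp add: r_coset_def)

lemma coset_cases:
  assumes "X \<in> carrier (F Mod R)"
  obtains x where "x \<in> carrier F" "X = cls x"
  using assms by (auto simp: FactGroup_def RCOSETS_def)

lemma coset_eqI:
  assumes "x \<in> carrier F" "y \<in> carrier F" "x - y \<in> R"
  shows "cls x = cls y"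
proof -
  interpret group F by simp
  interpret normal R F by (rule normal_R)
  have "x \<otimes>\<^bsub>F\<^esub> inv\<^bsub>F\<^esub> y \<in> R" using assms by simp
  then show ?thesis
    using assms is_subgroup repr_independence[of x R y] by (metis rcos_module_rev is_group)
qed

lemma diff_in_R: "x \<in> R \<Longrightarrow> y \<in> R \<Longrightarrow> x - y \<in> R"
proof -
  assume a: "x \<in> R" "y \<in> R"
  interpret group F by simp
  have s: "subgroup R F" using rel by (rule generate_is_subgroup)
  have "y \<in> carrier F" using a s subgroup.mem_carrier by metis
  then show ?thesis using subgroup.m_closed[OF s a(1) subgroup.m_inv_closed[OF s a(2)]] by simp
qed

lemma zero_in_R: "0 \<in> R"
  using generate.one[of F rel] by simp

lemma add_in_R: "x \<in> R \<Longrightarrow> y \<in> R \<Longrightarrow> x + y \<in> R"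
  using generate.eng[of x F rel y] by simp

lemma R_carrier: "x \<in> R \<Longrightarrow> x \<in> carrier F"
  using rel group.generate_in_carrier[of F rel x] by (metis group_free_Abelian_group)

lemma lift_R:
  assumes G: "comm_group G" and b: "b \<in> S \<rightarrow> carrier G"
    and kill: "\<And>r. r \<in> rel \<Longrightarrow> frag_lift G b r = \<one>\<^bsub>G\<^esub>" and x: "x \<in> R"
  shows "frag_lift G b x = \<one>\<^bsub>G\<^esub>"
proof -
  interpret comm_group G by (rule G)
  interpret h: group_hom F G "frag_lift G b"
    using frag_lift_hom[OF b] by (simp add: group_hom_def group_hom_axioms_def is_group)
  show ?thesis using x
  proof (induction)
    case (inv r)
    then show ?case using rel kill h.hom_inv by (metis inv_one subset_iff)
  next
    case (eng h1 h2)
    then show ?case using h.hom_mult R_carrier by (metis one_closed r_one)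
  qed (auto simp: kill simp del: one_free_Abelian_group)
qed

text \<open>The lift kills \<open>R\<close> as soon as it kills the relators, so it is constant on
  each coset; since 0 lies in \<open>R\<close> the coset is nonempty, and \<open>the_elem\<close>
  finds a singleton.\<close>

lemma coset_lift_coset:
  assumes G: "comm_group G" and b: "b \<in> S \<rightarrow> carrier G"
    and kill: "\<And>r. r \<in> rel \<Longrightarrow> frag_lift G b r = \<one>\<^bsub>G\<^esub>" and x: "x \<in> carrier F"
  shows "coset_lift G b (cls x) = frag_lift G b x"
proof -
  interpret comm_group G by (rule G)
  have h: "frag_lift G b \<in> hom F G" by (rule frag_lift_hom[OF b])
  have "frag_lift G b (r + x) = frag_lift G b x" if "r \<in> R" for r
    using hom_mult[OF h R_carrier[OF that] x] lift_R[OF G b kill that] hom_in_carrier[OF h x]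
    by simp
  then have "frag_lift G b ` (cls x) \<subseteq> {frag_lift G b x}"
    by (auto simp: r_coset_def)
  moreover have "cls x \<noteq> {}" using zero_in_R by (auto simp: r_coset_def)
  ultimately have "frag_lift G b ` (cls x) = {frag_lift G b x}"
    using subset_singletonD[of "frag_lift G b ` (cls x)"] by simp
  then show ?thesis by (simp add: coset_lift_alt)
qed

lemma coset_lift_hom:
  assumes G: "comm_group G" and b: "b \<in> S \<rightarrow> carrier G"
    and kill: "\<And>r. r \<in> rel \<Longrightarrow> frag_lift G b r = \<one>\<^bsub>G\<^esub>"
  shows "coset_lift G b \<in> hom (F Mod R) G"
proof (rule homI)
  interpret comm_group G by (rule G)
  have h: "frag_lift G b \<in> hom F G" by (rule frag_lift_hom[OF b])
  fix X assume "X \<in> carrier (F Mod R)"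
  then obtain x where x: "x \<in> carrier F" "X = cls x" by (rule coset_cases)
  then show "coset_lift G b X \<in> carrier G"
    using coset_lift_coset[OF G b kill] hom_in_carrier[OF h] by simp
  fix Y assume "Y \<in> carrier (F Mod R)"
  then obtain y where y: "y \<in> carrier F" "Y = cls y" by (rule coset_cases)
  have "x + y \<in> carrier F" using x y Poly_Mapping.keys_add[of x y] by auto
  then show "coset_lift G b (X \<otimes>\<^bsub>F Mod R\<^esub> Y) = coset_lift G b X \<otimes>\<^bsub>G\<^esub> coset_lift G b Y"
    using x y hom_mult[OF h x(1) y(1)] coset_lift_coset[OF G b kill] coset_mult[OF x(1) y(1)]
    by (simp del: mult_FactGroup)
qed

end

section \<open>Balanced maps and tensor products\<close>

text \<open>Dresses a multiplicative group as a module record, so that \<open>balanced\<close>,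
  which speaks of addition in the target, also covers maps into the group \<open>TG\<close>.\<close>

abbreviation "additive_space G \<equiv>
  \<lparr>carrier = carrier G, monoid.mult = undefined, monoid.one = undefined, ring.zero = \<one>\<^bsub>G\<^esub>, ring.add = mult G\<rparr>"

text \<open>Scalar multiplication of \<open>Q\<close> does not occur. For
  \<open>D = scalar_pairs\<close> only the passage of scalars from one argument to the other is
  demanded, so the lifts are merely additive and linearity is proved where it is wanted.\<close>

definition balanced where
  "balanced M N D Q b \<longleftrightarrow>
     (\<forall>x\<in>carrier M. \<forall>y\<in>carrier N. b x y \<in> carrier Q) \<and>
     (\<forall>x\<in>carrier M. \<forall>x'\<in>carrier M. \<forall>y\<in>carrier N. b (x \<oplus>\<^bsub>M\<^esub> x') y = b x y \<oplus>\<^bsub>Q\<^esub> b x' y) \<and>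
     (\<forall>x\<in>carrier M. \<forall>y\<in>carrier N. \<forall>y'\<in>carrier N. b x (y \<oplus>\<^bsub>N\<^esub> y') = b x y \<oplus>\<^bsub>Q\<^esub> b x y') \<and>
     (\<forall>(d, d')\<in>D. \<forall>x\<in>carrier M. \<forall>y\<in>carrier N. b (d x) y = b x (d' y))"

lemma balancedI:
  assumes "\<And>x y. x \<in> carrier M \<Longrightarrow> y \<in> carrier N \<Longrightarrow> b x y \<in> carrier Q"
    and "\<And>x x' y. x \<in> carrier M \<Longrightarrow> x' \<in> carrier M \<Longrightarrow> y \<in> carrier N \<Longrightarrow> b (x \<oplus>\<^bsub>M\<^esub> x') y = b x y \<oplus>\<^bsub>Q\<^esub> b x' y"
    and "\<And>x y y'. x \<in> carrier M \<Longrightarrow> y \<in> carrier N \<Longrightarrow> y' \<in> carrier N \<Longrightarrow> b x (y \<oplus>\<^bsub>N\<^esub> y') = b x y \<oplus>\<^bsub>Q\<^esub> b x y'"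
    and "\<And>d d' x y. (d, d') \<in> D \<Longrightarrow> x \<in> carrier M \<Longrightarrow> y \<in> carrier N \<Longrightarrow> b (d x) y = b x (d' y)"
  shows "balanced M N D Q b"
  using assms unfolding balanced_def by blast

lemma balanced_closed: "balanced M N D Q b \<Longrightarrow> x \<in> carrier M \<Longrightarrow> y \<in> carrier N \<Longrightarrow> b x y \<in> carrier Q"
  unfolding balanced_def by blast

locale balanced_tensor = M: abelian_group M + N: abelian_group N
  for M :: "('k, 'm, 'y) module_scheme" and N :: "('k, 'n, 'z) module_scheme" +
  fixes D :: "(('m \<Rightarrow> 'm) \<times> ('n \<Rightarrow> 'n)) set"
  assumes D_closed: "(d, d') \<in> D \<Longrightarrow> x \<in> carrier M \<Longrightarrow> d x \<in> carrier M"
    "(d, d') \<in> D \<Longrightarrow> y \<in> carrier N \<Longrightarrow> d' y \<in> carrier N"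
begin

abbreviation "TG \<equiv> tensor_group M N D"
abbreviation "pt \<equiv> pure_tensor M N D"

sublocale fq: free_quotient "carrier M \<times> carrier N" "tensor_relators M N D"
proof
  show "tensor_relators M N D \<subseteq> carrier (free_Abelian_group (carrier M \<times> carrier N))"
    unfolding tensor_relators_def using D_closed
    by (intro Un_least subsetI; elim CollectE exE conjE; simp add: keys_diff_subset)
qed

lemma TG_alt: "TG = free_Abelian_group (carrier M \<times> carrier N) Mod fq.R"
  by (simp add: tensor_group_def tensor_subgroup_def)

lemma pt_alt: "pt x y = fq.cls (frag_of (x, y))"
  by (simp add: pure_tensor_def tensor_subgroup_def)

lemma TG_comm: "comm_group TG"
  unfolding TG_alt by (rule fq.comm_quotient)

lemma pt_closed: "x \<in> carrier M \<Longrightarrow> y \<in> carrier N \<Longrightarrow> pt x y \<in> carrier TG"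
  unfolding TG_alt pt_alt by (rule fq.coset_in) simp

lemma pt_sum:
  assumes r: "frag_of p - frag_of q - frag_of r \<in> tensor_relators M N D"
    and S: "p \<in> carrier M \<times> carrier N" "q \<in> carrier M \<times> carrier N" "r \<in> carrier M \<times> carrier N"
  shows "fq.cls (frag_of p) = fq.cls (frag_of q) \<otimes>\<^bsub>TG\<^esub> fq.cls (frag_of r)"
proof -
  have *: "frag_of p - (frag_of q + frag_of r) \<in> fq.R"
    using generate.incl[OF r] by (simp add: diff_diff_eq)
  have "frag_of q + frag_of r \<in> carrier fq.F"
    using S Poly_Mapping.keys_add[of "frag_of q" "frag_of r"] by auto
  then show ?thesis
    unfolding TG_alt using S fq.coset_eqI[OF _ _ *] by (simp add: fq.coset_mult del: mult_FactGroup)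
qed

lemma pt_add_left:
  assumes "x \<in> carrier M" "x' \<in> carrier M" "y \<in> carrier N"
  shows "pt (x \<oplus>\<^bsub>M\<^esub> x') y = pt x y \<otimes>\<^bsub>TG\<^esub> pt x' y"
  unfolding pt_alt by (rule pt_sum) (use assms in \<open>unfold tensor_relators_def, blast, auto\<close>)

lemma pt_add_right:
  assumes "x \<in> carrier M" "y \<in> carrier N" "y' \<in> carrier N"
  shows "pt x (y \<oplus>\<^bsub>N\<^esub> y') = pt x y \<otimes>\<^bsub>TG\<^esub> pt x y'"
  unfolding pt_alt by (rule pt_sum) (use assms in \<open>unfold tensor_relators_def, blast, auto\<close>)

lemma pt_balanced:
  assumes "(d, d') \<in> D" "x \<in> carrier M" "y \<in> carrier N"
  shows "pt (d x) y = pt x (d' y)"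
proof -
  have "frag_of (d x, y) - frag_of (x, d' y) \<in> tensor_relators M N D"
    using assms unfolding tensor_relators_def by blast
  then have "frag_of (d x, y) - frag_of (x, d' y) \<in> fq.R" by (rule generate.incl)
  then show ?thesis
    unfolding pt_alt using assms D_closed by (intro fq.coset_eqI) auto
qed

lemma TG_one: "y \<in> carrier N \<Longrightarrow> pt \<zero>\<^bsub>M\<^esub> y = \<one>\<^bsub>TG\<^esub>"
proof -
  interpret comm_group TG by (rule TG_comm)
  show "y \<in> carrier N \<Longrightarrow> pt \<zero>\<^bsub>M\<^esub> y = \<one>\<^bsub>TG\<^esub>"
    using pt_add_left[of "\<zero>\<^bsub>M\<^esub>" "\<zero>\<^bsub>M\<^esub>" y] pt_closed[of "\<zero>\<^bsub>M\<^esub>" y] by (simp add: l_cancel_one')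
qed

lemma pt_inv: "x \<in> carrier M \<Longrightarrow> y \<in> carrier N \<Longrightarrow> inv\<^bsub>TG\<^esub> (pt x y) = pt (\<ominus>\<^bsub>M\<^esub> x) y"
proof -
  interpret comm_group TG by (rule TG_comm)
  assume a: "x \<in> carrier M" "y \<in> carrier N"
  show ?thesis
    using a pt_add_left[of "\<ominus>\<^bsub>M\<^esub> x" x y] TG_one[of y] pt_closed
    by (metis M.a_inv_closed M.l_neg inv_equality)
qed

text \<open>Negatives need no case of their own: the inverse of a pure tensor is again pure, by
  \<open>pt_inv\<close>.\<close>

lemma tensor_induct [consumes 1, case_names pure add]:
  assumes X: "X \<in> carrier TG"
    and pure: "\<And>x y. x \<in> carrier M \<Longrightarrow> y \<in> carrier N \<Longrightarrow> Q (pt x y)"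
    and add: "\<And>X Y. X \<in> carrier TG \<Longrightarrow> Y \<in> carrier TG \<Longrightarrow> Q X \<Longrightarrow> Q Y \<Longrightarrow> Q (X \<otimes>\<^bsub>TG\<^esub> Y)"
  shows "Q X"
proof -
  interpret comm_group TG by (rule TG_comm)
  have inv: "Q (inv\<^bsub>TG\<^esub> (pt x y))" if "x \<in> carrier M" "y \<in> carrier N" for x y
    using that pure pt_inv by simp
  obtain x where x: "x \<in> carrier fq.F" and X': "X = fq.cls x"
    using X unfolding TG_alt by (rule fq.coset_cases)
  from x have k: "keys x \<subseteq> carrier M \<times> carrier N" by simp
  \<comment> \<open>Induction on the free group proceeds by differences, so the property is carried
    along for the inverse as well.\<close>
  have "Q (fq.cls x) \<and> Q (inv\<^bsub>TG\<^esub> (fq.cls x))"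
    using k
  proof (induction rule: free_Abelian_group_induct[consumes 1])
    case 1
    have "fq.cls 0 = \<one>\<^bsub>TG\<^esub>" unfolding TG_alt by (rule fq.cls_zero)
    moreover have "Q \<one>\<^bsub>TG\<^esub>" using pure[of "\<zero>\<^bsub>M\<^esub>" "\<zero>\<^bsub>N\<^esub>"] TG_one[of "\<zero>\<^bsub>N\<^esub>"] by simp
    ultimately show ?case by simp
  next
    case (2 x y)
    have xy: "x \<in> carrier fq.F" "y \<in> carrier fq.F" "x - y \<in> carrier fq.F" using 2 keys_diff[of x y] by auto
    have in': "fq.cls x \<in> carrier TG" "fq.cls y \<in> carrier TG" "fq.cls (x-y) \<in> carrier TG"
      using xy fq.coset_in unfolding TG_alt by blast+
    have "(fq.cls (x - y)) \<otimes>\<^bsub>TG\<^esub> (fq.cls y) = fq.cls x"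
      using fq.coset_mult[OF xy(3,2)] unfolding TG_alt by simp
    then have e: "fq.cls (x - y) = fq.cls x \<otimes>\<^bsub>TG\<^esub> inv\<^bsub>TG\<^esub> (fq.cls y)"
      using in' inv_solve_right by metis
    then have e2: "inv\<^bsub>TG\<^esub> (fq.cls (x - y)) = (fq.cls y) \<otimes>\<^bsub>TG\<^esub> inv\<^bsub>TG\<^esub> (fq.cls x)"
      using in' by (simp add: inv_mult_group)
    show ?case unfolding e2 unfolding e using add in' 2 by auto
  next
    case (3 a)
    then show ?case using pure inv by (auto simp flip: pt_alt)
  qed
  then show ?thesis using X' by simp
qed

lemma hom_ext:
  assumes "f \<in> hom TG G" "g \<in> hom TG G" "X \<in> carrier TG"
    and "\<And>x y. x \<in> carrier M \<Longrightarrow> y \<in> carrier N \<Longrightarrow> f (pt x y) = g (pt x y)"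
  shows "f X = g X"
  using assms(3) by (induction rule: tensor_induct) (simp_all add: assms(4) hom_mult[OF assms(1)] hom_mult[OF assms(2)])

context
  fixes G (structure) and b
  assumes G: "comm_group G" and b: "balanced M N D (additive_space G) b"
begin

interpretation comm_group G by (rule G)

lemma frag_lift_relator: "r \<in> tensor_relators M N D \<Longrightarrow> frag_lift G (\<lambda>(x, y). b x y) r = \<one>"
proof -
  assume r: "r \<in> tensor_relators M N D"
  let ?b = "\<lambda>(x, y). b x y" and ?S = "carrier M \<times> carrier N"
  have bb: "?b \<in> ?S \<rightarrow> carrier G" using b by (auto simp: balanced_def)
  have of: "frag_lift G ?b (frag_of (x, y)) = b x y" if "x \<in> carrier M" "y \<in> carrier N" for x y
    using frag_lift_of[of ?b "(x, y)"] that b by (auto simp: balanced_def)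
  have c: "b x y \<in> carrier G" if "x \<in> carrier M" "y \<in> carrier N" for x y
    using that b by (auto simp: balanced_def)
  have mm: "u \<otimes> v \<otimes> inv u \<otimes> inv v = \<one>" if "u \<in> carrier G" "v \<in> carrier G" for u v
  proof -
    have "u \<otimes> v \<otimes> inv u \<otimes> inv v = (u \<otimes> v) \<otimes> inv (u \<otimes> v)"
      unfolding inv_mult[OF that] using that by (simp add: m_assoc)
    then show ?thesis using that by simp
  qed
  have fl: "frag_lift G ?b (frag_of (x, y) - frag_of (x', y')) = b x y \<otimes> inv (b x' y')"
    if "x \<in> carrier M" "y \<in> carrier N" "x' \<in> carrier M" "y' \<in> carrier N" for x y x' y'
    using that frag_lift_diff[OF bb, of "frag_of (x, y)" "frag_of (x', y')"] by (simp add: of)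
  have fl3: "frag_lift G ?b (frag_of (x, y) - frag_of (x', y') - frag_of (u, v)) = b x y \<otimes> inv (b x' y') \<otimes> inv (b u v)"
    if "x \<in> carrier M" "y \<in> carrier N" "x' \<in> carrier M" "y' \<in> carrier N" "u \<in> carrier M" "v \<in> carrier N" for x y x' y' u v
    using that frag_lift_diff[OF bb, of "frag_of (x, y) - frag_of (x', y')" "frag_of (u, v)"] keys_diff_subset[of "frag_of (x, y)" ?S "frag_of (x', y')"]
    by (simp add: of fl)
  from r show ?thesis
    unfolding tensor_relators_def
  proof (elim UnE CollectE exE conjE)
    fix e e' x y
    assume d: "r = frag_of (e x, y) - frag_of (x, e' y)" "(e, e') \<in> D" "x \<in> carrier M" "y \<in> carrier N"
    have "b (e x) y = b x (e' y)" using d b by (auto simp: balanced_def)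
    then show ?thesis using d D_closed c by (simp add: fl)
  qed (use b c in \<open>simp_all add: fl3 mm balanced_def\<close>)
qed

lemma b_closed: "(\<lambda>(x, y). b x y) \<in> carrier M \<times> carrier N \<rightarrow> carrier G"
  using balanced_closed[OF b] by auto

lemma coset_lift_tensor_hom: "coset_lift G (\<lambda>(x, y). b x y) \<in> hom TG G"
  unfolding TG_alt by (rule fq.coset_lift_hom[OF G b_closed frag_lift_relator])

lemma coset_lift_tensor_pure:
  "x \<in> carrier M \<Longrightarrow> y \<in> carrier N \<Longrightarrow> coset_lift G (\<lambda>(x, y). b x y) (pt x y) = b x y"
  unfolding pt_alt using fq.coset_lift_coset[OF G b_closed frag_lift_relator, of "frag_of (x, y)"]
    frag_lift_of[of "\<lambda>(x, y). b x y" "(x, y)"] balanced_closed[OF b] by simp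

end

lemma tensor_lift_hom:
  assumes "abelian_group Q" "balanced M N D Q b"
  shows "tensor_lift Q b \<in> hom TG (add_monoid Q)"
  unfolding tensor_lift_def using assms(2)
  by (intro coset_lift_tensor_hom abelian_group.a_comm_group[OF assms(1)]) (simp add: balanced_def)

lemma tensor_lift_pure:
  assumes "abelian_group Q" "balanced M N D Q b" "x \<in> carrier M" "y \<in> carrier N"
  shows "tensor_lift Q b (pt x y) = b x y"
  unfolding tensor_lift_def using assms(2-4)
  by (intro coset_lift_tensor_pure abelian_group.a_comm_group[OF assms(1)]) (simp_all add: balanced_def)

lemma tensor_over_fields:
  "carrier (tensor_over M N D) = carrier TG" "add (tensor_over M N D) = mult TG"
  "\<zero>\<^bsub>tensor_over M N D\<^esub> = \<one>\<^bsub>TG\<^esub>"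
  by (simp_all add: tensor_over_def)

lemma hom_tensor_over:
  "hom (add_monoid (tensor_over M N D)) G = hom TG G"
  "hom G (add_monoid (tensor_over M N D)) = hom G TG"
  by (simp_all add: hom_def tensor_over_fields)

lemma abelian_group_tensor_over: "abelian_group (tensor_over M N D)"
proof -
  interpret comm_group TG by (rule TG_comm)
  show ?thesis
    by (rule abelian_groupI; simp only: tensor_over_fields)
      (simp_all only: m_assoc l_one m_closed one_closed l_inv_ex, rule m_comm)
qed

context
  assumes sm: "\<And>c. smult M c \<in> hom (add_monoid M) (add_monoid M)"
    and smD: "\<And>c d d' x. (d, d') \<in> D \<Longrightarrow> x \<in> carrier M \<Longrightarrow> c \<odot>\<^bsub>M\<^esub> d x = d (c \<odot>\<^bsub>M\<^esub> x)"
begin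

text \<open>Scalars act through the left factor, and the balancing relation survives because every
  \<open>d\<close> in \<open>D\<close> commutes with them (\<open>smD\<close>).\<close>

lemma smult_balanced: 
  "balanced M N D (additive_space TG) (\<lambda>x y. pt (c \<odot>\<^bsub>M\<^esub> x) y)"
proof -
  have c: "c \<odot>\<^bsub>M\<^esub> x \<in> carrier M" if "x \<in> carrier M" for x
    using hom_in_carrier[OF sm[of c], of x] that by simp
  have a: "c \<odot>\<^bsub>M\<^esub> (x \<oplus>\<^bsub>M\<^esub> y) = c \<odot>\<^bsub>M\<^esub> x \<oplus>\<^bsub>M\<^esub> c \<odot>\<^bsub>M\<^esub> y" if "x \<in> carrier M" "y \<in> carrier M" for x y
    using hom_mult[OF sm[of c], of x y] that by simp
  show ?thesis
  proof (rule balancedI)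
    fix d d' x y assume "(d, d') \<in> D" "x \<in> carrier M" "y \<in> carrier N"
    then show "pt (c \<odot>\<^bsub>M\<^esub> d x) y = pt (c \<odot>\<^bsub>M\<^esub> x) (d' y)"
      using pt_balanced[of d d' "c \<odot>\<^bsub>M\<^esub> x" y] smD[of d d' x c] c by metis
  qed (simp_all add: c a pt_closed pt_add_left pt_add_right)
qed

lemma smult_tensor_alt:
  "smult (tensor_over M N D) c = coset_lift TG (\<lambda>(x, y). pt (c \<odot>\<^bsub>M\<^esub> x) y)"
  unfolding tensor_over_def module.simps ..

lemma smult_tensor_hom: "smult (tensor_over M N D) c \<in> hom TG TG"
  unfolding smult_tensor_alt by (rule coset_lift_tensor_hom[where b = "\<lambda>x y. pt (c \<odot>\<^bsub>M\<^esub> x) y", OF TG_comm smult_balanced])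

lemma smult_tensor_pure: "x \<in> carrier M \<Longrightarrow> y \<in> carrier N \<Longrightarrow> smult (tensor_over M N D) c (pt x y) = pt (c \<odot>\<^bsub>M\<^esub> x) y"
  unfolding smult_tensor_alt by (rule coset_lift_tensor_pure[where b = "\<lambda>x y. pt (c \<odot>\<^bsub>M\<^esub> x) y", OF TG_comm smult_balanced])

end

end

lemmas distrib = distrib_left distrib_right

section \<open>Calculus in a Hopf algebra\<close>

lemma space_of_fields [simp]:
  "carrier (space_of s) = UNIV" "add (space_of s) = (+)" "\<zero>\<^bsub>space_of s\<^esub> = 0" "smult (space_of s) = s"
  by (simp_all add: space_of_def)

lemma abelian_space_of: "abelian_group (space_of (s :: 'k \<Rightarrow> 'b::ab_group_add \<Rightarrow> 'b))"
  by (rule abelian_groupI) (auto simp: add_ac intro: exI[of _ "- _"])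

lemma linear_mapsD:
  assumes "\<phi> \<in> linear_maps M N"
  shows "\<phi> \<in> hom (add_monoid M) (add_monoid N)"
    and "v \<in> carrier M \<Longrightarrow> \<phi> v \<in> carrier N"
    and "v \<in> carrier M \<Longrightarrow> w \<in> carrier M \<Longrightarrow> \<phi> (v \<oplus>\<^bsub>M\<^esub> w) = \<phi> v \<oplus>\<^bsub>N\<^esub> \<phi> w"
    and "v \<in> carrier M \<Longrightarrow> \<phi> (c \<odot>\<^bsub>M\<^esub> v) = c \<odot>\<^bsub>N\<^esub> \<phi> v"
  using assms by (auto simp: linear_maps_def hom_def)

lemma linear_mapsI:
  assumes "\<And>v. v \<in> carrier M \<Longrightarrow> \<phi> v \<in> carrier N"
    and "\<And>v w. v \<in> carrier M \<Longrightarrow> w \<in> carrier M \<Longrightarrow> \<phi> (v \<oplus>\<^bsub>M\<^esub> w) = \<phi> v \<oplus>\<^bsub>N\<^esub> \<phi> w"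
    and "\<And>c v. v \<in> carrier M \<Longrightarrow> \<phi> (c \<odot>\<^bsub>M\<^esub> v) = c \<odot>\<^bsub>N\<^esub> \<phi> v"
  shows "\<phi> \<in> linear_maps M N"
  using assms by (auto simp: linear_maps_def hom_def)

context hopf_algebra
begin

abbreviation "HH \<equiv> scalar_pairs (hspace H) (hspace H)"
lemmas hscale_mult = hscale_mult_left hscale_mult_right

abbreviation "ant \<equiv> antipode H"
abbreviation "cm \<equiv> hscale H"

lemma hspace_abelian: "abelian_group (hspace H)"
  by (rule abelian_space_of)

sublocale hs: balanced_tensor "hspace H" "hspace H" HH
  by (intro balanced_tensor.intro hspace_abelian balanced_tensor_axioms.intro) (auto simp: scalar_pairs_def)

lemma scale_add: "cm c (x + y) = cm c x + cm c y"
  using vector_space.vector_space_assms(1)[OF hscale_space] .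

lemma scale_scale: "cm c (cm d x) = cm (c * d) x"
  using vector_space.vector_space_assms(3)[OF hscale_space] .

lemma hsquare_alt: "hsquare H = tensor_over (hspace H) (hspace H) HH" "htens H = pure_tensor (hspace H) (hspace H) HH"
  by (simp_all add: tensor_def ptensor_def fun_eq_iff)

lemma hsquare_abelian: "abelian_group (hsquare H)"
  unfolding hsquare_alt by (rule hs.abelian_group_tensor_over)

lemma htens_closed: "htens H a b \<in> carrier (hsquare H)"
  unfolding hsquare_alt hs.tensor_over_fields by (rule hs.pt_closed) auto

lemma htens_add: 
  "htens H (a + a') b = htens H a b \<oplus>\<^bsub>hsquare H\<^esub> htens H a' b"
  "htens H a (b + b') = htens H a b \<oplus>\<^bsub>hsquare H\<^esub> htens H a b'"
  unfolding hsquare_alt hs.tensor_over_fields using hs.pt_add_left hs.pt_add_right by auto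

lemma htens_scale: "htens H (cm c a) b = htens H a (cm c b)"
  using hs.pt_balanced[of "smult (hspace H) c" "smult (hspace H) c" a b] unfolding hsquare_alt
  by (auto simp: scalar_pairs_def)

lemma hsquare_smult_hom: "smult (hsquare H) c \<in> hom (add_monoid (hsquare H)) (add_monoid (hsquare H))"
  unfolding hsquare_alt hs.hom_tensor_over
  by (rule hs.smult_tensor_hom) (auto simp: scalar_pairs_def scale_add scale_scale mult.commute hom_def)

lemma hsquare_smult: "c \<odot>\<^bsub>hsquare H\<^esub> htens H a b = htens H (cm c a) b"
  unfolding hsquare_alt 
  by (subst hs.smult_tensor_pure) (auto simp: scalar_pairs_def scale_add scale_scale mult.commute hom_def)

lemma hsquare_hom_ext:
  assumes "f \<in> hom (add_monoid (hsquare H)) (add_monoid M)" "g \<in> hom (add_monoid (hsquare H)) (add_monoid M)" "X \<in> carrier (hsquare H)"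
    and "\<And>x y. f (htens H x y) = g (htens H x y)"
  shows "f X = g X"
proof -
  have h: "hom (add_monoid (hsquare H)) (add_monoid M) = hom hs.TG (add_monoid M)"
    unfolding hsquare_alt by (rule hs.hom_tensor_over)
  show ?thesis
    by (rule hs.hom_ext[OF assms(1,2)[unfolded h]])
      (use assms(3,4) in \<open>simp_all only: hsquare_alt hs.tensor_over_fields\<close>)
qed

abbreviation "hbal \<equiv> balanced (hspace H) (hspace H) HH"

lemma hbalI:
  assumes "\<And>x y. b x y \<in> carrier Q" 
    and "\<And>x x' y. b (x + x') y = b x y \<oplus>\<^bsub>Q\<^esub> b x' y"
    and "\<And>x y y'. b x (y + y') = b x y \<oplus>\<^bsub>Q\<^esub> b x y'"
    and "\<And>c x y. b (cm c x) y = b x (cm c y)"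
  shows "hbal Q b"
  using assms by (auto simp: balanced_def scalar_pairs_def)

lemma hbalD:
  assumes "hbal Q b"
  shows "b x y \<in> carrier Q" 
    and "b (x + x') y = b x y \<oplus>\<^bsub>Q\<^esub> b x' y"
    and "b x (y + y') = b x y \<oplus>\<^bsub>Q\<^esub> b x y'"
    and "b (cm c x) y = b x (cm c y)"
proof -
  have "(cm c, cm c) \<in> HH" by (auto simp: scalar_pairs_def)
  then show "b (cm c x) y = b x (cm c y)" using assms unfolding balanced_def by fastforce
qed (use assms in \<open>auto simp: balanced_def\<close>)

lemma lift_hom: "abelian_group Q \<Longrightarrow> hbal Q b \<Longrightarrow> tensor_lift Q b \<in> hom (add_monoid (hsquare H)) (add_monoid Q)"
  unfolding hsquare_alt hs.hom_tensor_over by (rule hs.tensor_lift_hom)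

lemma lift_htens: "abelian_group Q \<Longrightarrow> hbal Q b \<Longrightarrow> tensor_lift Q b (htens H x y) = b x y"
  unfolding hsquare_alt by (rule hs.tensor_lift_pure) auto

lemma comult_closed: "comult H h \<in> carrier (hsquare H)"
  using linear_mapsD(2)[OF comult_linear] by simp

lemma comult_add: "comult H (x + y) = comult H x \<oplus>\<^bsub>hsquare H\<^esub> comult H y"
  using linear_mapsD(3)[OF comult_linear] by simp

lemma comult_scale: "comult H (cm c x) = c \<odot>\<^bsub>hsquare H\<^esub> comult H x"
  using linear_mapsD(4)[OF comult_linear] by simp

lemma ant_add: "ant (x + y) = ant x + ant y"
  using linear_mapsD(3)[OF antipode_linear] by simp

lemma ant_scale: "ant (cm c x) = cm c (ant x)"
  using linear_mapsD(4)[OF antipode_linear] by simp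

lemma counit_add: "counit H (x + y) = counit H x + counit H y"
  using linear_mapsD(3)[OF counit_linear] by simp

lemma counit_scale: "counit H (cm c x) = c * counit H x"
  using linear_mapsD(4)[OF counit_linear] by simp

text \<open>Both sides are additive in the element of \<open>hsquare H\<close> and agree on pure
  tensors; this is the licence to move an additive map inside a Sweedler sum.\<close>

lemma sweedler_hom:
  assumes "abelian_group Q" "hbal Q b" "abelian_group Q'" "g \<in> hom (add_monoid Q) (add_monoid Q')"
  shows "g (sweedler H Q b h) = sweedler H Q' (\<lambda>x y. g (b x y)) h"
proof -
  have b': "hbal Q' (\<lambda>x y. g (b x y))"
    using hbalD[OF assms(2)] hom_in_carrier[OF assms(4)] hom_mult[OF assms(4)]
    by (intro hbalI) auto
  have "(g \<circ> tensor_lift Q b) (comult H h) = tensor_lift Q' (\<lambda>x y. g (b x y)) (comult H h)"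
    by (rule hsquare_hom_ext[OF _ lift_hom[OF assms(3) b'] comult_closed])
      (simp_all add: lift_htens assms b' hom_compose[OF lift_hom[OF assms(1,2)] assms(4)] del: o_apply, simp add: lift_htens assms)
  then show ?thesis by (simp add: sweedler_def)
qed

lemma sweedler_closed: "abelian_group Q \<Longrightarrow> hbal Q b \<Longrightarrow> sweedler H Q b h \<in> carrier Q"
  unfolding sweedler_def using hom_in_carrier[OF lift_hom, of Q b "comult H h"] comult_closed by simp

lemma sweedler_add: "abelian_group Q \<Longrightarrow> hbal Q b \<Longrightarrow> sweedler H Q b (h + h') = sweedler H Q b h \<oplus>\<^bsub>Q\<^esub> sweedler H Q b h'"
  unfolding sweedler_def comult_add using hom_mult[OF lift_hom, of Q b "comult H h" "comult H h'"] comult_closed by simp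

lemma sweedler_scale:
  assumes "abelian_group Q" "hbal Q b"
  shows "sweedler H Q b (cm c h) = sweedler H Q (\<lambda>x y. b (cm c x) y) h"
proof -
  have b': "hbal Q (\<lambda>x y. b (cm c x) y)"
    using hbalD[OF assms(2)] by (intro hbalI) (auto simp: scale_add scale_scale mult.commute)
  have "(tensor_lift Q b \<circ> smult (hsquare H) c) (comult H h) = tensor_lift Q (\<lambda>x y. b (cm c x) y) (comult H h)"
    by (rule hsquare_hom_ext[OF _ lift_hom[OF assms(1) b'] comult_closed])
      (simp_all add: lift_htens assms b' hom_compose[OF hsquare_smult_hom lift_hom[OF assms]] del: o_apply, simp add: lift_htens assms hsquare_smult)
  then show ?thesis by (simp add: sweedler_def comult_scale)
qed

lemma sweedler_plus:
  assumes "abelian_group Q" "hbal Q b" "hbal Q b'"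
  shows "sweedler H Q (\<lambda>x y. b x y \<oplus>\<^bsub>Q\<^esub> b' x y) h = sweedler H Q b h \<oplus>\<^bsub>Q\<^esub> sweedler H Q b' h"
proof -
  interpret abelian_group Q by fact
  have bb: "hbal Q (\<lambda>x y. b x y \<oplus>\<^bsub>Q\<^esub> b' x y)"
    using hbalD[OF assms(2)] hbalD[OF assms(3)] by (intro hbalI) (auto simp: a_ac)
  let ?g = "\<lambda>X. tensor_lift Q b X \<oplus>\<^bsub>Q\<^esub> tensor_lift Q b' X"
  have h: "?g \<in> hom (add_monoid (hsquare H)) (add_monoid Q)"
    using lift_hom[OF assms(1,2)] lift_hom[OF assms(1,3)] unfolding hom_def Pi_def
    by (auto simp: a_ac)
  have "tensor_lift Q (\<lambda>x y. b x y \<oplus>\<^bsub>Q\<^esub> b' x y) (comult H h) = ?g (comult H h)"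
    by (rule hsquare_hom_ext[OF lift_hom[OF assms(1) bb] h comult_closed])
      (simp add: lift_htens assms bb)
  then show ?thesis by (simp add: sweedler_def)
qed

text \<open>The analogue of \<open>hbal\<close> for three arguments. Letting scalars pass between
  neighbouring arguments is what factorisation through \<open>hcube H\<close> requires.\<close>

definition trilin :: "('q, 's, 'zz) module_scheme \<Rightarrow> ('h \<Rightarrow> 'h \<Rightarrow> 'h \<Rightarrow> 's) \<Rightarrow> bool" where
  "trilin Q t \<longleftrightarrow> (\<forall>a b c. t a b c \<in> carrier Q) \<and>
     (\<forall>a a' b c. t (a + a') b c = t a b c \<oplus>\<^bsub>Q\<^esub> t a' b c) \<and>
     (\<forall>a b b' c. t a (b + b') c = t a b c \<oplus>\<^bsub>Q\<^esub> t a b' c) \<and>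
     (\<forall>a b c c'. t a b (c + c') = t a b c \<oplus>\<^bsub>Q\<^esub> t a b c') \<and>
     (\<forall>k a b c. t (cm k a) b c = t a (cm k b) c) \<and>
     (\<forall>k a b c. t a (cm k b) c = t a b (cm k c))"

lemma trilinD:
  assumes "trilin Q t"
  shows "t a b c \<in> carrier Q" "t (a + a') b c = t a b c \<oplus>\<^bsub>Q\<^esub> t a' b c"
    "t a (b + b') c = t a b c \<oplus>\<^bsub>Q\<^esub> t a b' c" "t a b (c + c') = t a b c \<oplus>\<^bsub>Q\<^esub> t a b c'"
    "t (cm k a) b c = t a (cm k b) c" "t a (cm k b) c = t a b (cm k c)"
  using assms by (simp_all add: trilin_def)

lemma trilin_inner:
  assumes "trilin Q t"
  shows "hbal Q (\<lambda>a b. t a b y)" "hbal Q (t x)"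
  using trilinD[OF assms] by (intro hbalI; simp)+

lemma trilin_outer:
  assumes Q: "abelian_group Q" and t: "trilin Q t"
  shows "hbal Q (\<lambda>x y. sweedler H Q (\<lambda>a b. t a b y) x)"
    and "hbal Q (\<lambda>x y. sweedler H Q (t x) y)"
proof -
  note t' = trilin_inner[OF t] and td = trilinD[OF t]
  show "hbal Q (\<lambda>x y. sweedler H Q (\<lambda>a b. t a b y) x)"
    by (rule hbalI)
      (simp_all add: sweedler_closed sweedler_add sweedler_scale Q t' td(4) sweedler_plus, simp add: td)
  have tx: "t (x + x') = (\<lambda>a b. t x a b \<oplus>\<^bsub>Q\<^esub> t x' a b)" for x x' by (simp add: fun_eq_iff td)
  have tc: "t (cm c x) = (\<lambda>a b. t x (cm c a) b)" for c x by (simp add: fun_eq_iff td)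
  show "hbal Q (\<lambda>x y. sweedler H Q (t x) y)"
    by (rule hbalI)
      (simp_all add: sweedler_closed sweedler_add sweedler_scale Q t' tx sweedler_plus tc)
qed

abbreviation "HC \<equiv> scalar_pairs (hspace H) (hsquare H)"

sublocale hc: balanced_tensor "hspace H" "hsquare H" HC
  by (intro balanced_tensor.intro hspace_abelian hsquare_abelian balanced_tensor_axioms.intro)
    (use hom_in_carrier[OF hsquare_smult_hom] in \<open>auto simp: scalar_pairs_def\<close>)

lemma hcube_alt: "hcube H = tensor_over (hspace H) (hsquare H) HC" "ptensor (hspace H) (hsquare H) = pure_tensor (hspace H) (hsquare H) HC"
  by (simp_all add: tensor_def ptensor_def fun_eq_iff)

text \<open>The axiom \<open>coassoc\<close> is an equation in \<open>hcube H\<close>. A trilinear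
  \<open>t\<close> factors through an additive map \<open>?L\<close> on that cube, and applying
  \<open>?L\<close> to both sides of the axiom gives the two bracketings for
  \<open>t\<close>.\<close>

lemma coassoc_trilinear:
  assumes Q: "abelian_group Q" and t: "trilin Q t"
  shows "sweedler H Q (\<lambda>x y. sweedler H Q (\<lambda>a b. t a b y) x) h = sweedler H Q (\<lambda>x y. sweedler H Q (t x) y) h"
proof -
  note t' = trilin_inner[OF t] and td = trilinD[OF t]
  let ?p = "ptensor (hspace H) (hsquare H)"
  have cube: "abelian_group (hcube H)"
    unfolding hcube_alt by (rule hc.abelian_group_tensor_over)
  have p_closed: "?p a X \<in> carrier (hcube H)" if "X \<in> carrier (hsquare H)" for a X
    unfolding hcube_alt hc.tensor_over_fields by (rule hc.pt_closed) (use that in auto)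
  have p_add1: "?p (a + a') X = ?p a X \<oplus>\<^bsub>hcube H\<^esub> ?p a' X" if "X \<in> carrier (hsquare H)" for a a' X
    unfolding hcube_alt hc.tensor_over_fields using hc.pt_add_left[of a a' X] that by auto
  have p_add2: "?p a (X \<oplus>\<^bsub>hsquare H\<^esub> Y) = ?p a X \<oplus>\<^bsub>hcube H\<^esub> ?p a Y"
    if "X \<in> carrier (hsquare H)" "Y \<in> carrier (hsquare H)" for a X Y
    unfolding hcube_alt hc.tensor_over_fields using hc.pt_add_right[of a X Y] that by auto
  have p_scale: "?p (cm c a) X = ?p a (c \<odot>\<^bsub>hsquare H\<^esub> X)" if "X \<in> carrier (hsquare H)" for c a X
    using hc.pt_balanced[of "smult (hspace H) c" "smult (hsquare H) c" a X] that unfolding hcube_alt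
    by (auto simp: scalar_pairs_def)
  have tri: "trilin (hcube H) (\<lambda>a b y. ?p a (htens H b y))"
    by (simp add: trilin_def p_closed htens_closed p_add1 p_add2 htens_add p_scale hsquare_smult htens_scale)
  \<comment> \<open>The last two arguments are lifted to \<open>hsquare H\<close> first;
    \<open>u\<close> is then balanced in the first argument and the square, and its lift is
    \<open>?L\<close>.\<close>
  define u where "u = (\<lambda>a X. tensor_lift Q (t a) X)"
  have u_hom: "u a \<in> hom (add_monoid (hsquare H)) (add_monoid Q)" for a
    unfolding u_def by (rule lift_hom[OF Q t'(2)])
  have u_tens: "u a (htens H b y) = t a b y" for a b y
    unfolding u_def by (rule lift_htens[OF Q t'(2)])
  have u_add: "u (a + a') X = u a X \<oplus>\<^bsub>Q\<^esub> u a' X" if X: "X \<in> carrier (hsquare H)" for a a' X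
  proof -
    interpret abelian_group Q by fact
    have *: "(\<lambda>X. u a X \<oplus>\<^bsub>Q\<^esub> u a' X) \<in> hom (add_monoid (hsquare H)) (add_monoid Q)"
      using u_hom[of a] u_hom[of a'] unfolding hom_def Pi_def by (auto simp: a_ac)
    show ?thesis by (rule hsquare_hom_ext[OF u_hom * X]) (simp add: u_tens td)
  qed
  have u_scale: "u (cm c a) X = u a (c \<odot>\<^bsub>hsquare H\<^esub> X)" if X: "X \<in> carrier (hsquare H)" for c a X
  proof -
    have "u (cm c a) X = (u a \<circ> smult (hsquare H) c) X"
      by (rule hsquare_hom_ext[OF u_hom hom_compose[OF hsquare_smult_hom u_hom] X])
        (simp add: u_tens hsquare_smult td)
    then show ?thesis by simp
  qed
  have u_bal: "balanced (hspace H) (hsquare H) HC Q u"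
    by (rule balancedI)
      (use u_add u_scale hom_in_carrier[OF u_hom] hom_mult[OF u_hom] in \<open>auto simp: scalar_pairs_def\<close>)
  let ?L = "tensor_lift Q u"
  have L_hom: "?L \<in> hom (add_monoid (hcube H)) (add_monoid Q)"
    unfolding hcube_alt hc.hom_tensor_over by (rule hc.tensor_lift_hom[OF Q u_bal])
  have L_p: "?L (?p a X) = u a X" if "X \<in> carrier (hsquare H)" for a X
    unfolding hcube_alt by (rule hc.tensor_lift_pure[OF Q u_bal]) (use that in auto)
  \<comment> \<open>On the right of the axiom \<open>comult H y\<close> stands unexpanded. Writing
    it as an inner Sweedler sum gives both sides the shape of iterated sums.\<close>
  have swp: "sweedler H (hcube H) (\<lambda>a b. ?p x (htens H a b)) y = ?p x (comult H y)" for x y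
  proof -
    have b: "hbal (hcube H) (\<lambda>a b. ?p x (htens H a b))" by (rule trilin_inner(2)[OF tri])
    have h: "?p x \<in> hom (add_monoid (hsquare H)) (add_monoid (hcube H))"
      by (simp add: hom_def p_closed p_add2)
    show ?thesis unfolding sweedler_def
      by (rule hsquare_hom_ext[OF lift_hom[OF cube b] h comult_closed]) (rule lift_htens[OF cube b])
  qed
  have "?L (sweedler H (hcube H) (\<lambda>x y. sweedler H (hcube H) (\<lambda>a b. ?p a (htens H b y)) x) h)
      = sweedler H Q (\<lambda>x y. sweedler H Q (\<lambda>a b. t a b y) x) h"
    by (simp add: sweedler_hom[OF cube trilin_outer(1)[OF cube tri] Q L_hom]
        sweedler_hom[OF cube trilin_inner(1)[OF tri] Q L_hom] L_p htens_closed u_tens)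
  moreover have "?L (sweedler H (hcube H) (\<lambda>x y. ?p x (comult H y)) h)
      = sweedler H Q (\<lambda>x y. sweedler H Q (t x) y) h"
    unfolding swp[symmetric]
    by (simp add: sweedler_hom[OF cube trilin_outer(2)[OF cube tri] Q L_hom]
        sweedler_hom[OF cube trilin_inner(2)[OF tri] Q L_hom] L_p htens_closed u_tens)
  ultimately show ?thesis using coassoc[of h] by simp
qed

lemma hsquare_mult_htens: "hsquare_mult H (htens H a b) (htens H c d) = htens H (a * c) (b * d)"
proof -
  have i: "hbal (hsquare H) (\<lambda>c d. htens H (a * c) (b * d))" for a b
    by (rule hbalI) (simp_all add: htens_closed distrib_left htens_add hscale_mult_right htens_scale)
  let ?I = "\<lambda>a b. tensor_lift (hsquare H) (\<lambda>c d. htens H (a * c) (b * d))"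
  have e: "?I a b (htens H c d) = htens H (a * c) (b * d)" for a b
    by (rule lift_htens[OF hsquare_abelian i])
  have o: "hbal (hsquare H) (\<lambda>a b. ?I a b (htens H c d))"
    unfolding e
    by (rule hbalI) (simp_all add: htens_closed distrib_right htens_add hscale_mult_left htens_scale)
  show ?thesis
    unfolding hsquare_mult_def
    by (subst lift_htens[OF hsquare_abelian o]) (rule lift_htens[OF hsquare_abelian i])
qed

lemma hbal_typeI:
  assumes "\<And>x x' y. b (x + x') y = b x y + b x' y"
    and "\<And>x y y'. b x (y + y') = b x y + b x y'"
    and "\<And>c x y. b (cm c x) y = b x (cm c y)"
  shows "hbal (space_of s) b"
  using assms by (intro hbalI) auto

lemma trilin_typeI:
  assumes "\<And>a a' b c. t (a + a') b c = t a b c + t a' b c"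
    and "\<And>a b b' c. t a (b + b') c = t a b c + t a b' c"
    and "\<And>a b c c'. t a b (c + c') = t a b c + t a b c'"
    and "\<And>k a b c. t (cm k a) b c = t a (cm k b) c"
    and "\<And>k a b c. t a (cm k b) c = t a b (cm k c)"
  shows "trilin (space_of s) t"
  using assms by (simp add: trilin_def)

lemma sweedler_type_hom:
  assumes "hbal (space_of s) b" "\<And>x y. g (x + y) = g x + g y"
  shows "g (sweedler H (space_of s) b h) = sweedler H (space_of s') (\<lambda>x y. g (b x y)) h"
  by (rule sweedler_hom[OF abelian_space_of assms(1) abelian_space_of])
    (use assms(2) in \<open>simp add: hom_def\<close>)

end

section \<open>Adapted elements: the conjugation identity in the completion\<close>

context tensor_completion
begin

abbreviation "tens a b \<equiv> incl T (htens H a b)"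
abbreviation "CC \<equiv> space_of (cscale T)"

lemma incl_add: "X \<in> carrier (hsquare H) \<Longrightarrow> Y \<in> carrier (hsquare H) \<Longrightarrow> incl T (X \<oplus>\<^bsub>hsquare H\<^esub> Y) = incl T X + incl T Y"
  using linear_mapsD(3)[OF incl_linear] by simp

lemma tens_add: "tens (a + a') b = tens a b + tens a' b" "tens a (b + b') = tens a b + tens a b'"
  by (simp_all add: htens_add incl_add htens_closed)

lemma tens_scale: "tens (cm c a) b = tens a (cm c b)"
  by (simp add: htens_scale)

lemma tens_mult: "tens a b * tens c d = tens (a * c) (b * d)"
  by (simp add: incl_mult[symmetric] htens_closed hsquare_mult_htens)

lemma incl_hom: "incl T \<in> hom (add_monoid (hsquare H)) (add_monoid CC)"
  by (rule linear_mapsD(1)[OF incl_linear])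

lemma tens_bal: "hbal CC tens"
  by (rule hbal_typeI) (simp_all add: tens_add tens_scale)

lemma incl_comult: "incl T (comult H h) = sweedler H CC tens h"
proof -
  have "hbal (hsquare H) (htens H)"
    by (rule hbalI) (simp_all add: htens_closed htens_add htens_scale)
  from sweedler_hom[OF hsquare_abelian this abelian_space_of incl_hom]
  have 1: "incl T (sweedler H (hsquare H) (htens H) h) = sweedler H CC tens h" .
  have "incl T (comult H h) = tensor_lift CC tens (comult H h)"
    by (rule hsquare_hom_ext[OF incl_hom lift_hom[OF abelian_space_of tens_bal] comult_closed])
      (simp add: lift_htens[OF abelian_space_of tens_bal])
  then show ?thesis by (simp add: sweedler_def)
qed

lemma incl_twisted:
  "incl T (sweedler H (hsquare H) (\<lambda>x y. htens H (ant (ant x)) y) h) = sweedler H CC (\<lambda>x y. tens (ant (ant x)) y) h"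
proof -
  have "hbal (hsquare H) (\<lambda>x y. htens H (ant (ant x)) y)"
    by (rule hbalI) (simp_all add: htens_closed htens_add htens_scale ant_add ant_scale)
  from sweedler_hom[OF hsquare_abelian this abelian_space_of incl_hom] show ?thesis .
qed

lemma sweedler_mult_right: "hbal CC b \<Longrightarrow> sweedler H CC b h * Y = sweedler H CC (\<lambda>x y. b x y * Y) h"
  by (rule sweedler_type_hom) (simp_all add: distrib_right)

lemma sweedler_mult_left: "hbal CC b \<Longrightarrow> Y * sweedler H CC b h = sweedler H CC (\<lambda>x y. Y * b x y) h"
  by (rule sweedler_type_hom) (simp_all add: distrib_left)

lemma counit_bal:
  "hbal (hspace H) (\<lambda>x y. cm (counit H x) y)" "hbal (hspace H) (\<lambda>x y. cm (counit H y) x)"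
  by (rule hbal_typeI; simp add: counit_add counit_scale scale_add scale_scale mult.commute
        vector_space.vector_space_assms(2)[OF hscale_space])+

text \<open>After re-bracketing, the second leg contains \<open>h_2 S(h_3)\<close>, which the
  antipode axiom reduces to a counit; the counit is then absorbed into the first leg.\<close>

lemma twist_collapse:
  "sweedler H CC (\<lambda>a b. sweedler H CC (\<lambda>x y. tens (ant (ant x)) y) a * tens 1 (ant b)) h = tens (ant (ant h)) 1"
proof -
  let ?S = "\<lambda>b h. sweedler H CC b h"
  have tri: "trilin CC (\<lambda>p q b. tens (ant (ant p)) (q * ant b))"
    by (rule trilin_typeI) (simp_all add: tens_add tens_scale ant_add ant_scale distrib
        hscale_mult)
  have b1: "hbal CC (\<lambda>x y. tens (ant (ant x)) y)"
    by (rule hbal_typeI) (simp_all add: tens_add tens_scale ant_add ant_scale)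
  have "?S (\<lambda>a b. ?S (\<lambda>x y. tens (ant (ant x)) y) a * tens 1 (ant b)) h
      = ?S (\<lambda>a b. ?S (\<lambda>x y. tens (ant (ant x)) (y * ant b)) a) h"
    by (simp add: sweedler_mult_right[OF b1] distrib_right tens_mult)
  also have "\<dots> = ?S (\<lambda>p r. ?S (\<lambda>q b. tens (ant (ant p)) (q * ant b)) r) h"
    by (rule coassoc_trilinear[OF abelian_space_of tri])
  also have "\<dots> = ?S (\<lambda>p r. tens (ant (ant p)) (cm (counit H r) 1)) h"
  proof -
    have b: "hbal (hspace H) (\<lambda>q b. q * ant b)"
      by (rule hbal_typeI) (simp_all add: ant_add ant_scale distrib hscale_mult)
    have "?S (\<lambda>q b. tens (ant (ant p)) (q * ant b)) r = tens (ant (ant p)) (cm (counit H r) 1)" for p r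
      using sweedler_type_hom[OF b, where g = "\<lambda>X. tens (ant (ant p)) X", symmetric] tens_add
      by (simp add: antipode_right)
    then show ?thesis by simp
  qed
  also have "\<dots> = ?S (\<lambda>p r. tens (ant (ant (cm (counit H r) p))) 1) h"
    by (simp add: tens_scale[symmetric] ant_scale)
  also have "\<dots> = tens (ant (ant h)) 1"
  proof -
    show ?thesis
      using sweedler_type_hom[OF counit_bal(2), where g = "\<lambda>X. tens (ant (ant X)) 1" and h = h and s' = "cscale T"]
      by (simp add: counit_right tens_add ant_add)
  qed
  finally show ?thesis .
qed

text \<open>After re-bracketing, the first leg contains \<open>S(h_1) h_2\<close>; it reduces to a
  counit, which is absorbed into the second leg.\<close>

lemma antipode_collapse:
  "sweedler H CC (\<lambda>a b. tens (ant a) 1 * sweedler H CC tens b) h = tens 1 h"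
proof -
  let ?S = "\<lambda>b h. sweedler H CC b h"
  have tri: "trilin CC (\<lambda>a p q. tens (ant a * p) q)"
    by (rule trilin_typeI) (simp_all add: tens_add tens_scale ant_add ant_scale distrib
        hscale_mult flip: tens_scale)
  have "?S (\<lambda>a b. tens (ant a) 1 * sweedler H CC tens b) h
      = ?S (\<lambda>a b. ?S (\<lambda>p q. tens (ant a * p) q) b) h"
    by (simp add: sweedler_mult_left[OF tens_bal] distrib_left tens_mult)
  also have "\<dots> = ?S (\<lambda>r q. ?S (\<lambda>a p. tens (ant a * p) q) r) h"
    by (rule coassoc_trilinear[OF abelian_space_of tri, symmetric])
  also have "\<dots> = ?S (\<lambda>r q. tens (cm (counit H r) 1) q) h"
  proof -
    have b: "hbal (hspace H) (\<lambda>a p. ant a * p)"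
      by (rule hbal_typeI) (simp_all add: ant_add ant_scale distrib hscale_mult)
    have "?S (\<lambda>a p. tens (ant a * p) q) r = tens (cm (counit H r) 1) q" for q r
      using sweedler_type_hom[OF b, where g = "\<lambda>X. tens X q", symmetric] tens_add
      by (simp add: antipode_left)
    then show ?thesis by simp
  qed
  also have "\<dots> = ?S (\<lambda>r q. tens 1 (cm (counit H r) q)) h"
    by (simp add: tens_scale)
  also have "\<dots> = tens 1 h"
  proof -
    show ?thesis
      using sweedler_type_hom[OF counit_bal(1), where g = "\<lambda>X. tens 1 X" and h = h and s' = "cscale T"]
      by (simp add: counit_left tens_add)
  qed
  finally show ?thesis .
qed

lemma tens_cscale: "tens (cm c a) b = cscale T c (tens a b)" "tens a (cm c b) = cscale T c (tens a b)"
  using linear_mapsD(4)[OF incl_linear htens_closed, of c a b] by (simp_all add: hsquare_smult htens_scale)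

lemma sweedler_cscale:
  assumes b: "hbal CC b" and scale: "\<And>c x y. b (cm c x) y = cscale T c (b x y)"
  shows "sweedler H CC b (cm c h) = cscale T c (sweedler H CC b h)"
proof -
  have "cscale T c (sweedler H CC b h) = sweedler H CC (\<lambda>x y. cscale T c (b x y)) h"
    by (rule sweedler_type_hom[OF b]) (rule vector_space.vector_space_assms(1)[OF cscale_space])
  then show ?thesis using sweedler_scale[OF abelian_space_of b] by (simp add: scale)
qed

text \<open>Both sides are bracketings of the single trilinear sum \<open>?t\<close> over
  \<open>h_1, h_2, h_3\<close>, whose middle is \<open>P * ?A a = ?E a * P\<close>. Read with
  \<open>?A\<close>, the last two arguments collapse by \<open>twist_collapse\<close> and leave the
  left side; read with \<open>?E\<close>, the first two collapse by \<open>antipode_collapse\<close>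
  and leave the right side.\<close>

lemma adapted_conjugation:
  assumes P: "P \<in> adapted H T"
  shows "sweedler H CC (\<lambda>x y. tens (ant x) 1 * P * tens (ant (ant y)) 1) h
       = sweedler H CC (\<lambda>x y. tens 1 x * P * tens 1 (ant y)) h"
proof -
  let ?S = "\<lambda>b h. sweedler H CC b h"
  let ?A = "?S (\<lambda>x y. tens (ant (ant x)) y)" and ?E = "?S tens"
  let ?t = "\<lambda>x a b. tens (ant x) 1 * (P * ?A a) * tens 1 (ant b)"
  note Q = abelian_space_of[of "cscale T"]
  note scale = tens_cscale ant_scale cscale_mult_left cscale_mult_right
  have PA: "P * ?A h = ?E h * P" for h
    using P incl_comult incl_twisted by (simp add: adapted_def)
  have bA: "hbal CC (\<lambda>x y. tens (ant (ant x)) y)"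
    by (rule hbal_typeI) (simp_all add: tens_add tens_scale ant_add ant_scale)
  have A: "?A (x + y) = ?A x + ?A y" "?A (cm c x) = cscale T c (?A x)" for c x y
    using sweedler_add[OF Q bA] sweedler_cscale[OF bA] by (simp_all add: scale)
  have E: "?E (x + y) = ?E x + ?E y" "?E (cm c x) = cscale T c (?E x)" for c x y
    using sweedler_add[OF Q tens_bal] sweedler_cscale[OF tens_bal] by (simp_all add: scale)
  have tri: "trilin CC ?t"
    by (rule trilin_typeI) (simp_all add: A ant_add tens_add distrib scale)
  have "?S (?t x) y = tens (ant x) 1 * P * tens (ant (ant y)) 1" for x y
  proof -
    have "hbal CC (\<lambda>a b. ?A a * tens 1 (ant b))"
      by (rule hbal_typeI) (simp_all add: A ant_add tens_add distrib scale)
    from sweedler_mult_left[OF this, of "tens (ant x) 1 * P" y] show ?thesis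
      by (simp add: twist_collapse mult.assoc)
  qed
  moreover have "?S (\<lambda>a b. ?t a b y) x = tens 1 x * P * tens 1 (ant y)" for x y
  proof -
    have "hbal CC (\<lambda>a b. tens (ant a) 1 * ?E b)"
      by (rule hbal_typeI) (simp_all add: E ant_add tens_add distrib scale)
    from sweedler_mult_right[OF this, of x "P * tens 1 (ant y)"] show ?thesis
      by (simp add: antipode_collapse mult.assoc PA)
  qed
  ultimately show ?thesis
    using coassoc_trilinear[OF Q tri, of h] by simp
qed

text \<open>Apply \<open>f \<otimes> 1\<close> to \<open>adapted_conjugation\<close>. By
  \<open>slice_bimodule\<close>, factors in the first leg move to \<open>f\<close> with left and
  right exchanged, which produces the arguments of the diamond action; factors in the second leg
  come out as multiplication in \<open>H\<close>, which is the adjoint action.\<close>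

lemma slice_adapted:
  assumes P: "P \<in> adapted H T" and f: "f \<in> HstC \<C> star"
  shows "sweedler H (hspace H) (\<lambda>x y. slice T (Hst_act (ant (ant y)) f (ant x)) P) h
       = sweedler H (hspace H) (\<lambda>x y. x * slice T f P * ant y) h"
proof -
  have s_add: "slice T f (X + Y) = slice T f X + slice T f Y" for X Y
    using linear_mapsD(3)[OF slice_linear[OF f]] by simp
  note scale = tens_cscale ant_scale cscale_mult_left cscale_mult_right
  have b1: "hbal CC (\<lambda>x y. tens (ant x) 1 * P * tens (ant (ant y)) 1)"
    by (rule hbal_typeI) (simp_all add: tens_add ant_add distrib scale)
  have b2: "hbal CC (\<lambda>x y. tens 1 x * P * tens 1 (ant y))"
    by (rule hbal_typeI) (simp_all add: tens_add ant_add distrib scale)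
  have "slice T f (sweedler H CC (\<lambda>x y. tens (ant x) 1 * P * tens (ant (ant y)) 1) h)
      = slice T f (sweedler H CC (\<lambda>x y. tens 1 x * P * tens 1 (ant y)) h)"
    using adapted_conjugation[OF P] by simp
  then show ?thesis
    unfolding sweedler_type_hom[of _ _ "slice T f", OF b1 s_add, where s' = "hscale H"] 
      sweedler_type_hom[of _ _ "slice T f", OF b2 s_add, where s' = "hscale H"] 
    by (simp add: slice_bimodule[OF f] Hst_act_def)
qed

end

section \<open>Matrix coefficients\<close>

lemma fun_scale_vector_space: "vector_space (fun_scale :: 'k::field \<Rightarrow> ('b \<Rightarrow> 'k) \<Rightarrow> _)"
  by unfold_locales (auto simp: fun_scale_def fun_eq_iff algebra_simps)

global_interpretation fs: vector_space "fun_scale :: 'k::field \<Rightarrow> ('b \<Rightarrow> 'k) \<Rightarrow> _"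
  by (rule fun_scale_vector_space)

lemma left_moduleD:
  assumes "left_module H V l"
  shows "Module.module ground_ring V" "abelian_group V"
    and "v \<in> carrier V \<Longrightarrow> l h v \<in> carrier V"
    and "v \<in> carrier V \<Longrightarrow> w \<in> carrier V \<Longrightarrow> l h (v \<oplus>\<^bsub>V\<^esub> w) = l h v \<oplus>\<^bsub>V\<^esub> l h w"
    and "v \<in> carrier V \<Longrightarrow> l h (c \<odot>\<^bsub>V\<^esub> v) = c \<odot>\<^bsub>V\<^esub> l h v"
    and "v \<in> carrier V \<Longrightarrow> l (h + h') v = l h v \<oplus>\<^bsub>V\<^esub> l h' v"
    and "v \<in> carrier V \<Longrightarrow> l (hscale H c h) v = c \<odot>\<^bsub>V\<^esub> l h v"
    and "v \<in> carrier V \<Longrightarrow> l (h * h') v = l h (l h' v)"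
    and "v \<in> carrier V \<Longrightarrow> l 1 v = v"
proof -
  from assms have l: "l h \<in> linear_maps V V" for h by (simp add: left_module_def)
  show "v \<in> carrier V \<Longrightarrow> l h v \<in> carrier V"
    "v \<in> carrier V \<Longrightarrow> w \<in> carrier V \<Longrightarrow> l h (v \<oplus>\<^bsub>V\<^esub> w) = l h v \<oplus>\<^bsub>V\<^esub> l h w"
    "v \<in> carrier V \<Longrightarrow> l h (c \<odot>\<^bsub>V\<^esub> v) = c \<odot>\<^bsub>V\<^esub> l h v"
    using linear_mapsD[OF l] by auto
qed (use assms in \<open>auto simp: left_module_def module_def\<close>)

lemma module_smult_axioms:
  assumes "Module.module (ground_ring :: 'k::field ring) V"
  shows "v \<in> carrier V \<Longrightarrow> c \<odot>\<^bsub>V\<^esub> v \<in> carrier V"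
    and "v \<in> carrier V \<Longrightarrow> (c + d) \<odot>\<^bsub>V\<^esub> v = c \<odot>\<^bsub>V\<^esub> v \<oplus>\<^bsub>V\<^esub> d \<odot>\<^bsub>V\<^esub> v"
    and "v \<in> carrier V \<Longrightarrow> w \<in> carrier V \<Longrightarrow> c \<odot>\<^bsub>V\<^esub> (v \<oplus>\<^bsub>V\<^esub> w) = c \<odot>\<^bsub>V\<^esub> v \<oplus>\<^bsub>V\<^esub> c \<odot>\<^bsub>V\<^esub> w"
    and "v \<in> carrier V \<Longrightarrow> (c * d) \<odot>\<^bsub>V\<^esub> v = c \<odot>\<^bsub>V\<^esub> (d \<odot>\<^bsub>V\<^esub> v)"
    and "v \<in> carrier V \<Longrightarrow> 1 \<odot>\<^bsub>V\<^esub> v = v"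
    and "v \<in> carrier V \<Longrightarrow> 0 \<odot>\<^bsub>V\<^esub> v = \<zero>\<^bsub>V\<^esub>"
    and "c \<odot>\<^bsub>V\<^esub> \<zero>\<^bsub>V\<^esub> = \<zero>\<^bsub>V\<^esub>"
proof -
  interpret module "ground_ring :: 'k ring" V by fact
  show "v \<in> carrier V \<Longrightarrow> 0 \<odot>\<^bsub>V\<^esub> v = \<zero>\<^bsub>V\<^esub>" "c \<odot>\<^bsub>V\<^esub> \<zero>\<^bsub>V\<^esub> = \<zero>\<^bsub>V\<^esub>"
    using smult_l_null[of v] smult_r_null[of c] by (simp_all add: ground_ring_def)
qed (use assms in \<open>simp_all add: module_def module_axioms_def ground_ring_def\<close>)

lemma module_smult_minus_one:
  assumes "Module.module (ground_ring :: 'k::field ring) V" and v: "v \<in> carrier V"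
  shows "(- 1) \<odot>\<^bsub>V\<^esub> v = \<ominus>\<^bsub>V\<^esub> v"
proof -
  interpret module "ground_ring :: 'k ring" V by fact
  note sm = module_smult_axioms[OF assms(1)]
  have "(- 1) \<odot>\<^bsub>V\<^esub> v \<oplus>\<^bsub>V\<^esub> v = \<zero>\<^bsub>V\<^esub>"
    using sm(2)[OF v, of "-1" 1] sm(5,6)[OF v] by simp
  then show ?thesis using v sm(1) by (simp add: M.minus_equality)
qed

lemmas module_smult = module_smult_axioms module_smult_minus_one

lemma module_homsD:
  assumes "\<phi> \<in> module_homs M l N l'"
  shows "\<phi> \<in> linear_maps M N" "v \<in> carrier M \<Longrightarrow> \<phi> v \<in> carrier N"
    and "v \<in> carrier M \<Longrightarrow> w \<in> carrier M \<Longrightarrow> \<phi> (v \<oplus>\<^bsub>M\<^esub> w) = \<phi> v \<oplus>\<^bsub>N\<^esub> \<phi> w"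
    and "v \<in> carrier M \<Longrightarrow> \<phi> (c \<odot>\<^bsub>M\<^esub> v) = c \<odot>\<^bsub>N\<^esub> \<phi> v"
    and "v \<in> carrier M \<Longrightarrow> \<phi> (l h v) = l' h (\<phi> v)"
  using assms linear_mapsD[of \<phi> M N] by (auto simp: module_homs_def)

lemma module_homsI:
  assumes "\<And>v. v \<in> carrier M \<Longrightarrow> \<phi> v \<in> carrier N"
    and "\<And>v w. v \<in> carrier M \<Longrightarrow> w \<in> carrier M \<Longrightarrow> \<phi> (v \<oplus>\<^bsub>M\<^esub> w) = \<phi> v \<oplus>\<^bsub>N\<^esub> \<phi> w"
    and "\<And>c v. v \<in> carrier M \<Longrightarrow> \<phi> (c \<odot>\<^bsub>M\<^esub> v) = c \<odot>\<^bsub>N\<^esub> \<phi> v"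
    and "\<And>h v. v \<in> carrier M \<Longrightarrow> \<phi> (l h v) = l' h (\<phi> v)"
  shows "\<phi> \<in> module_homs M l N l'"
  using assms linear_mapsI[of M \<phi> N] by (auto simp: module_homs_def)

lemma linear_maps_zero:
  assumes "abelian_group M" "abelian_group N" "\<phi> \<in> linear_maps M N"
  shows "\<phi> \<zero>\<^bsub>M\<^esub> = \<zero>\<^bsub>N\<^esub>"
proof -
  interpret M: abelian_group M by fact
  interpret N: abelian_group N by fact
  have "\<phi> \<zero>\<^bsub>M\<^esub> \<oplus>\<^bsub>N\<^esub> \<phi> \<zero>\<^bsub>M\<^esub> = \<phi> \<zero>\<^bsub>M\<^esub>"
    using linear_mapsD(3)[OF assms(3), of "\<zero>\<^bsub>M\<^esub>" "\<zero>\<^bsub>M\<^esub>"] by simp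
  then show ?thesis
    using linear_mapsD(2)[OF assms(3), of "\<zero>\<^bsub>M\<^esub>"] by (metis M.zero_closed N.add.l_cancel_one')
qed

text \<open>Injectivity of \<alpha> pulls the linearity of \<kappa> back to \<open>U\<close>. Used
  for inverses of isomorphisms, for comparing two embeddings, and for the retraction in
  \<open>trace_on_exact\<close>.\<close>

lemma module_homs_factor:
  assumes \<alpha>: "\<alpha> \<in> module_homs U l V l'" "inj_on \<alpha> (carrier U)"
    and \<kappa>: "\<kappa> \<in> module_homs W m V l'" "\<kappa> ` carrier W \<subseteq> \<alpha> ` carrier U"
    and U: "abelian_group U" "\<And>c u. u \<in> carrier U \<Longrightarrow> c \<odot>\<^bsub>U\<^esub> u \<in> carrier U" "\<And>h u. u \<in> carrier U \<Longrightarrow> l h u \<in> carrier U"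
  shows "(\<lambda>w. inv_into (carrier U) \<alpha> (\<kappa> w)) \<in> module_homs W m U l"
    and "w \<in> carrier W \<Longrightarrow> \<alpha> (inv_into (carrier U) \<alpha> (\<kappa> w)) = \<kappa> w"
proof -
  interpret abelian_group U by (rule U(1))
  let ?g = "\<lambda>w. inv_into (carrier U) \<alpha> (\<kappa> w)"
  note ad = module_homsD[OF \<alpha>(1)] and kd = module_homsD[OF \<kappa>(1)]
  have g: "?g w \<in> carrier U" "\<alpha> (?g w) = \<kappa> w" if "w \<in> carrier W" for w
    using that \<kappa>(2) by (auto simp: image_subset_iff intro: inv_into_into f_inv_into_f)
  show "w \<in> carrier W \<Longrightarrow> \<alpha> (?g w) = \<kappa> w" by (rule g(2))
  have e: "?g w = u" if "u \<in> carrier U" "\<alpha> u = \<kappa> w" for u w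
    using inv_into_f_eq[OF \<alpha>(2) that] .
  show "?g \<in> module_homs W m U l"
    by (rule module_homsI; (rule g)?; (rule e)?) (simp_all add: g U(2,3) ad kd)
qed

lemma isomorphic_sym:
  fixes V W :: "('k::field, 'h::ring_1, 'v) hmod"
  assumes V: "left_module H V (lact V)" and iso: "isomorphic V W"
  shows "isomorphic W V"
proof -
  note d = left_moduleD[OF V]
  obtain \<phi> where h: "\<phi> \<in> hom_H V W" and b: "bij_betw \<phi> (carrier V) (carrier W)"
    using iso by (auto simp: isomorphic_def module_isos_def)
  have "(\<lambda>w. w) \<in> hom_H W W" by (rule module_homsI) auto
  then have "inv_into (carrier V) \<phi> \<in> hom_H W V"
    by (rule module_homs_factor(1)[OF h bij_betw_imp_inj_on[OF b]])
      (use b d(2,3) module_smult(1)[OF d(1)] in \<open>auto simp: bij_betw_def\<close>)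
  then have "inv_into (carrier V) \<phi> \<in> module_isos W (lact W) V (lact V)"
    using bij_betw_inv_into[OF b] by (simp add: module_isos_def)
  then show ?thesis unfolding isomorphic_def by blast
qed

lemma isomorphic_refl: "isomorphic V V"
proof -
  have "(\<lambda>x. x) \<in> module_isos V (lact V) V (lact V)"
    by (simp add: module_isos_def module_homsI bij_betw_def)
  then show ?thesis unfolding isomorphic_def by blast
qed

lemma isomorphic_trans:
  assumes "isomorphic U V" "isomorphic V W"
  shows "isomorphic U W"
proof -
  obtain \<phi> \<psi> where a: "\<phi> \<in> module_isos U (lact U) V (lact V)" "\<psi> \<in> module_isos V (lact V) W (lact W)"
    using assms by (auto simp: isomorphic_def)
  then have p: "\<phi> \<in> module_homs U (lact U) V (lact V)" "\<psi> \<in> module_homs V (lact V) W (lact W)"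
    "bij_betw \<phi> (carrier U) (carrier V)" "bij_betw \<psi> (carrier V) (carrier W)"
    by (auto simp: module_isos_def)
  have "\<psi> \<circ> \<phi> \<in> module_homs U (lact U) W (lact W)"
    by (rule module_homsI) (simp_all add: module_homsD[OF p(1)] module_homsD[OF p(2)])
  then have "\<psi> \<circ> \<phi> \<in> module_isos U (lact U) W (lact W)"
    using bij_betw_trans[OF p(3,4)] by (simp add: module_isos_def)
  then show ?thesis unfolding isomorphic_def by blast
qed

text \<open>The matrix coefficient of \<open>v\<close> and \<open>f\<close>, that is \<beta> at a
  pure tensor, detached from cosets so that it can be manipulated as a function.\<close>

definition mcoeff :: "('k, 'h, 'v) hmod \<Rightarrow> 'v \<Rightarrow> ('v \<Rightarrow> 'k) \<Rightarrow> 'h \<Rightarrow> 'k" where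
  "mcoeff V v f = (\<lambda>h. f (lact V h v))"

lemma star_space_fields [simp]:
  "carrier (star_space star V) = star V" "add (star_space star V) = (+)" "\<zero>\<^bsub>star_space star V\<^esub> = 0"
  "smult (star_space star V) = fun_scale"
  by (simp_all add: star_space_def dual_space_def space_of_def)

section \<open>The coefficient spaces as images of \<beta>, with their two actions\<close>

context duality_category
begin

abbreviation "CS V \<equiv> coeff_space star V"
abbreviation "CT V \<equiv> coeff_tensor star V"
abbreviation "HstAll \<equiv> HstC \<C> star"
abbreviation "fin_obs \<equiv> fin_objects \<C>"
abbreviation "simple_classes \<equiv> simple_iso_classes \<C>"

lemmas objD = left_moduleD[OF object]
lemmas obj_smult = module_smult[OF objD(1)]

lemma obj_closed:
  assumes "V \<in> \<C>"
  shows "\<zero>\<^bsub>V\<^esub> \<in> carrier V" "v \<in> carrier V \<Longrightarrow> w \<in> carrier V \<Longrightarrow> v \<oplus>\<^bsub>V\<^esub> w \<in> carrier V"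
    "v \<in> carrier V \<Longrightarrow> \<ominus>\<^bsub>V\<^esub> v \<in> carrier V"
proof -
  interpret abelian_group V by (rule objD(2)[OF assms])
  show "\<zero>\<^bsub>V\<^esub> \<in> carrier V" "v \<in> carrier V \<Longrightarrow> w \<in> carrier V \<Longrightarrow> v \<oplus>\<^bsub>V\<^esub> w \<in> carrier V"
    "v \<in> carrier V \<Longrightarrow> \<ominus>\<^bsub>V\<^esub> v \<in> carrier V" by auto
qed

lemma star_linear:
  assumes "V \<in> \<C>" "f \<in> star V"
  shows "v \<in> carrier V \<Longrightarrow> w \<in> carrier V \<Longrightarrow> f (v \<oplus>\<^bsub>V\<^esub> w) = f v + f w"
    and "v \<in> carrier V \<Longrightarrow> f (c \<odot>\<^bsub>V\<^esub> v) = c * f v"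
    and "v \<notin> carrier V \<Longrightarrow> f v = 0"
    and "f \<zero>\<^bsub>V\<^esub> = 0"
proof -
  have "star V \<subseteq> carrier (dual_space V)"
    using star_submodule[OF assms(1)] subgroup.subset[of "star V" "add_monoid (dual_space V)"]
    by (simp add: submodule_def)
  then have f: "f \<in> linear_maps V ground_space" "\<forall>v. v \<notin> carrier V \<longrightarrow> f v = 0"
    using assms(2) by (auto simp: dual_space_def)
  show "v \<in> carrier V \<Longrightarrow> w \<in> carrier V \<Longrightarrow> f (v \<oplus>\<^bsub>V\<^esub> w) = f v + f w"
    "v \<in> carrier V \<Longrightarrow> f (c \<odot>\<^bsub>V\<^esub> v) = c * f v" "v \<notin> carrier V \<Longrightarrow> f v = 0"
    using linear_mapsD(3,4)[OF f(1)] f(2) by auto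
  show "f \<zero>\<^bsub>V\<^esub> = 0"
    using linear_maps_zero[OF objD(2)[OF assms(1)] abelian_space_of f(1)] by simp
qed

lemma star_closed:
  assumes "V \<in> \<C>"
  shows "f \<in> star V \<Longrightarrow> g \<in> star V \<Longrightarrow> f + g \<in> star V" "0 \<in> star V"
    "f \<in> star V \<Longrightarrow> fun_scale c f \<in> star V"
proof -
  note s = star_submodule[OF assms]
  have g: "subgroup (star V) (add_monoid (dual_space V))" using s by (simp add: submodule_def)
  show "f \<in> star V \<Longrightarrow> g \<in> star V \<Longrightarrow> f + g \<in> star V" "0 \<in> star V"
    using subgroup.m_closed[OF g] subgroup.one_closed[OF g] by (auto simp: dual_space_def)
  show "f \<in> star V \<Longrightarrow> fun_scale c f \<in> star V"
    using submodule.smult_closed[OF s, of c f] by (simp add: dual_space_def ground_ring_def)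
qed

lemma star_abelian:
  assumes "V \<in> \<C>" shows "abelian_group (star_space star V)"
proof (rule abelian_groupI)
  fix f assume f: "f \<in> carrier (star_space star V)"
  then have "fun_scale (-1) f \<in> star V" by (intro star_closed(3)[OF assms]) simp
  moreover have "fun_scale (-1) f + f = 0" by (simp add: fun_scale_def fun_eq_iff)
  ultimately have "\<exists>g\<in>star V. g + f = 0" by blast
  then show "\<exists>g\<in>carrier (star_space star V). g \<oplus>\<^bsub>star_space star V\<^esub> f = \<zero>\<^bsub>star_space star V\<^esub>" by simp
qed (auto simp: star_closed[OF assms] add_ac)

lemma coeff_balanced_tensor:
  assumes V: "V \<in> \<C>"
  shows "balanced_tensor V (star_space star V) (endo_pairs V)"
proof (intro balanced_tensor.intro objD(2)[OF V] star_abelian[OF V] balanced_tensor_axioms.intro)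
  fix d d' x assume "(d, d') \<in> endo_pairs V"
  then have d: "d \<in> hom_H V V" "d' = transpose_map V d" by (auto simp: endo_pairs_def)
  show "x \<in> carrier V \<Longrightarrow> d x \<in> carrier V" using module_homsD(2)[OF d(1)] by blast
next
  fix d d' y assume "(d, d') \<in> endo_pairs V"
  then have d: "d \<in> hom_H V V" "d' = transpose_map V d" by (auto simp: endo_pairs_def)
  show "y \<in> carrier (star_space star V) \<Longrightarrow> d' y \<in> carrier (star_space star V)"
    using star_functorial[OF V V d(1)] d(2) by simp
qed

context
  fixes V assumes V: "V \<in> \<C>"
begin

interpretation ct: balanced_tensor V "star_space star V" "endo_pairs V"
  by (rule coeff_balanced_tensor[OF V])

lemmas CS_fields = coeff_space_def ct.tensor_over_fields

lemma coeff_space_group: "abelian_group (CS V)"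
  unfolding coeff_space_def by (rule ct.abelian_group_tensor_over)

lemma coeff_tensor_closed: "v \<in> carrier V \<Longrightarrow> f \<in> star V \<Longrightarrow> CT V v f \<in> carrier (CS V)"
  unfolding CS_fields by (rule ct.pt_closed) simp_all

lemma coeff_induct [consumes 1, case_names pure add]:
  assumes "X \<in> carrier (CS V)"
    and "\<And>v f. v \<in> carrier V \<Longrightarrow> f \<in> star V \<Longrightarrow> Q (CT V v f)"
    and "\<And>X Y. X \<in> carrier (CS V) \<Longrightarrow> Y \<in> carrier (CS V) \<Longrightarrow> Q X \<Longrightarrow> Q Y \<Longrightarrow> Q (X \<oplus>\<^bsub>CS V\<^esub> Y)"
  shows "Q X"
  using assms unfolding CS_fields by (rule ct.tensor_induct) auto

lemma coeff_smult:
  shows "X \<in> carrier (CS V) \<Longrightarrow> c \<odot>\<^bsub>CS V\<^esub> X \<in> carrier (CS V)"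
    and "X \<in> carrier (CS V) \<Longrightarrow> Y \<in> carrier (CS V) \<Longrightarrow>
      c \<odot>\<^bsub>CS V\<^esub> (X \<oplus>\<^bsub>CS V\<^esub> Y) = c \<odot>\<^bsub>CS V\<^esub> X \<oplus>\<^bsub>CS V\<^esub> c \<odot>\<^bsub>CS V\<^esub> Y"
    and "v \<in> carrier V \<Longrightarrow> f \<in> star V \<Longrightarrow> c \<odot>\<^bsub>CS V\<^esub> CT V v f = CT V (c \<odot>\<^bsub>V\<^esub> v) f"
proof -
  have s: "\<And>c. smult V c \<in> hom (add_monoid V) (add_monoid V)"
    using obj_smult[OF V] by (auto simp: hom_def)
  have d: "c \<odot>\<^bsub>V\<^esub> d x = d (c \<odot>\<^bsub>V\<^esub> x)" if "(d, d') \<in> endo_pairs V" "x \<in> carrier V" for c d d' x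
    using that module_homsD(4)[of d V "lact V" V "lact V" x c] by (auto simp: endo_pairs_def)
  have h: "smult (tensor_over V (star_space star V) (endo_pairs V)) c \<in> hom ct.TG ct.TG" for c
    by (rule ct.smult_tensor_hom) (fact s, rule d)
  show "X \<in> carrier (CS V) \<Longrightarrow> c \<odot>\<^bsub>CS V\<^esub> X \<in> carrier (CS V)"
    unfolding CS_fields using hom_in_carrier[OF h] .
  show "X \<in> carrier (CS V) \<Longrightarrow> Y \<in> carrier (CS V) \<Longrightarrow>
      c \<odot>\<^bsub>CS V\<^esub> (X \<oplus>\<^bsub>CS V\<^esub> Y) = c \<odot>\<^bsub>CS V\<^esub> X \<oplus>\<^bsub>CS V\<^esub> c \<odot>\<^bsub>CS V\<^esub> Y"
    unfolding CS_fields using hom_mult[OF h] .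
  show "v \<in> carrier V \<Longrightarrow> f \<in> star V \<Longrightarrow> c \<odot>\<^bsub>CS V\<^esub> CT V v f = CT V (c \<odot>\<^bsub>V\<^esub> v) f"
    unfolding coeff_space_def by (rule ct.smult_tensor_pure) (rule s d | simp)+
qed

lemma endoD:
  assumes "(d, d') \<in> endo_pairs V"
  shows "d \<in> hom_H V V" "d' = transpose_map V d"
  using assms by (auto simp: endo_pairs_def)

lemma \<beta>_balanced: "balanced V (star_space star V) (endo_pairs V) (space_of fun_scale) (mcoeff V)"
proof (rule balancedI)
  fix d d' x f assume d: "(d, d') \<in> endo_pairs V" and x: "x \<in> carrier V" and f: "f \<in> carrier (star_space star V)"
  note dd = endoD[OF d]
  show "mcoeff V (d x) f = mcoeff V x (d' f)"
    unfolding mcoeff_def dd(2) transpose_map_def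
    using module_homsD(5)[OF dd(1) x] objD(3)[OF V x] by (simp add: fun_eq_iff)
qed (auto simp: mcoeff_def fun_eq_iff star_linear[OF V] objD[OF V])

lemma \<beta>_hom: "\<beta> star V \<in> hom (add_monoid (CS V)) (add_monoid (space_of fun_scale))"
  unfolding coeff_space_def ct.hom_tensor_over \<beta>_def
  using ct.tensor_lift_hom[OF abelian_space_of \<beta>_balanced] unfolding mcoeff_def .

lemma \<beta>_pure: "v \<in> carrier V \<Longrightarrow> f \<in> star V \<Longrightarrow> \<beta> star V (CT V v f) = mcoeff V v f"
  using ct.tensor_lift_pure[OF abelian_space_of \<beta>_balanced, of v f] 
  unfolding \<beta>_def mcoeff_def by simp

lemma \<beta>_add: "X \<in> carrier (CS V) \<Longrightarrow> Y \<in> carrier (CS V) \<Longrightarrow>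
   \<beta> star V (X \<oplus>\<^bsub>CS V\<^esub> Y) = \<beta> star V X + \<beta> star V Y"
  using hom_mult[OF \<beta>_hom, of X Y] by simp

lemma \<beta>_smult: "X \<in> carrier (CS V) \<Longrightarrow> \<beta> star V (c \<odot>\<^bsub>CS V\<^esub> X) = fun_scale c (\<beta> star V X)"
proof (induction rule: coeff_induct)
  case (pure v f)
  then show ?case
    using objD[OF V] star_linear[OF V] obj_smult[OF V]
    by (simp add: coeff_smult \<beta>_pure) (simp add: mcoeff_def fun_scale_def fun_eq_iff)
next
  case (add X Y)
  then show ?case by (simp add: coeff_smult \<beta>_add) (simp add: fun_scale_def fun_eq_iff algebra_simps)
qed

lemma dual_act_closed: "f \<in> star V \<Longrightarrow> dual_act V f h \<in> star V"
  using star_right_act[OF V] by blast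

text \<open>Common source of both actions on the coefficient bimodule: \<open>p\<close> is the part
  on \<open>V\<close>, \<open>q\<close> the part on its dual, and \<open>\<tau>\<close> the effect
  on functions on \<open>H\<close>. Commuting with the \<open>H\<close>-endomorphisms makes the pair
  compatible with balancing over \<open>D(V)\<close>.\<close>

lemma coeff_lift:
  assumes p: "\<And>v. v \<in> carrier V \<Longrightarrow> p v \<in> carrier V" and q: "\<And>f. f \<in> star V \<Longrightarrow> q f \<in> star V"
    and p_add: "\<And>v w. v \<in> carrier V \<Longrightarrow> w \<in> carrier V \<Longrightarrow> p (v \<oplus>\<^bsub>V\<^esub> w) = p v \<oplus>\<^bsub>V\<^esub> p w"
    and q_add: "\<And>f g. f \<in> star V \<Longrightarrow> g \<in> star V \<Longrightarrow> q (f + g) = q f + q g"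
    and p_endo: "\<And>d v. d \<in> hom_H V V \<Longrightarrow> v \<in> carrier V \<Longrightarrow> p (d v) = d (p v)"
    and q_endo: "\<And>d f. d \<in> hom_H V V \<Longrightarrow> f \<in> star V \<Longrightarrow> q (transpose_map V d f) = transpose_map V d (q f)"
    and mc: "\<And>v f. v \<in> carrier V \<Longrightarrow> f \<in> star V \<Longrightarrow> mcoeff V (p v) (q f) = \<tau> (mcoeff V v f)"
    and \<tau>: "\<And>\<xi> \<eta>. \<tau> (\<xi> + \<eta>) = \<tau> \<xi> + \<tau> \<eta>"
    and X: "X \<in> carrier (CS V)"
  defines "L \<equiv> tensor_lift (CS V) (\<lambda>v f. CT V (p v) (q f))"
  shows "L X \<in> carrier (CS V) \<and> \<beta> star V (L X) = \<tau> (\<beta> star V X)"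
proof
  have b: "balanced V (star_space star V) (endo_pairs V) (CS V) (\<lambda>v f. CT V (p v) (q f))"
  proof (rule balancedI)
    fix d d' x f assume d: "(d, d') \<in> endo_pairs V" and x: "x \<in> carrier V" "f \<in> carrier (star_space star V)"
    show "CT V (p (d x)) (q f) = CT V (p x) (q (d' f))"
      using ct.pt_balanced[OF d, of "p x" "q f"] x p q p_endo q_endo endoD[OF d] by simp
  qed (use p q p_add q_add ct.pt_add_left ct.pt_add_right in
      \<open>auto simp: CS_fields intro!: ct.pt_closed\<close>)
  have h: "L \<in> hom (add_monoid (CS V)) (add_monoid (CS V))"
    unfolding L_def using ct.tensor_lift_hom[OF coeff_space_group b]
    by (simp add: coeff_space_def ct.hom_tensor_over)
  have L_pure: "L (CT V v f) = CT V (p v) (q f)" if "v \<in> carrier V" "f \<in> star V" for v f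
    unfolding L_def by (rule ct.tensor_lift_pure[OF coeff_space_group b]) (use that in auto)
  have c: "L X \<in> carrier (CS V)" if "X \<in> carrier (CS V)" for X
    using hom_in_carrier[OF h] that by simp
  show "L X \<in> carrier (CS V)" by (rule c[OF X])
  show "\<beta> star V (L X) = \<tau> (\<beta> star V X)"
    using X
  proof (induction rule: coeff_induct)
    case (pure v f)
    then show ?case by (simp add: L_pure \<beta>_pure p q mc)
  next
    case (add X Y)
    then show ?case using hom_mult[OF h, of X Y] c by (simp only: \<beta>_add \<tau>) (simp add: \<beta>_add)
  qed
qed

lemma coeff_lact:
  assumes "X \<in> carrier (CS V)"
  shows "coeff_lact star V h X \<in> carrier (CS V) \<and>
     \<beta> star V (coeff_lact star V h X) = Hst_act h (\<beta> star V X) 1"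
  unfolding coeff_lact_def
  by (rule coeff_lift[where p = "lact V h" and q = "\<lambda>f. f" and \<tau> = "\<lambda>\<xi>. Hst_act h \<xi> 1", OF _ _ _ _ _ _ _ _ assms];
      simp add: objD[OF V] module_homsD mcoeff_def Hst_act_def fun_eq_iff)

lemma coeff_ract:
  assumes "X \<in> carrier (CS V)"
  shows "coeff_ract star V X h \<in> carrier (CS V) \<and>
     \<beta> star V (coeff_ract star V X h) = Hst_act 1 (\<beta> star V X) h"
  unfolding coeff_ract_def
  by (rule coeff_lift[where p = "\<lambda>v. v" and q = "\<lambda>f. dual_act V f h" and \<tau> = "\<lambda>\<xi>. Hst_act 1 \<xi> h", OF _ _ _ _ _ _ _ _ assms];
      (rule dual_act_closed, assumption)?;
      (simp add: mcoeff_def Hst_act_def fun_eq_iff objD[OF V] module_homsD dual_act_def transpose_map_def)?)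

lemma mcoeff_Hst: "v \<in> carrier V \<Longrightarrow> f \<in> star V \<Longrightarrow> mcoeff V v f \<in> Hst star V"
  unfolding Hst_def using \<beta>_pure coeff_tensor_closed by force

lemma Hst_induct [consumes 1, case_names coeff add]:
  assumes "\<xi> \<in> Hst star V"
    and "\<And>v f. v \<in> carrier V \<Longrightarrow> f \<in> star V \<Longrightarrow> Q (mcoeff V v f)"
    and "\<And>\<xi> \<eta>. \<xi> \<in> Hst star V \<Longrightarrow> \<eta> \<in> Hst star V \<Longrightarrow> Q \<xi> \<Longrightarrow> Q \<eta> \<Longrightarrow> Q (\<xi> + \<eta>)"
  shows "Q \<xi>"
proof -
  obtain X where X: "X \<in> carrier (CS V)" "\<xi> = \<beta> star V X" using assms(1) by (auto simp: Hst_def)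
  from X(1) have "Q (\<beta> star V X)"
  proof (induction rule: coeff_induct)
    case (pure v f)
    then show ?case using assms(2) \<beta>_pure by simp
  next
    case (add X Y)
    then show ?case unfolding \<beta>_add[OF add(1,2)] by (intro assms(3)) (auto simp: Hst_def)
  qed
  then show ?thesis using X by simp
qed

lemma Hst_add: "\<xi> \<in> Hst star V \<Longrightarrow> \<eta> \<in> Hst star V \<Longrightarrow> \<xi> + \<eta> \<in> Hst star V"
  unfolding Hst_def using \<beta>_add coeff_space_group abelian_monoid.a_closed[OF abelian_group.axioms(1)]
  by (smt (verit, best) imageE imageI)

lemma Hst_scale: "\<xi> \<in> Hst star V \<Longrightarrow> fun_scale c \<xi> \<in> Hst star V"
  unfolding Hst_def using \<beta>_smult coeff_smult(1) by (smt (verit, best) imageE imageI)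

lemma Hst_zero: "0 \<in> Hst star V"
  using mcoeff_Hst[OF obj_closed(1)[OF V] star_closed(2)[OF V]] by (simp add: mcoeff_def zero_fun_def)

lemma Hst_subspace: "fs.subspace (Hst star V)"
  by (simp add: fs.subspace_def Hst_add Hst_scale Hst_zero)

lemma Hst_linear:
  assumes "\<xi> \<in> Hst star V"
  shows "\<xi> (x + y) = \<xi> x + \<xi> y" "\<xi> (cm c x) = c * \<xi> x"
proof -
  have "(\<forall>x y. \<xi> (x + y) = \<xi> x + \<xi> y) \<and> (\<forall>c x. \<xi> (cm c x) = c * \<xi> x)"
    using assms
    by (induction rule: Hst_induct) (auto simp: mcoeff_def objD[OF V] star_linear[OF V] algebra_simps)
  then show "\<xi> (x + y) = \<xi> x + \<xi> y" "\<xi> (cm c x) = c * \<xi> x" by auto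
qed

lemma Hst_HstC: "\<xi> \<in> Hst star V \<Longrightarrow> \<xi> \<in> HstAll"
  unfolding HstC_def by (rule fs.span_base) (use V in auto)

end

text \<open>The coefficient of \<open>\<phi> v\<close> and \<open>f\<close> is the coefficient of
  \<open>v\<close> and the transpose of \<open>f\<close>, and surjectivity reaches every vector of
  \<open>W\<close>.\<close>

lemma Hst_quotient:
  assumes "V \<in> \<C>" "W \<in> \<C>" "\<phi> \<in> hom_H V W" "\<phi> ` carrier V = carrier W"
  shows "Hst star W \<subseteq> Hst star V"
proof
  fix \<xi> assume "\<xi> \<in> Hst star W"
  then show "\<xi> \<in> Hst star V"
    using assms(2)
  proof (induction rule: Hst_induct[OF assms(2), consumes 1, case_names coeff add])
    case (coeff w f)
    then obtain v where v: "v \<in> carrier V" "w = \<phi> v" using assms(4) by auto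
    have "mcoeff W w f = mcoeff V v (transpose_map V \<phi> f)"
      unfolding mcoeff_def transpose_map_def v(2)
      using module_homsD(5)[OF assms(3) v(1)] objD(3)[OF assms(1) v(1)] by (simp add: fun_eq_iff)
    then show ?case using mcoeff_Hst[OF assms(1) v(1) star_functorial[OF assms(1-3) coeff(2)]] by simp
  next
    case (add \<xi> \<eta>)
    then show ?case by (intro Hst_add[OF assms(1)])
  qed
qed

lemma Hst_iso:
  assumes "V \<in> \<C>" "W \<in> \<C>" "isomorphic V W"
  shows "Hst star V = Hst star W"
proof -
  have "Hst star W \<subseteq> Hst star V" if VW: "V \<in> \<C>" "W \<in> \<C>" "isomorphic V W" for V W
    using VW(3) Hst_quotient[OF VW(1,2)] by (auto simp: isomorphic_def module_isos_def bij_betw_def)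
  then show ?thesis using assms isomorphic_sym[OF object[OF assms(1)]] by blast
qed

end

context duality_category
begin

lemma \<beta>_inj_on:
  assumes V: "V \<in> \<C>" and simple: "simple_coeff_bimodule star V"
  shows "inj_on (\<beta> star V) (carrier (CS V))"
proof -
  let ?A = "CS V" and ?F = "space_of fun_scale :: ('k, 'h \<Rightarrow> 'k) module"
  interpret A: abelian_group ?A by (rule coeff_space_group[OF V])
  interpret F: abelian_group ?F by (rule abelian_space_of)
  interpret h: group_hom "add_monoid ?A" "add_monoid ?F" "\<beta> star V"
    using \<beta>_hom[OF V] A.a_group F.a_group by (simp add: group_hom_def group_hom_axioms_def)
  define K where "K = kernel (add_monoid ?A) (add_monoid ?F) (\<beta> star V)"
  have K: "X \<in> K \<longleftrightarrow> X \<in> carrier ?A \<and> \<beta> star V X = 0" for X by (simp add: K_def kernel_def)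
  have sub: "subgroup K (add_monoid ?A)" unfolding K_def by (rule h.subgroup_kernel)
  have "submodule K ground_ring ?A"
    by (intro submodule.intro sub submodule_axioms.intro)
      (auto simp: K coeff_smult[OF V] \<beta>_smult[OF V])
  then have "left_submodule K ?A (coeff_lact star V) \<and> (\<forall>h. \<forall>u\<in>K. coeff_ract star V u h \<in> K)"
    by (auto simp: left_submodule_def K coeff_lact[OF V] coeff_ract[OF V] Hst_act_def fun_eq_iff)
  \<comment> \<open>If \<beta> vanished identically, evaluating coefficients at 1 would give
    \<open>g v = 0\<close> for all \<open>g\<close> and \<open>v\<close>; non-degeneracy then makes
    \<open>V\<close> zero, hence all pure tensors zero, against the nonvanishing contained in
    simplicity.\<close>
  moreover have "K \<noteq> carrier ?A"
  proof
    assume eq: "K = carrier ?A"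
    have "CT V v f = \<zero>\<^bsub>?A\<^esub>" if v: "v \<in> carrier V" and f: "f \<in> star V" for v f
    proof -
      interpret ct: balanced_tensor V "star_space star V" "endo_pairs V"
        by (rule coeff_balanced_tensor[OF V])
      have "g v = 0" if "g \<in> star V" for g
      proof -
        have "mcoeff V v g = 0"
          using eq coeff_tensor_closed[OF V v that] \<beta>_pure[OF V v that] K by metis
        then have "mcoeff V v g 1 = 0" by simp
        then show ?thesis using objD(9)[OF V v] by (simp add: mcoeff_def)
      qed
      then have "v = \<zero>\<^bsub>V\<^esub>" using star_nondegenerate[OF V v] by blast
      then show ?thesis using ct.TG_one[of f] f by (simp add: coeff_space_def ct.tensor_over_fields)
    qed
    then have "X = \<zero>\<^bsub>?A\<^esub>" if "X \<in> carrier ?A" for X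
      using coeff_induct[OF V that, of "\<lambda>X. X = \<zero>\<^bsub>?A\<^esub>"] by simp
    then have "carrier ?A = {\<zero>\<^bsub>?A\<^esub>}" using A.zero_closed by blast
    then show False using simple by (simp add: simple_coeff_bimodule_def simple_bimodule_def)
  qed
  ultimately have "K = {\<zero>\<^bsub>?A\<^esub>}"
    using simple unfolding simple_coeff_bimodule_def simple_bimodule_def by blast
  then show ?thesis using h.inj_iff_trivial_ker by (simp add: K_def)
qed

lemma HstC_closed:
  shows "f \<in> HstAll \<Longrightarrow> g \<in> HstAll \<Longrightarrow> f + g \<in> HstAll"
    and "f \<in> HstAll \<Longrightarrow> fun_scale c f \<in> HstAll"
  unfolding HstC_def by (auto intro: fs.span_add fs.span_scale)

lemma HstC_zero: "0 \<in> HstAll"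
  unfolding HstC_def by (rule fs.span_zero)

end

section \<open>Part (a): the composite of \<open>\<Phi>\<close> and \<beta> carries the diamond
  action to the adjoint action\<close>

context tensor_completion
begin

lemma coeff_space_iso_ad:
  assumes V: "V \<in> \<C>" and simple: "simple_coeff_bimodule star V"
    and P: "P \<in> adapted H T" and inj: "inj_on (\<Phi> T P) (HstAll)"
  shows "\<Phi> T P \<circ> \<beta> star V \<in> module_isos (CS V)
          (diamond_action H (CS V) (coeff_lact star V) (coeff_ract star V))
          (HVP H star T P V) (ad_action H (hspace H) (*) (*))"
proof -
  let ?A = "CS V"
  let ?d = "diamond_action H ?A (coeff_lact star V) (coeff_ract star V)"
  let ?\<phi> = "\<Phi> T P \<circ> \<beta> star V"
  interpret A: abelian_group ?A by (rule coeff_space_group[OF V])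
  note bi = \<beta>_inj_on[OF V simple]
  have bH: "\<beta> star V X \<in> Hst star V" if "X \<in> carrier ?A" for X using that by (simp add: Hst_def)
  have bC: "\<beta> star V X \<in> HstAll" if "X \<in> carrier ?A" for X using Hst_HstC[OF V bH[OF that]] .
  have eqI: "X = Y" if "X \<in> carrier ?A" "Y \<in> carrier ?A" "\<beta> star V X = \<beta> star V Y" for X Y
    using inj_onD[OF bi that(3,1,2)] .
  have phi_add: "?\<phi> (X \<oplus>\<^bsub>?A\<^esub> Y) = ?\<phi> X + ?\<phi> Y" if "X \<in> carrier ?A" "Y \<in> carrier ?A" for X Y
    using that by (simp add: \<Phi>_def \<beta>_add[OF V] slice_add bC del: plus_fun_apply)
  have phi_smult: "?\<phi> (c \<odot>\<^bsub>?A\<^esub> X) = hscale H c (?\<phi> X)" if "X \<in> carrier ?A" for c X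
    using that by (simp add: \<Phi>_def \<beta>_smult[OF V] slice_scale bC)
  have phi_hom: "?\<phi> \<in> hom (add_monoid ?A) (add_monoid (hspace H))"
    using phi_add by (simp add: hom_def)
  \<comment> \<open>Instead of computing with cosets, the required equations are compared after
    applying the injective \<beta>, where they become identities between functions on
    \<open>H\<close> that follow from linearity of the coefficients.\<close>
  have bal: "hbal ?A (\<lambda>x y. coeff_ract star V (coeff_lact star V (ant (ant y)) X) (ant x))"
    if X: "X \<in> carrier ?A" for X
  proof -
    note l = Hst_linear[OF V bH[OF X]]
    show ?thesis
      using X by (intro hbalI eqI)
        (auto simp: coeff_lact[OF V] coeff_ract[OF V] \<beta>_add[OF V] Hst_act_def fun_eq_iff ant_add ant_scale
           distrib l hscale_mult)
  qed
  have bal': "?d h X = sweedler H ?A (\<lambda>x y. coeff_ract star V (coeff_lact star V (ant (ant y)) X) (ant x)) h" for h X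
    by (simp add: diamond_action_def)
  have act: "?\<phi> (?d h X) = ad_action H (hspace H) (*) (*) h (?\<phi> X)" if X: "X \<in> carrier ?A" for h X
  proof -
    have "Hst_act 1 (Hst_act a \<xi> 1) b = Hst_act a \<xi> b" for a b and \<xi> :: "'h \<Rightarrow> 'k"
      by (simp add: Hst_act_def mult.assoc)
    then have "?\<phi> (?d h X) = sweedler H (hspace H) (\<lambda>x y. slice T (Hst_act (ant (ant y)) (\<beta> star V X) (ant x)) P) h"
      unfolding bal' sweedler_hom[OF coeff_space_group[OF V] bal[OF X] hspace_abelian phi_hom]
      using X by (simp add: coeff_lact[OF V] coeff_ract[OF V] \<Phi>_def)
    also have "\<dots> = sweedler H (hspace H) (\<lambda>x y. x * slice T (\<beta> star V X) P * ant y) h"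
      by (rule slice_adapted[OF P bC[OF X]])
    finally show ?thesis by (simp add: ad_action_def \<Phi>_def)
  qed
  have "?\<phi> \<in> module_homs ?A ?d (HVP H star T P V) (ad_action H (hspace H) (*) (*))"
    by (rule module_homsI) (use bH phi_add phi_smult act in \<open>auto simp: HVP_def\<close>)
  moreover have "bij_betw ?\<phi> (carrier ?A) (carrier (HVP H star T P V))"
  proof (rule bij_betw_imageI)
    show "inj_on ?\<phi> (carrier ?A)"
      by (rule comp_inj_on[OF bi inj_on_subset[OF inj]]) (use bC in auto)
    show "?\<phi> ` carrier ?A = carrier (HVP H star T P V)"
      by (auto simp: HVP_def Hst_def)
  qed
  ultimately show ?thesis by (simp add: module_isos_def)
qed

end

text \<open>As rewrite rules, these also expand sums and zeros of functions that are not applied to an argument.\<close>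

declare plus_fun_apply [simp del] zero_fun_apply [simp del]

lemmas fun_pointwise = fun_eq_iff plus_fun_apply zero_fun_apply

section \<open>Independence of the coefficient spaces of simple modules\<close>

text \<open>The target consists of all functions on \<open>H\<close>, with the left action of the
  dual; that elements of a coefficient space are linear on \<open>H\<close> is used only later, in
  \<open>Hst_disjoint\<close>.\<close>

abbreviation "coeff_homs V \<equiv> module_homs V (lact V) (space_of fun_scale) (\<lambda>h \<xi>. Hst_act h \<xi> 1)"

definition shift_inv :: "('h::ring_1 \<Rightarrow> 'k::field) set \<Rightarrow> bool" where
  "shift_inv N \<longleftrightarrow> fs.subspace N \<and> (\<forall>h. \<forall>\<xi>\<in>N. Hst_act h \<xi> 1 \<in> N)"

text \<open>Recursion over a list of pairs replaces a homomorphism out of an external direct sum,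
  which would first have to be built as an object. Repeated modules are welcome: several copies of
  one \<open>V\<close> are the typical case.\<close>

fun image_sum :: "(('k::field, 'h::ring_1, 'v) hmod \<times> ('v \<Rightarrow> 'h \<Rightarrow> 'k)) list \<Rightarrow> ('h \<Rightarrow> 'k) set" where
  "image_sum [] = {0}"
| "image_sum ((W, \<phi>) # L) = {\<phi> w + t | w t. w \<in> carrier W \<and> t \<in> image_sum L}"

lemma shift_invD:
  assumes "shift_inv N"
  shows "0 \<in> N" "\<xi> \<in> N \<Longrightarrow> \<eta> \<in> N \<Longrightarrow> \<xi> + \<eta> \<in> N" "\<xi> \<in> N \<Longrightarrow> \<eta> \<in> N \<Longrightarrow> \<xi> - \<eta> \<in> N"
    "\<xi> \<in> N \<Longrightarrow> fun_scale c \<xi> \<in> N" "\<xi> \<in> N \<Longrightarrow> Hst_act h \<xi> 1 \<in> N"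
  using assms fs.subspace_0 fs.subspace_add fs.subspace_diff fs.subspace_scale
  unfolding shift_inv_def by blast+

lemma Hst_act_add: "Hst_act h (\<xi> + \<eta>) h' = Hst_act h \<xi> h' + Hst_act h \<eta> h'"
  by (simp add: Hst_act_def fun_pointwise)

lemma image_sum_append: "\<xi> \<in> image_sum L \<Longrightarrow> \<eta> \<in> image_sum L' \<Longrightarrow> \<xi> + \<eta> \<in> image_sum (L @ L')"
proof (induction L arbitrary: \<xi>)
  case (Cons p L)
  obtain W \<phi> where p: "p = (W, \<phi>)" by force
  obtain w t where wt: "\<xi> = \<phi> w + t" "w \<in> carrier W" "t \<in> image_sum L" using Cons.prems(1) p by auto
  have "\<xi> + \<eta> = \<phi> w + (t + \<eta>)" using wt(1) by (simp add: add.assoc)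
  moreover have "t + \<eta> \<in> image_sum (L @ L')" by (rule Cons.IH[OF wt(3) Cons.prems(2)])
  ultimately show ?case using wt(2) unfolding p append_Cons image_sum.simps by blast
qed simp

lemma image_sum_single: "image_sum [(W, \<phi>)] = \<phi> ` carrier W"
  by auto

context duality_category
begin

lemma left_submoduleI:
  assumes V: "V \<in> \<C>" and U: "U \<subseteq> carrier V" "\<zero>\<^bsub>V\<^esub> \<in> U" "\<And>u w. u \<in> U \<Longrightarrow> w \<in> U \<Longrightarrow> u \<oplus>\<^bsub>V\<^esub> w \<in> U"
    "\<And>c u. u \<in> U \<Longrightarrow> c \<odot>\<^bsub>V\<^esub> u \<in> U" "\<And>h u. u \<in> U \<Longrightarrow> lact V h u \<in> U"
  shows "left_submodule U V (lact V)"
proof -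
  interpret module ground_ring V by (rule objD(1)[OF V])
  have "\<ominus>\<^bsub>V\<^esub> u \<in> U" if "u \<in> U" for u
    using U(4)[OF that, of "-1"] obj_smult(8)[OF V, of u] that U(1) by auto
  then show ?thesis
    unfolding left_submodule_def using U by (intro conjI submoduleI) auto
qed

lemma coeff_homs_zero: "V \<in> \<C> \<Longrightarrow> \<phi> \<in> coeff_homs V \<Longrightarrow> \<phi> \<zero>\<^bsub>V\<^esub> = 0"
  using linear_maps_zero[OF objD(2) abelian_space_of module_homsD(1)] by simp

lemma image_sum_invariant:
  assumes "\<And>W \<phi>. (W, \<phi>) \<in> set L \<Longrightarrow> W \<in> \<C> \<and> \<phi> \<in> coeff_homs W"
  shows "shift_inv (image_sum L)"
  using assms
proof (induction L)
  case Nil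
  then show ?case by (simp add: shift_inv_def Hst_act_def fun_pointwise)
next
  case (Cons p L)
  obtain W \<phi> where p: "p = (W, \<phi>)" by force
  have W: "W \<in> \<C>" and \<phi>: "\<phi> \<in> coeff_homs W" using Cons.prems p by auto
  have IH: "shift_inv (image_sum L)" using Cons by auto
  note i = shift_invD[OF IH] and h = module_homsD[OF \<phi>]
  have "0 = \<phi> \<zero>\<^bsub>W\<^esub> + 0" by (simp add: coeff_homs_zero[OF W \<phi>])
  then have z: "0 \<in> image_sum ((W, \<phi>) # L)" using obj_closed(1)[OF W] i(1) unfolding image_sum.simps by blast
  have a: "\<xi> + \<eta> \<in> image_sum ((W, \<phi>) # L)" if "\<xi> \<in> image_sum ((W, \<phi>) # L)" "\<eta> \<in> image_sum ((W, \<phi>) # L)" for \<xi> \<eta>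
  proof -
    obtain w t w' t' where wt: "\<xi> = \<phi> w + t" "w \<in> carrier W" "t \<in> image_sum L"
      "\<eta> = \<phi> w' + t'" "w' \<in> carrier W" "t' \<in> image_sum L" using \<open>\<xi> \<in> _\<close> \<open>\<eta> \<in> _\<close> by auto
    have "\<xi> + \<eta> = \<phi> (w \<oplus>\<^bsub>W\<^esub> w') + (t + t')" using wt h(3)[of w w'] by (simp add: add_ac)
    then show ?thesis using wt obj_closed(2)[OF W] i(2) unfolding image_sum.simps by blast
  qed
  have s: "fun_scale c \<xi> \<in> image_sum ((W, \<phi>) # L)" if "\<xi> \<in> image_sum ((W, \<phi>) # L)" for \<xi> c
  proof -
    obtain w t where wt: "\<xi> = \<phi> w + t" "w \<in> carrier W" "t \<in> image_sum L" using \<open>\<xi> \<in> _\<close> by auto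
    have "fun_scale c \<xi> = \<phi> (c \<odot>\<^bsub>W\<^esub> w) + fun_scale c t"
      unfolding wt(1) fs.scale_right_distrib using h(4)[OF wt(2)] by simp
    then show ?thesis using wt obj_smult(1)[OF W] i(4) unfolding image_sum.simps by blast
  qed
  have l: "Hst_act g \<xi> 1 \<in> image_sum ((W, \<phi>) # L)" if "\<xi> \<in> image_sum ((W, \<phi>) # L)" for \<xi> g
  proof -
    obtain w t where wt: "\<xi> = \<phi> w + t" "w \<in> carrier W" "t \<in> image_sum L" using \<open>\<xi> \<in> _\<close> by auto
    have "Hst_act g \<xi> 1 = \<phi> (lact W g w) + Hst_act g t 1"
      unfolding wt(1) Hst_act_add using h(5)[OF wt(2)] by simp
    then show ?thesis using wt objD(3)[OF W] i(5) unfolding image_sum.simps by blast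
  qed
  show ?case
    unfolding p shift_inv_def fs.subspace_def using z a s l by blast
qed

text \<open>
  A nonzero invariant subspace of a sum of images of simple modules contains a copy of one of them:
  if it meets the sum \<open>T\<close> of the remaining images trivially, then \<open>n\<close> is determined by \<open>v\<close> in
  \<open>n - \<phi> v \<in> T\<close>, and \<open>v \<mapsto> n\<close> is the required embedding.
\<close>

lemma simple_in_image_sum:
  assumes "\<And>W \<phi>. (W, \<phi>) \<in> set L \<Longrightarrow> W \<in> \<C> \<and> simple_hmod W \<and> \<phi> \<in> coeff_homs W"
    and "shift_inv N" "N \<noteq> {0}" "N \<subseteq> image_sum L"
  shows "\<exists>(W, \<phi>)\<in>set L. \<exists>\<psi>\<in>coeff_homs W. inj_on \<psi> (carrier W) \<and> \<psi> ` carrier W \<subseteq> N"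
  using assms
proof (induction L arbitrary: N)
  case Nil
  then have "N \<subseteq> {0}" by simp
  then show ?case using Nil(3) shift_invD(1)[OF Nil(2)] by auto
next
  case (Cons p L)
  obtain V \<phi> where p: "p = (V, \<phi>)" by force
  have V: "V \<in> \<C>" and \<phi>: "\<phi> \<in> coeff_homs V" and simple: "simple_hmod V" using Cons.prems(1) p by auto
  let ?T = "image_sum L"
  have T: "shift_inv ?T" using Cons.prems(1) by (intro image_sum_invariant) auto
  note t = shift_invD[OF T] and n = shift_invD[OF Cons.prems(2)]
    and h = module_homsD[OF \<phi>]
  show ?case
  proof (cases "N \<inter> ?T = {0}")
    case False
    have "shift_inv (N \<inter> ?T)"
      using Cons.prems(2) T unfolding shift_inv_def by (auto intro: fs.subspace_inter)
    then have "\<exists>(W, \<phi>)\<in>set L. \<exists>\<psi>\<in>coeff_homs W. inj_on \<psi> (carrier W) \<and> \<psi> ` carrier W \<subseteq> N \<inter> ?T"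
      using Cons.prems(1) False by (intro Cons.IH) auto
    then show ?thesis by fastforce
  next
    case True
    define r where "r = (\<lambda>v \<eta>. v \<in> carrier V \<and> \<eta> \<in> N \<and> \<eta> - \<phi> v \<in> ?T)"
    have unique: "\<eta> = \<eta>'" if "r v \<eta>" "r v \<eta>'" for v \<eta> \<eta>'
    proof -
      have "\<eta> - \<eta>' = (\<eta> - \<phi> v) - (\<eta>' - \<phi> v)" by simp
      then have "\<eta> - \<eta>' \<in> N \<inter> ?T" using that t(3) n(3) unfolding r_def by (metis IntI)
      then show ?thesis using True by auto
    qed
    have r_zero: "r \<zero>\<^bsub>V\<^esub> 0" using obj_closed(1)[OF V] n(1) t(1) coeff_homs_zero[OF V \<phi>] by (simp add: r_def)
    have r_add: "r (v \<oplus>\<^bsub>V\<^esub> w) (\<eta> + \<eta>')" if "r v \<eta>" "r w \<eta>'" for v w \<eta> \<eta>'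
    proof -
      have "\<eta> + \<eta>' - \<phi> (v \<oplus>\<^bsub>V\<^esub> w) = (\<eta> - \<phi> v) + (\<eta>' - \<phi> w)" using that h(3)[of v w] by (simp add: r_def)
      then show ?thesis using that t(2) n(2) obj_closed(2)[OF V] unfolding r_def by metis
    qed
    have r_scale: "r (c \<odot>\<^bsub>V\<^esub> v) (fun_scale c \<eta>)" if "r v \<eta>" for c v \<eta>
    proof -
      have "fun_scale c \<eta> - \<phi> (c \<odot>\<^bsub>V\<^esub> v) = fun_scale c (\<eta> - \<phi> v)"
        using that h(4)[of v c] unfolding fs.scale_right_diff_distrib by (simp add: r_def)
      then show ?thesis using that t(4) n(4) obj_smult(1)[OF V] unfolding r_def by metis
    qed
    have r_act: "r (lact V g v) (Hst_act g \<eta> 1)" if "r v \<eta>" for g v \<eta>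
    proof -
      have "Hst_act g \<eta> 1 - \<phi> (lact V g v) = Hst_act g (\<eta> - \<phi> v) 1"
        using that h(5)[of v g] by (simp add: r_def Hst_act_def fun_pointwise)
      then show ?thesis using that t(5) n(5) objD(3)[OF V] unfolding r_def by metis
    qed
    \<comment> \<open>The relation \<open>r\<close> is a partial function and \<open>U\<close> is
      its domain. A nonzero element of \<open>N\<close> is related to some \<open>v\<close>, and
      \<open>v\<close> is not zero because \<open>r\<close> already relates the zero vector to 0;
      simplicity thus makes \<open>r\<close> total.\<close>
    define U where "U = {v. \<exists>\<eta>. r v \<eta>}"
    have "left_submodule U V (lact V)"
    proof (rule left_submoduleI[OF V])
      show "U \<subseteq> carrier V" by (auto simp: U_def r_def)
    qed (use r_zero r_add r_scale r_act in \<open>unfold U_def, blast+\<close>)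
    moreover obtain \<eta> where \<eta>: "\<eta> \<in> N" "\<eta> \<noteq> 0" using Cons.prems(3) n(1) by auto
    then obtain v where v: "r v \<eta>" using Cons.prems(4) p unfolding r_def by fastforce
    have "v \<noteq> \<zero>\<^bsub>V\<^esub>" using v r_zero unique \<eta> by blast
    then have "U \<noteq> {\<zero>\<^bsub>V\<^esub>}" using v by (auto simp: U_def)
    ultimately have U: "U = carrier V" using simple unfolding simple_module_def by blast
    define \<psi> where "\<psi> v = (THE \<eta>. r v \<eta>)" for v
    have \<psi>: "r v (\<psi> v)" if "v \<in> carrier V" for v
    proof -
      have "\<exists>!\<eta>. r v \<eta>" using that U unique unfolding U_def by blast
      then show ?thesis unfolding \<psi>_def by (rule theI')
    qed
    have \<psi>_eq: "\<psi> v = \<eta>" if "r v \<eta>" for v \<eta>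
      using that unique \<psi> r_def by metis
    have \<psi>_hom: "\<psi> \<in> coeff_homs V"
      by (rule module_homsI) (auto intro!: \<psi>_eq r_add r_scale r_act \<psi>)
    define K where "K = {w \<in> carrier V. \<psi> w = 0}"
    have "left_submodule K V (lact V)"
      unfolding K_def
      by (rule left_submoduleI[OF V])
        (auto simp: module_homsD[OF \<psi>_hom] coeff_homs_zero[OF V \<psi>_hom] obj_closed[OF V] obj_smult[OF V] objD[OF V],
         simp add: Hst_act_def fun_pointwise)
    moreover have "K \<noteq> carrier V" using \<psi>_eq[OF v] \<eta> v unfolding K_def r_def by blast
    ultimately have K: "K = {\<zero>\<^bsub>V\<^esub>}" using simple unfolding simple_module_def by blast
    have "inj_on \<psi> (carrier V)"
    proof -
      interpret group_hom "add_monoid V" "add_monoid (space_of fun_scale :: ('k, 'h \<Rightarrow> 'k) module)" \<psi>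
        by (intro group_hom.intro group_hom_axioms.intro linear_mapsD(1) module_homsD(1)[OF \<psi>_hom]
          abelian_group.a_group objD(2)[OF V] abelian_space_of)
      show ?thesis using inj_on_one_iff K unfolding K_def by auto
    qed
    moreover have "\<psi> ` carrier V \<subseteq> N" using \<psi> by (auto simp: r_def)
    ultimately show ?thesis using \<psi>_hom p by auto
  qed
qed

lemma simple_nonzero:
  assumes "V \<in> \<C>" "simple_hmod V"
  shows "\<exists>v\<in>carrier V. v \<noteq> \<zero>\<^bsub>V\<^esub>"
  using assms obj_closed(1)[OF assms(1)] unfolding simple_module_def by blast

text \<open>The preimage under \<psi> of the image of \<chi> is a nonzero submodule of the simple
  \<open>V\<close>, hence everything; the two images coincide and one embedding can be inverted
  along the other.\<close>

lemma isomorphic_of_embeddings: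
  assumes V: "V \<in> \<C>" "simple_hmod V" and W: "W \<in> \<C>" "simple_hmod W"
    and \<psi>: "\<psi> \<in> coeff_homs V" "inj_on \<psi> (carrier V)"
    and \<chi>: "\<chi> \<in> coeff_homs W" "inj_on \<chi> (carrier W)"
    and sub: "\<chi> ` carrier W \<subseteq> \<psi> ` carrier V"
  shows "isomorphic W V"
proof -
  let ?g = "\<lambda>w. inv_into (carrier V) \<psi> (\<chi> w)"
  note hp = module_homsD[OF \<psi>(1)]
  have hom: "?g \<in> hom_H W V" and g2: "\<And>w. w \<in> carrier W \<Longrightarrow> \<psi> (?g w) = \<chi> w"
    using module_homs_factor[OF \<psi> \<chi>(1) sub objD(2)[OF V(1)]] obj_smult(1)[OF V(1)] objD(3)[OF V(1)] by blast+
  note g = module_homsD(2)[OF hom] g2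
  have "shift_inv (image_sum [(W, \<chi>)])"
    using W(1) \<chi>(1) by (intro image_sum_invariant) auto
  note t = shift_invD[OF this[unfolded image_sum_single]]
  define U where "U = {v \<in> carrier V. \<psi> v \<in> \<chi> ` carrier W}"
  have "left_submodule U V (lact V)"
    unfolding U_def by (rule left_submoduleI[OF V(1)])
      (auto simp only: mem_Collect_eq hp space_of_fields coeff_homs_zero[OF V(1) \<psi>(1)] t
        obj_closed[OF V(1)] obj_smult[OF V(1)] objD[OF V(1)])
  moreover have "U \<noteq> {\<zero>\<^bsub>V\<^esub>}"
  proof
    assume U: "U = {\<zero>\<^bsub>V\<^esub>}"
    obtain w where w: "w \<in> carrier W" "w \<noteq> \<zero>\<^bsub>W\<^esub>" using simple_nonzero[OF W] by blast
    have "?g w \<in> U" using g[OF w(1)] w(1) by (auto simp: U_def)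
    then have "\<chi> w = \<chi> \<zero>\<^bsub>W\<^esub>"
      using U g(2)[OF w(1)] coeff_homs_zero[OF V(1) \<psi>(1)] coeff_homs_zero[OF W(1) \<chi>(1)] by simp
    then show False using inj_onD[OF \<chi>(2)] w obj_closed(1)[OF W(1)] by blast
  qed
  ultimately have "U = carrier V" using V(2) unfolding simple_module_def by blast
  then have "\<psi> ` carrier V = \<chi> ` carrier W" using sub by (auto simp: U_def)
  then have "bij_betw (inv_into (carrier V) \<psi> \<circ> \<chi>) (carrier W) (carrier V)"
    using bij_betw_trans[OF inj_on_imp_bij_betw[OF \<chi>(2)]] bij_betw_inv_into[OF inj_on_imp_bij_betw[OF \<psi>(2)]]
    by metis
  then have "?g \<in> module_isos W (lact W) V (lact V)"
    using hom by (simp add: module_isos_def comp_def)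
  then show ?thesis unfolding isomorphic_def by blast
qed

lemma mcoeff_hom: "V \<in> \<C> \<Longrightarrow> f \<in> star V \<Longrightarrow> (\<lambda>v. mcoeff V v f) \<in> coeff_homs V"
  by (rule module_homsI) (auto simp: mcoeff_def fun_pointwise Hst_act_def fun_scale_def objD star_linear)

text \<open>For fixed \<open>f\<close>, the map from \<open>v\<close> to its coefficient is a
  homomorphism into the functions on \<open>H\<close>; a finite sum of coefficients therefore lies
  in a finite sum of images of \<open>V\<close>.\<close>

lemma Hst_image_sum:
  assumes V: "V \<in> \<C>" and "\<xi> \<in> Hst star V"
  shows "\<exists>L. (\<forall>(W, \<phi>)\<in>set L. W = V \<and> \<phi> \<in> coeff_homs V) \<and> \<xi> \<in> image_sum L"
  using assms(2)
proof (induction rule: Hst_induct[OF V, consumes 1, case_names coeff add])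
  case (coeff v f)
  then show ?case
    using mcoeff_hom[OF V coeff(2)] by (intro exI[of _ "[(V, \<lambda>v. mcoeff V v f)]"]) auto
next
  case (add \<xi> \<eta>)
  then obtain L L' where "\<forall>(W, \<phi>)\<in>set L. W = V \<and> \<phi> \<in> coeff_homs V" "\<xi> \<in> image_sum L"
    "\<forall>(W, \<phi>)\<in>set L'. W = V \<and> \<phi> \<in> coeff_homs V" "\<eta> \<in> image_sum L'" by blast
  then show ?case using image_sum_append by (intro exI[of _ "L @ L'"]) fastforce
qed

text \<open>The cyclic module generated by \<xi> lies in a sum of images of \<open>V\<close>, so it
  contains a copy of \<open>V\<close>. That copy also lies in \<open>image_sum L\<close>, so it
  contains a copy of some \<open>W\<close> from \<open>L\<close>, and two simple modules so nested
  are isomorphic.\<close>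

lemma Hst_disjoint:
  assumes V: "V \<in> \<C>" "simple_hmod V" and \<xi>: "\<xi> \<in> Hst star V" "\<xi> \<noteq> 0" "\<xi> \<in> image_sum L"
    and L: "\<And>W \<phi>. (W, \<phi>) \<in> set L \<Longrightarrow> W \<in> \<C> \<and> simple_hmod W \<and> \<phi> \<in> coeff_homs W"
  shows "\<exists>(W, \<phi>)\<in>set L. isomorphic W V"
proof -
  obtain K where K: "\<forall>(W, \<phi>)\<in>set K. W = V \<and> \<phi> \<in> coeff_homs V" "\<xi> \<in> image_sum K"
    using Hst_image_sum[OF V(1) \<xi>(1)] by blast
  have tK: "shift_inv (image_sum K)" using K(1) V by (intro image_sum_invariant) auto
  have tL: "shift_inv (image_sum L)" using L by (intro image_sum_invariant) auto
  \<comment> \<open>No span has to be taken: as \<xi> is linear on \<open>H\<close>, sums and scalar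
    multiples of translates are again translates.\<close>
  define N where "N = range (\<lambda>h. Hst_act h \<xi> 1)"
  have "\<xi> = Hst_act 1 \<xi> 1" by (simp add: Hst_act_def)
  then have \<xi>N: "\<xi> \<in> N" unfolding N_def by blast
  note lin = Hst_linear[OF V(1) \<xi>(1)]
  have z: "\<xi> 0 = 0" using lin(2)[of 0 0] scale_add[of 0 0 0] by simp
  have N0': "0 = Hst_act 0 \<xi> 1" by (simp add: Hst_act_def fun_pointwise z)
  have N1: "Hst_act h \<xi> 1 + Hst_act h' \<xi> 1 = Hst_act (h + h') \<xi> 1" for h h'
    by (simp add: Hst_act_def fun_pointwise distrib_left lin)
  have N2: "fun_scale c (Hst_act h \<xi> 1) = Hst_act (cm c h) \<xi> 1" for c h
    by (simp add: Hst_act_def fun_pointwise hscale_mult_right lin fun_scale_def)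
  have N3: "Hst_act h' (Hst_act h \<xi> 1) 1 = Hst_act (h' * h) \<xi> 1" for h h'
    by (simp add: Hst_act_def fun_pointwise mult.assoc)
  have tN: "shift_inv N"
    unfolding shift_inv_def fs.subspace_def
  proof (intro conjI ballI allI)
    show "0 \<in> N" unfolding N_def by (subst N0') (rule rangeI)
    fix x assume "x \<in> N"
    then obtain h where x: "x = Hst_act h \<xi> 1" by (auto simp: N_def)
    show "fun_scale c x \<in> N" for c unfolding x N2 N_def by (rule rangeI)
    show "Hst_act g x 1 \<in> N" for g unfolding x N3 N_def by (rule rangeI)
    fix y assume "y \<in> N"
    then obtain h' where y: "y = Hst_act h' \<xi> 1" by (auto simp: N_def)
    show "x + y \<in> N" unfolding x y N1 N_def by (rule rangeI)
  qed
  have N0: "N \<noteq> {0}" using \<xi>N \<xi>(2) by auto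
  have NK: "N \<subseteq> image_sum K" and NL: "N \<subseteq> image_sum L"
    using shift_invD(5)[OF tK K(2)] shift_invD(5)[OF tL \<xi>(3)] by (auto simp: N_def)
  have "\<exists>(W, \<phi>)\<in>set K. \<exists>\<psi>\<in>coeff_homs W. inj_on \<psi> (carrier W) \<and> \<psi> ` carrier W \<subseteq> N"
    by (rule simple_in_image_sum[OF _ tN N0 NK]) (use K(1) V in auto)
  then obtain \<psi> where \<psi>: "\<psi> \<in> coeff_homs V" "inj_on \<psi> (carrier V)" "\<psi> ` carrier V \<subseteq> N" using K(1) by fastforce
  let ?N = "\<psi> ` carrier V"
  have tN': "shift_inv ?N"
    unfolding image_sum_single[symmetric] using V(1) \<psi>(1) by (intro image_sum_invariant) auto
  have "?N \<noteq> {0}"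
  proof
    assume N: "?N = {0}"
    obtain v where v: "v \<in> carrier V" "v \<noteq> \<zero>\<^bsub>V\<^esub>" using simple_nonzero[OF V] by blast
    have "\<psi> v = \<psi> \<zero>\<^bsub>V\<^esub>" using imageI[OF v(1), of \<psi>] N coeff_homs_zero[OF V(1) \<psi>(1)] by simp
    then show False using inj_onD[OF \<psi>(2)] v obj_closed(1)[OF V(1)] by blast
  qed
  then obtain W \<phi> \<chi> where W: "(W, \<phi>) \<in> set L" and \<chi>: "\<chi> \<in> coeff_homs W" "inj_on \<chi> (carrier W)" "\<chi> ` carrier W \<subseteq> ?N"
    using simple_in_image_sum[OF L tN' _ subset_trans[OF \<psi>(3) NL]] by blast
  have "isomorphic W V"
    using isomorphic_of_embeddings[OF V _ _ \<psi>(1,2) \<chi>] L[OF W] by blast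
  then show ?thesis using W by blast
qed

text \<open>If \<open>\<xi> i\<close> were nonzero, the vanishing sum would place it in a sum of
  images of the other \<open>V j\<close>, and \<open>Hst_disjoint\<close> would make one of them
  isomorphic to \<open>V i\<close>.\<close>

lemma Hst_independent:
  assumes J: "finite J" and V: "\<And>j. j \<in> J \<Longrightarrow> V j \<in> \<C> \<and> simple_hmod (V j)"
    and niso: "\<And>i j. i \<in> J \<Longrightarrow> j \<in> J \<Longrightarrow> isomorphic (V i) (V j) \<Longrightarrow> i = j"
    and \<xi>: "\<And>j. j \<in> J \<Longrightarrow> \<xi> j \<in> Hst star (V j)" and sum: "sum \<xi> J = 0" and i: "i \<in> J"
  shows "\<xi> i = 0"
proof (rule ccontr)
  assume ne: "\<xi> i \<noteq> 0"
  have "\<exists>L. (\<forall>(W, \<phi>)\<in>set L. (\<exists>j\<in>K. W = V j) \<and> \<phi> \<in> coeff_homs W) \<and> sum \<xi> K \<in> image_sum L"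
    if "finite K" "K \<subseteq> J" for K
    using that
  proof (induction K)
    case empty
    show ?case by (intro exI[of _ "[]"]) simp
  next
    case (insert j K)
    then obtain L where L: "\<forall>(W, \<phi>)\<in>set L. (\<exists>j\<in>K. W = V j) \<and> \<phi> \<in> coeff_homs W" "sum \<xi> K \<in> image_sum L"
      by blast
    obtain L' where L': "\<forall>(W, \<phi>)\<in>set L'. W = V j \<and> \<phi> \<in> coeff_homs (V j)" "\<xi> j \<in> image_sum L'"
      using Hst_image_sum[of "V j" "\<xi> j"] V \<xi> insert.prems by blast
    have "sum \<xi> (insert j K) \<in> image_sum (L' @ L)"
      unfolding sum.insert[OF insert.hyps(1,2)] by (rule image_sum_append[OF L'(2) L(2)])
    then show ?case using L(1) L'(1) by (intro exI[of _ "L' @ L"]) auto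
  qed
  from this[of "J - {i}"] J obtain L where
    L: "\<And>W \<phi>. (W, \<phi>) \<in> set L \<Longrightarrow> (\<exists>j\<in>J - {i}. W = V j) \<and> \<phi> \<in> coeff_homs W" "sum \<xi> (J - {i}) \<in> image_sum L"
    by fastforce
  have L': "(W, \<phi>) \<in> set L \<Longrightarrow> W \<in> \<C> \<and> simple_hmod W \<and> \<phi> \<in> coeff_homs W" for W \<phi>
    using L(1)[of W \<phi>] V by auto
  have "shift_inv (image_sum L)" using L' by (intro image_sum_invariant) auto
  then have "fun_scale (-1) (sum \<xi> (J - {i})) \<in> image_sum L" using L(2) shift_invD(4) by blast
  moreover have "fun_scale (-1) (sum \<xi> (J - {i})) = \<xi> i"
    using sum sum.remove[OF J i, of \<xi>] by (simp add: eq_neg_iff_add_eq_0 neg_eq_iff_add_eq_0 add.commute)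
  ultimately have "\<xi> i \<in> image_sum L" by simp
  then obtain W \<phi> where "(W, \<phi>) \<in> set L" "isomorphic W (V i)"
    using Hst_disjoint[of "V i" "\<xi> i" L] V[OF i] \<xi>[OF i] ne L' by blast
  then show False using L(1) niso i by blast
qed

end

section \<open>Semisimple categories\<close>

lemma module_space_of:
  assumes "vector_space s"
  shows "Module.module ground_ring (space_of s)"
proof -
  interpret vector_space s by fact
  have "cring (ground_ring :: 'a ring)"
    by (intro cringI abelian_groupI comm_monoidI)
      (auto simp: ground_ring_def algebra_simps intro: exI[of _ "- _"])
  then show ?thesis
    by (intro moduleI abelian_space_of)
      (auto simp: ground_ring_def scale_left_distrib scale_right_distrib)
qed

lemma submodule_space_of:
  fixes s :: "'k::field \<Rightarrow> 'b::ab_group_add \<Rightarrow> 'b"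
  assumes "vector_space s" "0 \<in> U" "\<And>x y. x \<in> U \<Longrightarrow> y \<in> U \<Longrightarrow> x + y \<in> U" "\<And>c x. x \<in> U \<Longrightarrow> s c x \<in> U"
  shows "submodule U ground_ring (space_of s)"
proof -
  have m: "Module.module ground_ring (space_of s)" by (rule module_space_of[OF assms(1)])
  then interpret module ground_ring "space_of s" .
  have "\<ominus>\<^bsub>space_of s\<^esub> x \<in> U" if "x \<in> U" for x
    using module_smult(8)[OF m, of x] assms(4)[OF that, of "-1"] by simp
  then show ?thesis by (intro submoduleI) (use assms in auto)
qed

lemma finprod_space_of: "finite J \<Longrightarrow> finprod (add_monoid (space_of s)) f J = sum f J"
proof (induction J rule: finite_induct)
  case empty
  interpret abelian_group "space_of s" by (rule abelian_space_of)
  show ?case using finsum_empty[of f] by (simp add: finsum_def)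
next
  case (insert j J)
  interpret abelian_group "space_of s" by (rule abelian_space_of)
  show ?case using insert finsum_insert[of J j f] by (simp add: finsum_def)
qed

text \<open>The family is given on all of \<open>I\<close> and vanishes off \<open>J\<close>, the
  shape of the finitely supported families in \<open>sum_group\<close>.\<close>

lemma span_Union_sum:
  fixes S :: "'i \<Rightarrow> ('b \<Rightarrow> 'k::field) set"
  assumes S: "\<And>i. i \<in> I \<Longrightarrow> fs.subspace (S i)" and x: "x \<in> fs.span (\<Union>i\<in>I. S i)"
  shows "\<exists>J \<xi>. finite J \<and> J \<subseteq> I \<and> (\<forall>j\<in>I. \<xi> j \<in> S j) \<and> (\<forall>j\<in>I - J. \<xi> j = 0) \<and> x = sum \<xi> J"
  using x
proof (induction rule: fs.span_induct_alt)
  case base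
  show ?case using S fs.subspace_0 by (intro exI[of _ "{}"] exI[of _ "\<lambda>_. 0"]) auto
next
  case (step c y z)
  then obtain J \<xi> i where J: "finite J" "J \<subseteq> I" "\<forall>j\<in>I. \<xi> j \<in> S j" "\<forall>j\<in>I - J. \<xi> j = 0" "z = sum \<xi> J"
    and i: "i \<in> I" "y \<in> S i" by blast
  define \<eta> where "\<eta> = \<xi>(i := fun_scale c y + \<xi> i)"
  have "\<eta> j \<in> S j" if "j \<in> I" for j
    using that J(3) i fs.subspace_add[OF S] fs.subspace_scale[OF S] by (simp add: \<eta>_def)
  moreover have "\<eta> j = 0" if "j \<in> I - insert i J" for j using that J(4) by (simp add: \<eta>_def)
  moreover have "fun_scale c y + z = sum \<eta> (insert i J)"
  proof -
    have "sum \<eta> (insert i J) = \<eta> i + sum \<eta> (insert i J - {i})"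
      using sum.remove[of "insert i J" i \<eta>] J(1) by simp
    also have "sum \<eta> (insert i J - {i}) = sum \<xi> (insert i J - {i})"
      by (rule sum.cong) (auto simp: \<eta>_def)
    also have "\<eta> i + sum \<xi> (insert i J - {i}) = fun_scale c y + (\<xi> i + sum \<xi> (insert i J - {i}))"
      by (simp add: \<eta>_def add.assoc)
    also have "\<xi> i + sum \<xi> (insert i J - {i}) = sum \<xi> (insert i J)"
      using sum.remove[of "insert i J" i \<xi>] J(1) by simp
    also have "\<dots> = sum \<xi> J"
      by (rule sum.mono_neutral_right) (use J i in auto)
    finally show ?thesis using J(5) by simp
  qed
  ultimately show ?case
    using J(1,2) i(1) by (intro exI[of _ "insert i J"] exI[of _ \<eta>]) auto
qed

section \<open>Representatives of simple classes and the span of their coefficients\<close>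

context duality_category
begin

lemma left_submoduleD:
  assumes V: "V \<in> \<C>" and U: "left_submodule U V (lact V)"
  shows "U \<subseteq> carrier V" "\<zero>\<^bsub>V\<^esub> \<in> U" "u \<in> U \<Longrightarrow> w \<in> U \<Longrightarrow> u \<oplus>\<^bsub>V\<^esub> w \<in> U"
    "u \<in> U \<Longrightarrow> c \<odot>\<^bsub>V\<^esub> u \<in> U" "u \<in> U \<Longrightarrow> lact V h u \<in> U"
proof -
  have s: "submodule U ground_ring V" using U by (simp add: left_submodule_def)
  then have g: "subgroup U (add_monoid V)" by (simp add: submodule_def)
  show "U \<subseteq> carrier V" "\<zero>\<^bsub>V\<^esub> \<in> U" "u \<in> U \<Longrightarrow> w \<in> U \<Longrightarrow> u \<oplus>\<^bsub>V\<^esub> w \<in> U"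
    using subgroup.subset[OF g] subgroup.one_closed[OF g] subgroup.m_closed[OF g] by auto
  show "u \<in> U \<Longrightarrow> c \<odot>\<^bsub>V\<^esub> u \<in> U" using submodule.smult_closed[OF s, of c u] by (simp add: ground_ring_def)
  show "u \<in> U \<Longrightarrow> lact V h u \<in> U" using U by (simp add: left_submodule_def)
qed

lemma simple_iso:
  assumes V: "V \<in> \<C>" and W: "W \<in> \<C>" and iso: "isomorphic V W" and simple: "simple_hmod V"
  shows "simple_hmod W"
proof -
  obtain \<phi> where \<phi>: "\<phi> \<in> hom_H V W" "bij_betw \<phi> (carrier V) (carrier W)"
    using iso by (auto simp: isomorphic_def module_isos_def)
  note h = module_homsD[OF \<phi>(1)]
  have z: "\<phi> \<zero>\<^bsub>V\<^esub> = \<zero>\<^bsub>W\<^esub>" using linear_maps_zero[OF objD(2)[OF V] objD(2)[OF W] h(1)] .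
  have surj: "\<phi> ` carrier V = carrier W" and inj: "inj_on \<phi> (carrier V)" using \<phi>(2) by (auto simp: bij_betw_def)
  obtain v where v: "v \<in> carrier V" "v \<noteq> \<zero>\<^bsub>V\<^esub>" using simple_nonzero[OF V simple] by blast
  then have "\<phi> v \<noteq> \<zero>\<^bsub>W\<^esub>" using inj_onD[OF inj] z obj_closed(1)[OF V] by metis
  then have "carrier W \<noteq> {\<zero>\<^bsub>W\<^esub>}" using h(2)[OF v(1)] by auto
  moreover have "U = {\<zero>\<^bsub>W\<^esub>} \<or> U = carrier W" if U: "left_submodule U W (lact W)" for U
  proof -
    note u = left_submoduleD[OF W U]
    define U' where "U' = {v \<in> carrier V. \<phi> v \<in> U}"
    have "left_submodule U' V (lact V)"
      unfolding U'_def by (rule left_submoduleI[OF V])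
        (auto simp: h z u obj_closed[OF V] obj_smult[OF V] objD[OF V])
    then have "U' = {\<zero>\<^bsub>V\<^esub>} \<or> U' = carrier V" using simple unfolding simple_module_def by blast
    moreover have "U = \<phi> ` U'"
    proof -
      have "U \<subseteq> \<phi> ` carrier V" using u(1) surj by simp
      then show ?thesis unfolding U'_def by blast
    qed
    ultimately show ?thesis using z surj by auto
  qed
  ultimately show ?thesis by (simp add: simple_module_def)
qed

lemma class_rep_iso_class:
  assumes V: "V \<in> \<C>"
  shows "class_rep (iso_class \<C> V) \<in> \<C>" "isomorphic V (class_rep (iso_class \<C> V))"
proof -
  have "V \<in> iso_class \<C> V" using V isomorphic_refl by (auto simp: iso_class_def)
  then have "class_rep (iso_class \<C> V) \<in> iso_class \<C> V" unfolding class_rep_def by (rule someI)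
  then show "class_rep (iso_class \<C> V) \<in> \<C>" "isomorphic V (class_rep (iso_class \<C> V))"
    by (auto simp: iso_class_def)
qed

lemma iso_class_eq:
  assumes V: "V \<in> \<C>" and W: "W \<in> \<C>" and iso: "isomorphic V W"
  shows "iso_class \<C> V = iso_class \<C> W"
  using isomorphic_trans[OF iso] isomorphic_trans[OF isomorphic_sym[OF object[OF V] iso]]
  by (auto simp: iso_class_def)

lemma simple_classD:
  assumes "c \<in> simple_classes"
  shows "class_rep c \<in> \<C>" "simple_hmod (class_rep c)" "c = iso_class \<C> (class_rep c)"
proof -
  obtain V where V: "V \<in> \<C>" "simple_hmod V" "c = iso_class \<C> V" using assms by (auto simp: simple_iso_classes_def)
  note r = class_rep_iso_class[OF V(1), folded V(3)]
  show "class_rep c \<in> \<C>" by (rule r)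
  show "simple_hmod (class_rep c)" by (rule simple_iso[OF V(1) r V(2)])
  show "c = iso_class \<C> (class_rep c)" using iso_class_eq[OF V(1) r] V(3) by simp
qed

lemma simple_class_eqI:
  assumes "c \<in> simple_classes" "d \<in> simple_classes" "isomorphic (class_rep c) (class_rep d)"
  shows "c = d"
  using iso_class_eq[OF simple_classD(1)[OF assms(1)] simple_classD(1)[OF assms(2)] assms(3)]
    simple_classD(3)[OF assms(1)] simple_classD(3)[OF assms(2)] by simp

abbreviation "simple_span \<equiv> fs.span (\<Union>c\<in>simple_classes. Hst star (class_rep c))"

lemma Hst_simple_span:
  assumes V: "V \<in> \<C>" and simple: "simple_hmod V"
  shows "Hst star V \<subseteq> simple_span"
proof -
  let ?c = "iso_class \<C> V"
  have c: "?c \<in> simple_classes" using assms by (auto simp: simple_iso_classes_def)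
  have "Hst star V = Hst star (class_rep ?c)"
    by (rule Hst_iso[OF V class_rep_iso_class[OF V]])
  then show ?thesis using c by (auto intro: fs.span_base)
qed

text \<open>A coefficient of a vector \<open>u\<close> in a simple summand \<open>U\<close> is a
  coefficient of \<open>U\<close> itself, with the functional restricted along the inclusion;
  \<open>star_functorial\<close> keeps the restriction in \<open>star\<close>. Sums of such vectors
  exhaust \<open>V\<close>.\<close>

lemma Hst_semisimple_span:
  assumes V: "V \<in> \<C>" and ss: "semisimple_module V (lact V)"
  shows "Hst star V \<subseteq> simple_span"
proof -
  obtain \<S> where S: "\<And>U. U \<in> \<S> \<Longrightarrow> left_submodule U V (lact V) \<and> simple_module (V\<lparr>carrier := U\<rparr>) (lact V)"
    and sum: "is_internal_direct_sum V \<S> (\<lambda>U. U) (carrier V)"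
    using ss unfolding semisimple_module_def by blast
  \<comment> \<open>Vectors all of whose coefficients are good: closed under addition, so containing
    every simple summand forces it to be \<open>V\<close>.\<close>
  define K where "K = {v \<in> carrier V. \<forall>f\<in>star V. mcoeff V v f \<in> simple_span}"
  interpret abelian_group V by (rule objD(2)[OF V])
  have SK: "U \<subseteq> K" if "U \<in> \<S>" for U
  proof
    fix u assume u: "u \<in> U"
    let ?U = "V\<lparr>carrier := U\<rparr>"
    note sub = S[OF that, THEN conjunct1]
    have UC: "?U \<in> \<C>" by (rule closed_submodule[OF V sub])
    have simple: "simple_hmod ?U" using S[OF that] by simp
    note d = left_submoduleD[OF V sub]
    have incl: "(\<lambda>x. x) \<in> hom_H ?U V" by (rule module_homsI) (use d in auto)
    have "mcoeff V u f \<in> simple_span" if f: "f \<in> star V" for f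
    proof -
      have "mcoeff V u f = mcoeff ?U u (transpose_map ?U (\<lambda>x. x) f)"
        using d(5)[OF u] by (simp add: mcoeff_def transpose_map_def)
      also have "\<dots> \<in> Hst star ?U"
        by (rule mcoeff_Hst[OF UC _ star_functorial[OF UC V incl f]]) (use u in simp)
      also have "\<dots> \<subseteq> simple_span" by (rule Hst_simple_span[OF UC simple])
      finally show ?thesis .
    qed
    then show "u \<in> K" using d(1) u by (auto simp: K_def)
  qed
  have K0: "\<zero>\<^bsub>V\<^esub> \<in> K"
  proof -
    have "mcoeff V \<zero>\<^bsub>V\<^esub> f = 0" if "f \<in> star V" for f
      using coeff_homs_zero[OF V mcoeff_hom[OF V that]] .
    then show ?thesis by (simp add: K_def fs.span_zero)
  qed
  have Kadd: "v \<oplus>\<^bsub>V\<^esub> w \<in> K" if "v \<in> K" "w \<in> K" for v w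
  proof -
    have "mcoeff V (v \<oplus>\<^bsub>V\<^esub> w) f = mcoeff V v f + mcoeff V w f" if "f \<in> star V" for f
      using module_homsD(3)[OF mcoeff_hom[OF V that], of v w] \<open>v \<in> K\<close> \<open>w \<in> K\<close> by (simp add: K_def)
    then show ?thesis using that by (simp add: K_def fs.span_add)
  qed
  have fin: "finprod (add_monoid V) u J \<in> K" if "finite J" "\<And>j. j \<in> J \<Longrightarrow> u j \<in> K" for u and J :: "'v set set"
    using that
  proof (induction J rule: finite_induct)
    case empty
    then show ?case using K0 finsum_empty[of u] by (simp add: finsum_def)
  next
    case (insert j J)
    have "u \<in> J \<rightarrow> carrier V" "u j \<in> carrier V" using insert.prems by (auto simp: K_def)
    then have "finprod (add_monoid V) u (insert j J) = u j \<oplus>\<^bsub>V\<^esub> finprod (add_monoid V) u J"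
      using finsum_insert[OF insert.hyps, of u] by (simp add: finsum_def)
    then show ?case using Kadd insert by simp
  qed
  have grp: "group (add_monoid (V\<lparr>carrier := U\<rparr>))" if "U \<in> \<S>" for U
    using abelian_group.a_group[OF objD(2)[OF closed_submodule[OF V]]] S[OF that] by blast
  have "carrier V \<subseteq> K"
  proof
    fix v assume "v \<in> carrier V"
    moreover have "(\<lambda>u. gfinprod (add_monoid V) u \<S>) ` carrier (sum_group \<S> (\<lambda>U. add_monoid (V\<lparr>carrier := U\<rparr>)))
        = carrier V"
      using sum by (auto simp: is_internal_direct_sum_def iso_def bij_betw_def)
    ultimately obtain u where u: "u \<in> carrier (sum_group \<S> (\<lambda>U. add_monoid (V\<lparr>carrier := U\<rparr>)))"
      "v = gfinprod (add_monoid V) u \<S>" by blast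
    have "u U \<in> U" if "U \<in> \<S>" for U
      using u(1) that by (subst (asm) carrier_sum_group[OF grp]) (auto simp: PiE_iff)
    then have "u U \<in> K" if "U \<in> \<S>" for U using SK that by blast
    then show "v \<in> K" unfolding u(2) gfinprod_def using K0 by (auto intro!: fin)
  qed
  then have c: "mcoeff V v f \<in> simple_span" if "v \<in> carrier V" "f \<in> star V" for v f
    using that by (auto simp: K_def)
  show ?thesis
  proof
    fix \<xi> assume "\<xi> \<in> Hst star V"
    then show "\<xi> \<in> simple_span"
      by (induction rule: Hst_induct[OF V, consumes 1, case_names coeff add]) (auto intro: c fs.span_add)
  qed
qed

end

section \<open>Part (b): transporting the decomposition along \<open>\<Phi>\<close>\<close>

context tensor_completion
begin

lemma \<Phi>_add: "f \<in> HstAll \<Longrightarrow> g \<in> HstAll \<Longrightarrow> \<Phi> T P (f + g) = \<Phi> T P f + \<Phi> T P g"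
  by (simp add: \<Phi>_def slice_add)

lemma \<Phi>_zero: "\<Phi> T P 0 = 0"
  using \<Phi>_add[OF HstC_zero HstC_zero, of P] by simp

lemma \<Phi>_scale: "f \<in> HstAll \<Longrightarrow> \<Phi> T P (fun_scale c f) = cm c (\<Phi> T P f)"
  by (simp add: \<Phi>_def slice_scale)

lemma \<Phi>_sum: "(\<And>j. j \<in> J \<Longrightarrow> f j \<in> HstAll) \<Longrightarrow> sum f J \<in> HstAll \<and> \<Phi> T P (sum f J) = (\<Sum>j\<in>J. \<Phi> T P (f j))"
  by (induction J rule: infinite_finite_induct) (auto simp: \<Phi>_zero HstC_zero \<Phi>_add HstC_closed)

text \<open>Semisimplicity makes the coefficient spaces of the representatives span
  \<open>HstAll\<close>. Their independence passes to \<open>H\<close> because \<open>\<Phi>\<close>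
  is injective on the whole of \<open>HstAll\<close>, not just on each summand.\<close>

lemma semisimple_direct_sum:
  assumes ss: "semisimple_category \<C>" and inj: "inj_on (\<Phi> T P) (HstAll)"
  shows "is_internal_direct_sum (hspace H) (simple_classes)
          (\<lambda>c. carrier (HVP H star T P (class_rep c))) (\<Phi> T P ` HstAll)"
proof -
  let ?I = "simple_classes"
  let ?U = "\<lambda>c. carrier (HVP H star T P (class_rep c))"
  let ?X = "\<Phi> T P ` HstAll"
  let ?G = "add_monoid (hspace H)"
  let ?A = "\<lambda>c. add_monoid ((hspace H)\<lparr>carrier := ?U c\<rparr>)"
  have U: "?U c = \<Phi> T P ` Hst star (class_rep c)" for c by (simp add: HVP_def)
  have HC: "\<xi> \<in> HstAll" if "c \<in> ?I" "\<xi> \<in> Hst star (class_rep c)" for c \<xi>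
    using that Hst_HstC[OF simple_classD(1)] by blast
  have sub: "submodule (?U c) ground_ring (hspace H)" if c: "c \<in> ?I" for c
  proof (rule submodule_space_of[OF hscale_space])
    note r = simple_classD(1)[OF c]
    show "0 \<in> ?U c" unfolding U using imageI[OF Hst_zero[OF r], of "\<Phi> T P"] by (simp only: \<Phi>_zero)
    fix x y assume "x \<in> ?U c" "y \<in> ?U c"
    then obtain \<xi> \<eta> where x: "x = \<Phi> T P \<xi>" "\<xi> \<in> Hst star (class_rep c)"
      and y: "y = \<Phi> T P \<eta>" "\<eta> \<in> Hst star (class_rep c)" unfolding U by blast
    show "x + y \<in> ?U c" unfolding U x(1) y(1) \<Phi>_add[OF HC[OF c x(2)] HC[OF c y(2)], symmetric]
      by (rule imageI) (rule Hst_add[OF r x(2) y(2)])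
  next
    note r = simple_classD(1)[OF c]
    fix k x assume "x \<in> ?U c"
    then obtain \<xi> where x: "x = \<Phi> T P \<xi>" "\<xi> \<in> Hst star (class_rep c)" unfolding U by blast
    show "cm k x \<in> ?U c" unfolding U x(1) \<Phi>_scale[OF HC[OF c x(2)], symmetric]
      by (rule imageI) (rule Hst_scale[OF r x(2)])
  qed
  have Gc: "comm_group ?G" by (rule abelian_group.a_comm_group[OF hspace_abelian])
  have grp: "group (?A c)" if "c \<in> ?I" for c
    using group.subgroup_imp_group[OF abelian_group.a_group[OF hspace_abelian] submodule.axioms(1)[OF sub[OF that]]] by simp
  have cs: "u \<in> carrier (sum_group ?I ?A) \<longleftrightarrow> u \<in> extensional ?I \<and> (\<forall>c\<in>?I. u c \<in> ?U c) \<and> finite {c \<in> ?I. u c \<noteq> 0}" for u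
    by (subst carrier_sum_group[OF grp]) (auto simp: PiE_iff)
  let ?s = "\<lambda>u. gfinprod ?G u ?I"
  have hom: "?s \<in> hom (sum_group ?I ?A) ?G"
    using comm_group.hom_group_sum[OF Gc, of ?I "\<lambda>_ x. x" ?A] grp by (auto simp: hom_def)
  \<comment> \<open>\<open>gfinprod\<close> runs over the support of \<open>u\<close> only; any
    finite set containing the support gives the same value as an ordinary sum.\<close>
  have s_eval: "?s u = sum u J" if "finite J" "J \<subseteq> ?I" "\<And>c. c \<in> ?I - J \<Longrightarrow> u c = 0" for u J
  proof -
    have sub: "{c \<in> ?I. u c \<noteq> 0} \<subseteq> J" using that(3) by blast
    then have "?s u = sum u {c \<in> ?I. u c \<noteq> 0}"
      using finite_subset[OF sub that(1)] by (simp add: gfinprod_def finprod_space_of[simplified])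
    also have "\<dots> = sum u J" by (rule sum.mono_neutral_left) (use that sub in auto)
    finally show ?thesis .
  qed
  \<comment> \<open>Each component of \<open>u\<close> is lifted to a functional, so that the sum in
    \<open>H\<close> becomes the value of \<open>\<Phi>\<close> at one functional.\<close>
  have val: "\<exists>J \<xi>. finite J \<and> J \<subseteq> ?I \<and> (\<forall>c\<in>?I. \<xi> c \<in> Hst star (class_rep c) \<and> u c = \<Phi> T P (\<xi> c)) \<and>
       (\<forall>c\<in>?I - J. u c = 0) \<and> ?s u = \<Phi> T P (sum \<xi> J) \<and> sum \<xi> J \<in> HstAll"
    if "u \<in> carrier (sum_group ?I ?A)" for u
  proof -
    have u: "\<forall>c\<in>?I. u c \<in> ?U c" "finite {c \<in> ?I. u c \<noteq> 0}"
      using that unfolding cs by auto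
    then obtain \<xi> where \<xi>: "\<forall>c\<in>?I. \<xi> c \<in> Hst star (class_rep c) \<and> u c = \<Phi> T P (\<xi> c)"
      unfolding U image_iff by metis
    let ?J = "{c \<in> ?I. u c \<noteq> 0}"
    have s: "?s u = sum u ?J" by (rule s_eval) (use u(2) in auto)
    have "sum u ?J = (\<Sum>c\<in>?J. \<Phi> T P (\<xi> c))" by (rule sum.cong) (use \<xi> in auto)
    moreover have "sum \<xi> ?J \<in> HstAll \<and> \<Phi> T P (sum \<xi> ?J) = (\<Sum>c\<in>?J. \<Phi> T P (\<xi> c))"
      by (rule \<Phi>_sum) (use \<xi> HC in blast)
    ultimately have "?s u = \<Phi> T P (sum \<xi> ?J)" "sum \<xi> ?J \<in> HstAll"
      using s by simp_all
    then show ?thesis using u(2) \<xi> by (intro exI[of _ ?J] exI[of _ \<xi>]) auto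
  qed
  interpret gh: group_hom "sum_group ?I ?A" ?G ?s
    using hom sum_group[OF grp] abelian_group.a_group[OF hspace_abelian] by (simp add: group_hom_def group_hom_axioms_def)
  have ker: "u = \<one>\<^bsub>sum_group ?I ?A\<^esub>" if u: "u \<in> carrier (sum_group ?I ?A)" and su: "?s u = 0" for u
  proof -
    obtain J \<xi> where J: "finite J" "J \<subseteq> ?I" "\<forall>c\<in>?I. \<xi> c \<in> Hst star (class_rep c) \<and> u c = \<Phi> T P (\<xi> c)"
      "\<forall>c\<in>?I - J. u c = 0" "?s u = \<Phi> T P (sum \<xi> J)" "sum \<xi> J \<in> HstAll" using val[OF u] by blast
    \<comment> \<open>Injectivity of \<open>\<Phi>\<close> returns the vanishing sum to the
      functions on \<open>H\<close>, where independence is known.\<close>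
    have "sum \<xi> J = 0" using inj_onD[OF inj _ J(6) HstC_zero] J(5) su \<Phi>_zero by simp
    then have "\<xi> c = 0" if "c \<in> J" for c
      by (rule Hst_independent[OF J(1), where V = class_rep, rotated 3])
        (use that J simple_classD simple_class_eqI in blast)+
    then have "u c = 0" if "c \<in> ?I" for c using that J(3,4) \<Phi>_zero by (cases "c \<in> J") auto
    then show ?thesis
      using u unfolding cs by (auto simp: extensional_def fun_eq_iff)
  qed
  have inj_s: "inj_on ?s (carrier (sum_group ?I ?A))"
    using gh.inj_on_one_iff ker by simp
  have span: "HstAll \<subseteq> simple_span"
    unfolding HstC_def
    by (rule fs.span_minimal) (use Hst_semisimple_span ss in \<open>auto simp: semisimple_category_def fs.subspace_span\<close>)
  have img: "?s ` carrier (sum_group ?I ?A) = ?X"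
  proof
    show "?s ` carrier (sum_group ?I ?A) \<subseteq> ?X" using val by blast
    show "?X \<subseteq> ?s ` carrier (sum_group ?I ?A)"
    proof
      fix x assume "x \<in> ?X"
      then obtain \<zeta> where \<zeta>: "\<zeta> \<in> simple_span" "x = \<Phi> T P \<zeta>" using span by blast
      obtain J \<xi> where J: "finite J" "J \<subseteq> ?I" "\<forall>c\<in>?I. \<xi> c \<in> Hst star (class_rep c)" "\<forall>c\<in>?I - J. \<xi> c = 0" "\<zeta> = sum \<xi> J"
        using span_Union_sum[OF Hst_subspace[OF simple_classD(1)] \<zeta>(1)] by blast
      define u where "u = (\<lambda>c\<in>?I. \<Phi> T P (\<xi> c))"
      have nz: "{c \<in> ?I. u c \<noteq> 0} \<subseteq> J" using J(4) \<Phi>_zero unfolding u_def by (auto, metis DiffI)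
      have "u \<in> carrier (sum_group ?I ?A)"
        unfolding cs using J(3) finite_subset[OF nz J(1)] by (auto simp: u_def U)
      moreover have "?s u = x"
      proof -
        have "?s u = sum u J" by (rule s_eval) (use J nz in auto)
        also have "\<dots> = (\<Sum>c\<in>J. \<Phi> T P (\<xi> c))" by (rule sum.cong) (use J(2) in \<open>auto simp: u_def\<close>)
        also have "\<dots> = \<Phi> T P (sum \<xi> J)"
          using \<Phi>_sum[of J \<xi> P] J(2,3) HC by (metis subsetD)
        also have "\<dots> = x" using J(5) \<zeta>(2) by simp
        finally show ?thesis .
      qed
      ultimately show "x \<in> ?s ` carrier (sum_group ?I ?A)" by blast
    qed
  qed
  have "?s \<in> iso (sum_group ?I ?A) (add_monoid ((hspace H)\<lparr>carrier := ?X\<rparr>))"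
    using hom inj_s img by (auto simp: iso_def bij_betw_def hom_def)
  then show ?thesis using sub by (simp add: is_internal_direct_sum_def)
qed

end

section \<open>Finite dimensional spaces and traces\<close>

locale kspace = Module.module "ground_ring :: 'k ring" V for V :: "('k::field, 'v, 'z) module_scheme" (structure)
begin

lemmas sm = module_smult[OF module_axioms]

text \<open>Indexed by \<open>I\<close>, in contrast to \<open>lin_comb\<close>, which is indexed by
  the vectors themselves: images of a spanning family under a quotient map may coincide.\<close>

definition lc :: "('i \<Rightarrow> 'v) \<Rightarrow> 'i set \<Rightarrow> ('i \<Rightarrow> 'k) \<Rightarrow> 'v" where
  "lc v I c = finsum V (\<lambda>i. c i \<odot> v i) I"

definition spanning :: "'v set \<Rightarrow> 'i set \<Rightarrow> ('i \<Rightarrow> 'v) \<Rightarrow> bool" where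
  "spanning U I v \<longleftrightarrow> finite I \<and> v ` I \<subseteq> U \<and> (\<forall>x\<in>U. \<exists>c. x = lc v I c)"

lemma lc_cong: "(\<And>i. i \<in> I \<Longrightarrow> c i \<odot> v i = d i \<odot> w i) \<Longrightarrow> (\<And>i. i \<in> I \<Longrightarrow> w i \<in> carrier V) \<Longrightarrow> lc v I c = lc w I d"
  unfolding lc_def by (rule finsum_cong') (auto simp: sm)

lemma lc_closed: "v ` I \<subseteq> carrier V \<Longrightarrow> lc v I c \<in> carrier V"
  unfolding lc_def by (rule finsum_closed) (auto simp: sm)

lemma lc_empty: "lc v {} c = \<zero>"
  by (simp add: lc_def)

lemma lc_insert: "finite I \<Longrightarrow> i \<notin> I \<Longrightarrow> v ` insert i I \<subseteq> carrier V \<Longrightarrow> lc v (insert i I) c = c i \<odot> v i \<oplus> lc v I c"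
  unfolding lc_def by (subst finsum_insert) (auto simp: sm)

lemma lc_add: "v ` I \<subseteq> carrier V \<Longrightarrow> lc v I (\<lambda>i. c i + d i) = lc v I c \<oplus> lc v I d"
  unfolding lc_def by (subst finsum_addf[symmetric]) (auto simp: sm intro!: finsum_cong')

lemma lc_scale: "finite I \<Longrightarrow> v ` I \<subseteq> carrier V \<Longrightarrow> lc v I (\<lambda>i. k * c i) = k \<odot> lc v I c"
proof (induction I rule: finite_induct)
  case empty
  then show ?case by (simp add: lc_empty sm)
next
  case (insert i I)
  then show ?case using lc_closed[of v I c] by (simp add: lc_insert sm)
qed

lemma lc_remove:
  assumes "finite I" "j \<in> I" "v ` I \<subseteq> carrier V"
  shows "lc v I c = c j \<odot> v j \<oplus> lc v (I - {j}) c"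
  using lc_insert[of "I - {j}" j v c] assms by (simp add: insert_absorb)

lemma lc_delta:
  assumes "finite I" "j \<in> I" "v ` I \<subseteq> carrier V"
  shows "lc v I (\<lambda>i. if i = j then 1 else 0) = v j"
proof -
  \<comment> \<open>The zero coefficient is written as \<open>0 * 0\<close> so that
    \<open>lc_scale\<close> can extract the scalar 0.\<close>
  have "lc v (I - {j}) (\<lambda>i. if i = j then 1 else 0) = lc v (I - {j}) (\<lambda>i. 0 * 0)"
    by (rule lc_cong) (use assms in \<open>auto simp: sm\<close>)
  also have "\<dots> = 0 \<odot> lc v (I - {j}) (\<lambda>i. 0)" by (rule lc_scale) (use assms in auto)
  also have "\<dots> = \<zero>" by (rule sm(6), rule lc_closed) (use assms in auto)
  finally show ?thesis using lc_remove[OF assms, of "\<lambda>i. if i = j then 1 else 0"] assms by (auto simp: sm)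
qed

lemma linear_lc:
  assumes N: "Module.module ground_ring N" and \<phi>: "\<phi> \<in> linear_maps V N" and v: "finite I" "v ` I \<subseteq> carrier V"
  shows "\<phi> (lc v I c) = kspace.lc N (\<lambda>i. \<phi> (v i)) I c"
proof -
  interpret N: kspace N using N by (simp add: kspace_def)
  show ?thesis using v
  proof (induction I rule: finite_induct)
    case empty
    show ?case unfolding lc_empty N.lc_empty
      by (rule linear_maps_zero[OF M.abelian_group_axioms N.M.abelian_group_axioms \<phi>])
  next
    case (insert i I)
    then show ?case
      using linear_mapsD[OF \<phi>] by (subst lc_insert) (auto simp: lc_closed N.lc_insert image_subset_iff sm)
  qed
qed

lemma functional_lc:
  assumes f: "f \<in> linear_maps V ground_space" and v: "finite I" "v ` I \<subseteq> carrier V"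
  shows "f (lc v I c) = (\<Sum>i\<in>I. c i * f (v i))"
  using v
proof (induction I rule: finite_induct)
  case empty
  then show ?case using linear_maps_zero[OF M.abelian_group_axioms abelian_space_of f] by (simp add: lc_empty)
next
  case (insert i I)
  then show ?case using linear_mapsD[OF f] by (simp add: lc_insert lc_closed sm)
qed

lemma spanning_drop:
  assumes s: "spanning U I v" and U: "U \<subseteq> carrier V" and e: "lc v I e = \<zero>" "j \<in> I" "e j \<noteq> 0"
  shows "spanning U (I - {j}) v"
proof -
  have I: "finite I" "v ` I \<subseteq> carrier V" using s U by (auto simp: spanning_def)
  have "\<exists>c. x = lc v (I - {j}) c" if x: "x \<in> U" for x
  proof -
    obtain a where a: "x = lc v I a" using s x by (auto simp: spanning_def)
    \<comment> \<open>The multiple of the relation is chosen to cancel the coefficient at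
      \<open>j\<close>; adding a relation does not change the vector.\<close>
    let ?c = "\<lambda>i. a i + (- a j / e j) * e i"
    have "lc v I ?c = x \<oplus> (- a j / e j) \<odot> \<zero>"
      unfolding lc_add[OF I(2)] lc_scale[OF I] a e ..
    then have "x = lc v I ?c" using x U by (auto simp: sm)
    also have "\<dots> = lc v (I - {j}) ?c"
    proof -
      have I': "v ` (I - {j}) \<subseteq> carrier V" "v j \<in> carrier V" using I e(2) by auto
      have "?c j = 0" using e by simp
      then show ?thesis using lc_remove[OF I(1) e(2) I(2), of ?c] lc_closed[OF I'(1)] I'(2)
        by (simp only: sm(6) l_zero)
    qed
    finally show ?thesis by blast
  qed
  then show ?thesis using s by (auto simp: spanning_def)
qed

text \<open>Members are discarded as long as a nontrivial relation exists; a family without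
  relations is a basis in the sense of \<open>finite_basis\<close>.\<close>

lemma spanning_fin_dim:
  fixes I :: "'i set"
  assumes "spanning (carrier V) I v"
  shows "fin_dim V"
  using assms
proof (induction "card I" arbitrary: I rule: less_induct)
  case less
  have I: "finite I" "v ` I \<subseteq> carrier V" using less.prems by (auto simp: spanning_def)
  show ?case
  proof (cases "\<exists>e. \<exists>j\<in>I. lc v I e = \<zero> \<and> e j \<noteq> 0")
    case True
    then obtain e j where "j \<in> I" "lc v I e = \<zero>" "e j \<noteq> 0" by blast
    then show ?thesis
      using less.hyps[of "I - {j}"] spanning_drop[OF less.prems] I(1) card_Diff1_less[of I j] by blast
  next
    case False
    then have indep: "e j = 0" if "lc v I e = \<zero>" "j \<in> I" for e j using that by blast
    have diff: "c j = d j" if "lc v I c = lc v I d" "j \<in> I" for c d j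
    proof -
      have "lc v I (\<lambda>i. c i + (-1) * d i) = lc v I c \<oplus> (-1) \<odot> lc v I d"
        by (simp only: lc_add[OF I(2)] lc_scale[OF I])
      also have "\<dots> = \<zero>" using that(1) lc_closed[OF I(2)] by (simp add: sm r_neg)
      finally show ?thesis using indep[of "\<lambda>i. c i + (-1) * d i" j] that(2) by simp
    qed
    \<comment> \<open>\<open>finite_basis\<close> speaks of a set of vectors, so a relation-free
      family must be shown to have no repetitions before it is replaced by its image.\<close>
    have inj: "inj_on v I"
    proof (rule inj_onI, rule ccontr)
      fix i j assume ij: "i \<in> I" "j \<in> I" "v i = v j" "i \<noteq> j"
      have "lc v I (\<lambda>k. if k = i then 1 else 0) = lc v I (\<lambda>k. if k = j then 1 else 0)"
        using lc_delta[OF I(1) ij(1) I(2)] lc_delta[OF I(1) ij(2) I(2)] ij(3) by simp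
      from diff[OF this ij(1)] ij(4) show False by simp
    qed
    have re: "lin_comb V (v ` I) c = lc v I (\<lambda>i. c (v i))" for c
      unfolding lin_comb_def lc_def
      by (rule finsum_reindex) (use I inj in \<open>auto simp: sm\<close>)
    have "bij_betw (lin_comb V (v ` I)) ((v ` I) \<rightarrow>\<^sub>E UNIV) (carrier V)"
    proof (rule bij_betwI')
      fix c d :: "'v \<Rightarrow> 'k" assume cd: "c \<in> v ` I \<rightarrow>\<^sub>E UNIV" "d \<in> v ` I \<rightarrow>\<^sub>E UNIV"
      show "lin_comb V (v ` I) c = lin_comb V (v ` I) d \<longleftrightarrow> c = d"
      proof
        assume "lin_comb V (v ` I) c = lin_comb V (v ` I) d"
        then have "c (v i) = d (v i)" if "i \<in> I" for i using diff[of "\<lambda>i. c (v i)" "\<lambda>i. d (v i)" i] that by (simp add: re)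
        then show "c = d" using cd by (intro PiE_ext) auto
      qed simp
    next
      fix c :: "'v \<Rightarrow> 'k" show "lin_comb V (v ` I) c \<in> carrier V" unfolding re by (rule lc_closed[OF I(2)])
    next
      fix x assume "x \<in> carrier V"
      then obtain a where a: "x = lc v I a" using less.prems by (auto simp: spanning_def)
      let ?c = "restrict (\<lambda>b. a (inv_into I v b)) (v ` I)"
      have "lin_comb V (v ` I) ?c = x"
        unfolding re a by (rule lc_cong) (use inj I in auto)
      then show "\<exists>c\<in>v ` I \<rightarrow>\<^sub>E UNIV. x = lin_comb V (v ` I) c"
        by (intro bexI[of _ ?c]) auto
    qed
    then have "finite_basis V (v ` I)" using I by (simp add: finite_basis_def)
    then show ?thesis by (auto simp: fin_dim_def)
  qed
qed

text \<open>Elimination of one index at a time, in a form that replaces a comparison of dimensions: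
  by the last clause a subspace not containing all combinations gets a strictly smaller index set,
  which is what lets the induction along composition series terminate.\<close>

lemma spanning_subspace:
  fixes I :: "'i set"
  assumes "finite I" "v ` I \<subseteq> carrier V"
    and "U \<subseteq> carrier V" "\<zero> \<in> U" "\<And>x y. x \<in> U \<Longrightarrow> y \<in> U \<Longrightarrow> x \<oplus> y \<in> U" "\<And>k x. x \<in> U \<Longrightarrow> k \<odot> x \<in> U"
    and "\<And>x. x \<in> U \<Longrightarrow> \<exists>c. x = lc v I c"
  shows "\<exists>J w. J \<subseteq> I \<and> spanning U J w \<and> (J = I \<longrightarrow> (\<forall>c. lc v I c \<in> U))"
  using assms
proof (induction I arbitrary: U rule: finite_induct)
  case empty
  then have "spanning U {} v" by (simp add: spanning_def)
  then show ?case using empty.prems(3) by (intro exI[of _ "{}"] exI[of _ v]) (simp add: lc_empty)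
next
  case (insert j I)
  have vI: "v ` I \<subseteq> carrier V" "v j \<in> carrier V" using insert.prems by auto
  \<comment> \<open>The part of \<open>U\<close> that can be written without \<open>v j\<close>; the
    induction hypothesis applies to it.\<close>
  let ?U = "U \<inter> range (lc v I)"
  have rg_add: "x \<oplus> y \<in> range (lc v I)" if "x \<in> range (lc v I)" "y \<in> range (lc v I)" for x y
  proof -
    from that obtain c d where "x = lc v I c" "y = lc v I d" by blast
    then have "x \<oplus> y = lc v I (\<lambda>i. c i + d i)" using lc_add[OF vI(1)] by simp
    then show ?thesis by blast
  qed
  have rg_scale: "k \<odot> x \<in> range (lc v I)" if "x \<in> range (lc v I)" for k x
  proof -
    from that obtain c where "x = lc v I c" by blast
    then have "k \<odot> x = lc v I (\<lambda>i. k * c i)" using lc_scale[OF insert.hyps(1) vI(1)] by simp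
    then show ?thesis by blast
  qed
  have rg_closed: "x \<in> carrier V" if "x \<in> range (lc v I)" for x using that lc_closed[OF vI(1)] by auto
  have rg_zero: "\<zero> \<in> range (lc v I)" using rg_scale[of "lc v I (\<lambda>_. 0)" 0] rg_closed by (simp add: sm)
  have "\<exists>J w. J \<subseteq> I \<and> spanning ?U J w \<and> (J = I \<longrightarrow> (\<forall>c. lc v I c \<in> ?U))"
    by (rule insert.IH[OF vI(1)]) (use insert.prems rg_add rg_scale rg_zero in auto)
  then obtain J w where J: "J \<subseteq> I" "spanning ?U J w" "J = I \<Longrightarrow> range (lc v I) \<subseteq> U" by blast
  show ?case
  proof (cases "U \<subseteq> range (lc v I)")
    case True
    then have "?U = U" by blast
    then show ?thesis using J insert.hyps by (intro exI[of _ J] exI[of _ w]) auto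
  next
    case False
    then obtain u where u: "u \<in> U" "u \<notin> range (lc v I)" by blast
    obtain c where c: "u = lc v (insert j I) c" using insert.prems(6)[OF u(1)] by blast
    then have u': "u = c j \<odot> v j \<oplus> lc v I c" using lc_insert insert by simp
    have cj: "c j \<noteq> 0" using u(2) u' vI by (auto simp: sm rg_closed)
    \<comment> \<open>A pivot: an element of \<open>U\<close> in which \<open>v j\<close> occurs
      with coefficient 1. It takes the index \<open>j\<close> in the new family.\<close>
    define u1 where "u1 = (1 / c j) \<odot> u"
    have u1U: "u1 \<in> U" using insert.prems(5) u(1) by (simp add: u1_def)
    define t where "t = (1 / c j) \<odot> lc v I c"
    have tr: "t \<in> range (lc v I)" unfolding t_def by (rule rg_scale) blast
    have u1: "u1 = v j \<oplus> t"
      unfolding u1_def t_def u' using vI lc_closed[OF vI(1), of c] cj by (simp add: sm(3) sm(1) sm(4)[symmetric] sm(5))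
    have jJ: "j \<notin> J" "finite J" using J insert.hyps by (auto simp: spanning_def)
    let ?w = "w(j := u1)"
    have wJ: "w ` J \<subseteq> ?U" using J(2) by (simp add: spanning_def)
    have w': "?w ` insert j J \<subseteq> U" using wJ u1U jJ by auto
    have w'c: "?w ` insert j J \<subseteq> carrier V" using w' insert.prems(2) by blast
    have eqw: "lc ?w J d = lc w J d" for d
      by (rule lc_cong) (use jJ wJ insert.prems(2) in auto)
    have "\<exists>d. x = lc ?w (insert j J) d" if x: "x \<in> U" for x
    proof -
      obtain a where "x = lc v (insert j I) a" using insert.prems(6)[OF x] by blast
      then have xa: "x = a j \<odot> v j \<oplus> lc v I a" using lc_insert insert by simp
      \<comment> \<open>Subtracting \<open>a j\<close> times the pivot removes \<open>v j\<close>,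
        so the rest lies in \<open>?U\<close> and is a combination of \<open>w\<close>.\<close>
      let ?y = "x \<oplus> (- a j) \<odot> u1"
      have yU: "?y \<in> U" using x u1U insert.prems(4,5) by blast
      have tc: "t \<in> carrier V" "lc v I a \<in> carrier V" using rg_closed tr lc_closed[OF vI(1)] by auto
      have "?y = (a j \<odot> v j \<oplus> (- a j) \<odot> v j) \<oplus> (lc v I a \<oplus> (- a j) \<odot> t)"
        unfolding xa u1 using vI tc by (simp add: sm a_ac)
      also have "a j \<odot> v j \<oplus> (- a j) \<odot> v j = \<zero>" using sm(2)[of "v j" "a j" "- a j"] vI sm(6) by simp
      finally have "?y = lc v I a \<oplus> (- a j) \<odot> t" using tc by (simp add: sm)
      then have "?y \<in> ?U" using yU rg_add rg_scale[OF tr] by (metis IntI rangeI)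
      then obtain d where d: "?y = lc w J d" using J(2) unfolding spanning_def by blast
      have xc: "x \<in> carrier V" "u1 \<in> carrier V" using x u1U insert.prems(2) by auto
      have "lc ?w (insert j J) (d(j := a j)) = a j \<odot> u1 \<oplus> lc ?w J (d(j := a j))"
        using lc_insert[OF jJ(2,1) w'c] by simp
      also have "lc ?w J (d(j := a j)) = lc w J d"
        by (rule lc_cong) (use jJ wJ insert.prems(2) in auto)
      also have "a j \<odot> u1 \<oplus> lc w J d = x \<oplus> (a j \<odot> u1 \<oplus> (- a j) \<odot> u1)"
        unfolding d[symmetric] using xc by (simp add: sm a_ac)
      also have "a j \<odot> u1 \<oplus> (- a j) \<odot> u1 = \<zero>" using sm(2)[of u1 "a j" "- a j"] xc sm(6) by simp
      finally have "lc ?w (insert j J) (d(j := a j)) = x"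
        using xc(1) by (simp only: r_zero)
      then show ?thesis by (intro exI[of _ "d(j := a j)"]) (rule sym)
    qed
    then have "spanning U (insert j J) ?w" using w' jJ by (auto simp: spanning_def)
    moreover have "\<forall>d. lc v (insert j I) d \<in> U" if "insert j J = insert j I"
    proof -
      have "J = I" using that jJ insert.hyps J(1) by auto
      then have rU: "range (lc v I) \<subseteq> U" by (rule J(3))
      have tc: "t \<in> carrier V" using rg_closed tr by auto
      \<comment> \<open>With \<open>J = I\<close> all combinations without \<open>v j\<close> lie in
        \<open>U\<close>, in particular \<open>t\<close>; hence so does \<open>v j\<close>, the
        difference of the pivot and \<open>t\<close>.\<close>
      have "u1 \<oplus> (-1) \<odot> t \<in> U" using u1U rU tr insert.prems(4,5) by blast
      also have "u1 \<oplus> (-1) \<odot> t = v j" unfolding u1 using vI tc by (simp add: sm a_assoc r_neg)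
      finally have vU: "v j \<in> U" .
      have "d j \<odot> v j \<oplus> lc v I d \<in> U" for d
        by (rule insert.prems(4)[OF insert.prems(5)[OF vU]]) (use rU in blast)
      then show ?thesis unfolding lc_insert[OF insert.hyps insert.prems(1)] by blast
    qed
    ultimately have "insert j J \<subseteq> insert j I \<and> spanning U (insert j J) ?w \<and>
        (insert j J = insert j I \<longrightarrow> (\<forall>d. lc v (insert j I) d \<in> U))"
      using J(1) by blast
    then show ?thesis by blast
  qed
qed

lemma spanning_quotient:
  assumes s: "spanning (carrier V) I v" and Q: "Module.module ground_ring Q"
    and \<pi>: "\<pi> \<in> linear_maps V Q" "\<pi> ` carrier V = carrier Q"
  shows "kspace.spanning Q (carrier Q) I (\<lambda>i. \<pi> (v i))"
    and "u \<in> carrier V \<Longrightarrow> u \<noteq> \<zero> \<Longrightarrow> \<pi> u = \<zero>\<^bsub>Q\<^esub> \<Longrightarrow> \<exists>j\<in>I. kspace.spanning Q (carrier Q) (I - {j}) (\<lambda>i. \<pi> (v i))"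
proof -
  interpret Q: kspace Q using Q by (simp add: kspace_def)
  have I: "finite I" "v ` I \<subseteq> carrier V" using s by (auto simp: spanning_def)
  note p = linear_lc[OF Q \<pi>(1) I]
  show sp: "Q.spanning (carrier Q) I (\<lambda>i. \<pi> (v i))"
    unfolding Q.spanning_def
  proof (intro conjI ballI)
    show "(\<lambda>i. \<pi> (v i)) ` I \<subseteq> carrier Q" using I \<pi>(2) by auto
    fix y assume "y \<in> carrier Q"
    then obtain x where "x \<in> carrier V" "y = \<pi> x" using \<pi>(2) by auto
    then show "\<exists>c. y = Q.lc (\<lambda>i. \<pi> (v i)) I c" using s p by (metis spanning_def)
  qed (rule I)
  assume u: "u \<in> carrier V" "u \<noteq> \<zero>" "\<pi> u = \<zero>\<^bsub>Q\<^esub>"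
  obtain e where e: "u = lc v I e" using s u(1) by (auto simp: spanning_def)
  have "\<exists>j\<in>I. e j \<noteq> 0"
  proof (rule ccontr)
    assume "\<not> ?thesis"
    then have "u = lc v I (\<lambda>i. 0 * 0)" unfolding e by (intro lc_cong) (use I in auto)
    also have "\<dots> = 0 \<odot> lc v I (\<lambda>i. 0)" by (rule lc_scale[OF I])
    finally show False using u(2) lc_closed[OF I(2)] by (simp add: sm)
  qed
  then obtain j where j: "j \<in> I" "e j \<noteq> 0" by blast
  have "Q.lc (\<lambda>i. \<pi> (v i)) I e = \<zero>\<^bsub>Q\<^esub>" using p[of e] e u(3) by simp
  then show "\<exists>j\<in>I. Q.spanning (carrier Q) (I - {j}) (\<lambda>i. \<pi> (v i))"
    using Q.spanning_drop[OF sp subset_refl _ j(1)] j by blast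
qed

end

lemma linear_maps_comp: "\<phi> \<in> linear_maps U V \<Longrightarrow> \<psi> \<in> linear_maps V W \<Longrightarrow> (\<lambda>x. \<psi> (\<phi> x)) \<in> linear_maps U W"
  by (rule linear_mapsI) (auto simp: linear_mapsD)

section \<open>Dual systems and traces\<close>

context kspace
begin

text \<open>Vectors and functionals with \<open>x = \<Sum> f_i(x) v_i\<close>. Independence of the
  \<open>v_i\<close> is not demanded; the expansion is what a trace computation uses.\<close>

definition dual_system :: "'i set \<Rightarrow> ('i \<Rightarrow> 'v) \<Rightarrow> ('i \<Rightarrow> 'v \<Rightarrow> 'k) \<Rightarrow> bool" where
  "dual_system I v f \<longleftrightarrow> finite I \<and> v ` I \<subseteq> carrier V \<and> (\<forall>i\<in>I. f i \<in> linear_maps V ground_space) \<and>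
     (\<forall>x\<in>carrier V. x = lc v I (\<lambda>i. f i x))"

definition coord :: "'v set \<Rightarrow> 'v \<Rightarrow> 'v \<Rightarrow> 'k" where
  "coord B x = inv_into (B \<rightarrow>\<^sub>E UNIV) (lin_comb V B) x"

lemma lin_comb_lc: "lin_comb V B c = lc (\<lambda>b. b) B c"
  by (simp add: lin_comb_def lc_def)

lemma coord:
  assumes B: "finite_basis V B" and x: "x \<in> carrier V"
  shows "coord B x \<in> B \<rightarrow>\<^sub>E UNIV" "x = lc (\<lambda>b. b) B (coord B x)"
proof -
  have b: "bij_betw (lin_comb V B) (B \<rightarrow>\<^sub>E UNIV) (carrier V)" using B by (simp add: finite_basis_def)
  have im: "x \<in> lin_comb V B ` (B \<rightarrow>\<^sub>E UNIV)" using b x by (simp add: bij_betw_def)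
  show "coord B x \<in> B \<rightarrow>\<^sub>E UNIV" "x = lc (\<lambda>b. b) B (coord B x)"
    unfolding coord_def lin_comb_lc[symmetric] using inv_into_into[OF im] f_inv_into_f[OF im] by simp_all
qed

lemma coord_eq:
  assumes B: "finite_basis V B" and x: "x = lc (\<lambda>b. b) B c" and b: "b \<in> B"
  shows "coord B x b = c b"
proof -
  have BV: "finite B" "B \<subseteq> carrier V" using B by (auto simp: finite_basis_def)
  have "lin_comb V B (restrict c B) = x"
    unfolding x lin_comb_lc by (rule lc_cong) (use BV in auto)
  moreover have "inj_on (lin_comb V B) (B \<rightarrow>\<^sub>E UNIV)" using B by (simp add: finite_basis_def bij_betw_def)
  ultimately have "coord B x = restrict c B" unfolding coord_def by (intro inv_into_f_eq) auto
  then show ?thesis using b by simp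
qed

lemma basis_dual_system:
  assumes B: "finite_basis V B"
  shows "dual_system B (\<lambda>b. b) (\<lambda>b x. coord B x b)"
proof -
  have BV: "finite B" "(\<lambda>b. b) ` B \<subseteq> carrier V" using B by (auto simp: finite_basis_def)
  have "(\<lambda>x. coord B x b) \<in> linear_maps V ground_space" if b: "b \<in> B" for b
  proof (rule linear_mapsI)
    fix x y assume xy: "x \<in> carrier V" "y \<in> carrier V"
    show "coord B (x \<oplus> y) b = coord B x b \<oplus>\<^bsub>ground_space\<^esub> coord B y b"
      unfolding space_of_fields
      by (rule coord_eq[OF B _ b]) (simp only: lc_add[OF BV(2)] coord(2)[OF B xy(1), symmetric] coord(2)[OF B xy(2), symmetric])
  next
    fix k x assume x: "x \<in> carrier V"
    show "coord B (k \<odot> x) b = k \<odot>\<^bsub>ground_space\<^esub> coord B x b"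
      unfolding space_of_fields
      by (rule coord_eq[OF B _ b]) (simp only: lc_scale[OF BV] coord(2)[OF B x, symmetric])
  qed simp
  then show ?thesis using BV coord(2)[OF B] by (auto simp: dual_system_def)
qed

end

text \<open>Expanding \<open>\<rho> (v i)\<close> in the \<open>w j\<close> and
  \<open>\<sigma> (w j)\<close> in the \<open>v i\<close> turns both sides into one double sum.
  Taken with an identity map it also shows that the trace does not depend on the system.\<close>

lemma trace_swap:
  assumes V: "kspace V" and N: "kspace N"
    and v: "kspace.dual_system V I v f" and w: "kspace.dual_system N J w g"
    and \<rho>: "\<rho> \<in> linear_maps V N" and \<sigma>: "\<sigma> \<in> linear_maps N V"
  shows "(\<Sum>i\<in>I. f i (\<sigma> (\<rho> (v i)))) = (\<Sum>j\<in>J. g j (\<rho> (\<sigma> (w j))))"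
proof -
  interpret V: kspace V by fact
  interpret N: kspace N by fact
  have v': "finite I" "v ` I \<subseteq> carrier V" "\<And>i. i \<in> I \<Longrightarrow> f i \<in> linear_maps V ground_space"
    "\<And>x. x \<in> carrier V \<Longrightarrow> x = V.lc v I (\<lambda>i. f i x)" using v unfolding V.dual_system_def by blast+
  have w': "finite J" "w ` J \<subseteq> carrier N" "\<And>j. j \<in> J \<Longrightarrow> g j \<in> linear_maps N ground_space"
    "\<And>x. x \<in> carrier N \<Longrightarrow> x = N.lc w J (\<lambda>j. g j x)" using w unfolding N.dual_system_def by blast+
  have 1: "f i (\<sigma> (\<rho> (v i))) = (\<Sum>j\<in>J. g j (\<rho> (v i)) * f i (\<sigma> (w j)))" if i: "i \<in> I" for i
  proof -
    have "\<rho> (v i) \<in> carrier N" using linear_mapsD(2)[OF \<rho>] v'(2) i by blast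
    from arg_cong[OF w'(4)[OF this], of "\<lambda>x. f i (\<sigma> x)"]
    show ?thesis using N.functional_lc[OF linear_maps_comp[OF \<sigma> v'(3)[OF i]] w'(1,2)] by simp
  qed
  have 2: "g j (\<rho> (\<sigma> (w j))) = (\<Sum>i\<in>I. f i (\<sigma> (w j)) * g j (\<rho> (v i)))" if j: "j \<in> J" for j
  proof -
    have "\<sigma> (w j) \<in> carrier V" using linear_mapsD(2)[OF \<sigma>] w'(2) j by blast
    from arg_cong[OF v'(4)[OF this], of "\<lambda>x. g j (\<rho> x)"]
    show ?thesis using V.functional_lc[OF linear_maps_comp[OF \<rho> w'(3)[OF j]] v'(1,2)] by simp
  qed
  have "(\<Sum>i\<in>I. f i (\<sigma> (\<rho> (v i)))) = (\<Sum>i\<in>I. \<Sum>j\<in>J. f i (\<sigma> (w j)) * g j (\<rho> (v i)))"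
    by (rule sum.cong) (simp_all add: 1 mult.commute)
  also have "\<dots> = (\<Sum>j\<in>J. \<Sum>i\<in>I. f i (\<sigma> (w j)) * g j (\<rho> (v i)))" by (rule sum.swap)
  also have "\<dots> = (\<Sum>j\<in>J. g j (\<rho> (\<sigma> (w j))))" by (rule sum.cong) (simp_all add: 2)
  finally show ?thesis .
qed

text \<open>Isolates the choice of a basis in \<open>trace_on\<close>: later arguments see some dual
  system that computes all traces on \<open>V\<close>.\<close>

lemma fin_dim_trace:
  assumes V: "kspace V" and fd: "fin_dim V"
  obtains B f where "finite_basis V B" "kspace.dual_system V B (\<lambda>b. b) f"
    and "\<And>\<phi>. trace_on V \<phi> = (\<Sum>b\<in>B. f b (\<phi> b))"
proof -
  interpret kspace V by fact
  let ?B = "SOME B. finite_basis V B"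
  have B: "finite_basis V ?B" using fd unfolding fin_dim_def by (rule someI_ex)
  show ?thesis
    by (rule that[OF B basis_dual_system[OF B]]) (simp add: trace_on_def Let_def coord_def)
qed

lemma trace_on_swap:
  assumes V: "kspace V" "fin_dim V" and N: "kspace N" "fin_dim N"
    and \<rho>: "\<rho> \<in> linear_maps V N" and \<sigma>: "\<sigma> \<in> linear_maps N V"
  shows "trace_on V (\<lambda>x. \<sigma> (\<rho> x)) = trace_on N (\<lambda>x. \<rho> (\<sigma> x))"
proof -
  obtain A f where A: "kspace.dual_system V A (\<lambda>b. b) f" "\<And>\<phi>. trace_on V \<phi> = (\<Sum>b\<in>A. f b (\<phi> b))"
    by (rule fin_dim_trace[OF V]) blast
  obtain B g where B: "kspace.dual_system N B (\<lambda>b. b) g" "\<And>\<phi>. trace_on N \<phi> = (\<Sum>b\<in>B. g b (\<phi> b))"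
    by (rule fin_dim_trace[OF N]) blast
  show ?thesis unfolding A(2) B(2) by (rule trace_swap[OF V(1) N(1) A(1) B(1) \<rho> \<sigma>])
qed

lemma trace_on_cong:
  assumes V: "kspace V" "fin_dim V" and "\<And>x. x \<in> carrier V \<Longrightarrow> \<phi> x = \<psi> x"
  shows "trace_on V \<phi> = trace_on V \<psi>"
proof -
  obtain A f where A: "finite_basis V A" "\<And>\<phi>. trace_on V \<phi> = (\<Sum>b\<in>A. f b (\<phi> b))"
    by (rule fin_dim_trace[OF V]) blast
  show ?thesis unfolding A(2) using A(1) assms(3) by (intro sum.cong) (auto simp: finite_basis_def)
qed

lemma trace_on_add:
  assumes V: "kspace V" "fin_dim V" and "\<phi> \<in> linear_maps V V" "\<psi> \<in> linear_maps V V"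
  shows "trace_on V (\<lambda>x. \<phi> x \<oplus>\<^bsub>V\<^esub> \<psi> x) = trace_on V \<phi> + trace_on V \<psi>"
proof -
  interpret kspace V by fact
  obtain A f where A: "finite_basis V A" "dual_system A (\<lambda>b. b) f" "\<And>\<phi>. trace_on V \<phi> = (\<Sum>b\<in>A. f b (\<phi> b))"
    by (rule fin_dim_trace[OF V]) blast
  have "f b (\<phi> b \<oplus>\<^bsub>V\<^esub> \<psi> b) = f b (\<phi> b) + f b (\<psi> b)" if "b \<in> A" for b
  proof -
    have "f b \<in> linear_maps V ground_space" "b \<in> carrier V" using A(1,2) that by (auto simp: dual_system_def finite_basis_def)
    then show ?thesis using linear_mapsD(3) linear_mapsD(2)[OF assms(3)] linear_mapsD(2)[OF assms(4)] by fastforce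
  qed
  then show ?thesis unfolding A(3) by (simp add: sum.distrib)
qed

text \<open>
  With a linear section \<open>s\<close> of \<open>\<pi>\<close> and the retraction \<open>r\<close> complementary to it, the identity of \<open>V\<close> is
  \<open>\<alpha> r + s \<pi>\<close>, and the trace of each summand of \<open>\<phi> \<alpha> r + \<phi> s \<pi>\<close> is computed by swapping.
\<close>

lemma trace_on_exact:
  assumes U: "kspace U" "fin_dim U" and V: "kspace V" "fin_dim V" and W: "kspace W" "fin_dim W"
    and \<alpha>: "\<alpha> \<in> linear_maps U V" "inj_on \<alpha> (carrier U)" and \<pi>: "\<pi> \<in> linear_maps V W" "\<pi> ` carrier V = carrier W"
    and exact: "\<alpha> ` carrier U = {v \<in> carrier V. \<pi> v = \<zero>\<^bsub>W\<^esub>}"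
    and \<phi>: "\<phi>\<^sub>U \<in> linear_maps U U" "\<phi> \<in> linear_maps V V" "\<phi>\<^sub>W \<in> linear_maps W W"
    and comm: "\<And>u. u \<in> carrier U \<Longrightarrow> \<alpha> (\<phi>\<^sub>U u) = \<phi> (\<alpha> u)" "\<And>v. v \<in> carrier V \<Longrightarrow> \<pi> (\<phi> v) = \<phi>\<^sub>W (\<pi> v)"
  shows "trace_on V \<phi> = trace_on U \<phi>\<^sub>U + trace_on W \<phi>\<^sub>W"
proof -
  interpret U: kspace U by fact
  interpret V: kspace V by fact
  interpret W: kspace W by fact
  note al = linear_mapsD[OF \<alpha>(1)] and pl = linear_mapsD[OF \<pi>(1)]
  obtain B where B: "finite_basis W B" using W(2) by (auto simp: fin_dim_def)
  then have ds: "W.dual_system B (\<lambda>b. b) (\<lambda>b x. W.coord B x b)" by (rule W.basis_dual_system)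
  have BW: "finite B" "B \<subseteq> carrier W" using B by (auto simp: finite_basis_def)
  \<comment> \<open>Preimages of a basis of \<open>W\<close>; extending linearly by coordinates
    gives the section \<open>s\<close>.\<close>
  define t where "t b = inv_into (carrier V) \<pi> b" for b
  have t: "t b \<in> carrier V" "\<pi> (t b) = b" if "b \<in> B" for b
  proof -
    have "b \<in> \<pi> ` carrier V" using that BW(2) \<pi>(2) by blast
    then show "t b \<in> carrier V" "\<pi> (t b) = b" unfolding t_def by (rule inv_into_into f_inv_into_f)+
  qed
  have tB: "t ` B \<subseteq> carrier V" using t by auto
  define s where "s y = V.lc t B (W.coord B y)" for y
  have s: "s \<in> linear_maps W V"
  proof (rule linear_mapsI)
    have g: "(\<lambda>y. W.coord B y b) \<in> linear_maps W ground_space" if "b \<in> B" for b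
      using ds that by (simp add: W.dual_system_def)
    show "s y \<in> carrier V" for y unfolding s_def by (rule V.lc_closed[OF tB])
    show "s (x \<oplus>\<^bsub>W\<^esub> y) = s x \<oplus>\<^bsub>V\<^esub> s y" if "x \<in> carrier W" "y \<in> carrier W" for x y
      unfolding s_def V.lc_add[OF tB, symmetric]
      by (rule V.lc_cong) (use that t linear_mapsD(3)[OF g] in auto)
    show "s (c \<odot>\<^bsub>W\<^esub> y) = c \<odot>\<^bsub>V\<^esub> s y" if "y \<in> carrier W" for c y
      unfolding s_def V.lc_scale[OF BW(1) tB, symmetric]
      by (rule V.lc_cong) (use that t linear_mapsD(4)[OF g] in auto)
  qed
  note sl = linear_mapsD[OF s]
  have \<pi>s: "\<pi> (s y) = y" if "y \<in> carrier W" for y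
  proof -
    have "\<pi> (s y) = W.lc (\<lambda>b. \<pi> (t b)) B (W.coord B y)"
      unfolding s_def by (rule V.linear_lc[OF W.module_axioms \<pi>(1) BW(1) tB])
    also have "\<dots> = W.lc (\<lambda>b. b) B (W.coord B y)"
      by (rule W.lc_cong) (use t BW in auto)
    finally show ?thesis using W.coord(2)[OF B that] by simp
  qed
  \<comment> \<open>The projection of \<open>V\<close> onto the kernel of \<pi> along the image of
    \<open>s\<close>; by exactness it factors through \<alpha>, which yields
    \<open>r\<close>.\<close>
  define k where "k x = x \<oplus>\<^bsub>V\<^esub> (-1) \<odot>\<^bsub>V\<^esub> s (\<pi> x)" for x
  have k: "k x \<in> \<alpha> ` carrier U" if x: "x \<in> carrier V" for x
  proof -
    have px: "\<pi> x \<in> carrier W" by (rule pl(2)[OF x])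
    have "\<pi> (k x) = \<pi> x \<oplus>\<^bsub>W\<^esub> (-1) \<odot>\<^bsub>W\<^esub> \<pi> x"
      unfolding k_def using x sl(2)[OF px] V.sm(1) by (simp add: pl \<pi>s px)
    also have "\<dots> = \<zero>\<^bsub>W\<^esub>" using px by (simp add: W.sm W.r_neg)
    finally show ?thesis unfolding exact k_def using x sl(2)[OF px] V.sm(1) by simp
  qed
  define r where "r = (\<lambda>x. inv_into (carrier U) \<alpha> (k x))"
  \<comment> \<open>With the identity as action, linear maps count as module homomorphisms, so that
    \<open>module_homs_factor\<close> supplies the linear retraction.\<close>
  have ah: "\<alpha> \<in> module_homs U (\<lambda>_ x. x) V (\<lambda>_ x. x)" by (rule module_homsI) (auto simp: al)
  have kh: "k \<in> module_homs V (\<lambda>_ x. x) V (\<lambda>_ x. x)"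
  proof (rule module_homsI)
    have "(-1) \<odot>\<^bsub>V\<^esub> (c \<odot>\<^bsub>V\<^esub> y) = c \<odot>\<^bsub>V\<^esub> ((-1) \<odot>\<^bsub>V\<^esub> y)" if "y \<in> carrier V" for c y
      using V.sm(4)[OF that, of "-1" c] V.sm(4)[OF that, of c "-1"] by (metis mult.commute)
    then show "k (c \<odot>\<^bsub>V\<^esub> x) = c \<odot>\<^bsub>V\<^esub> k x" if "x \<in> carrier V" for c x
      using that by (simp add: k_def pl sl V.sm(1,3) del: V.smult_closed)
  qed (simp_all add: k_def pl sl V.sm(1,3) V.a_ac)
  have ki: "k ` carrier V \<subseteq> \<alpha> ` carrier U" using k by blast
  note factor = module_homs_factor[OF ah \<alpha>(2) kh ki U.abelian_group_axioms]
  have rh: "r \<in> module_homs V (\<lambda>_ x. x) U (\<lambda>_ x. x)"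
    unfolding r_def by (rule factor(1)) (simp_all add: U.sm(1))
  have \<alpha>r: "\<alpha> (r x) = k x" if "x \<in> carrier V" for x
    unfolding r_def by (rule factor(2)) (simp_all add: U.sm(1) that)
  have rl: "r \<in> linear_maps V U" by (rule module_homsD(1)[OF rh])
  have r: "x \<in> carrier V \<Longrightarrow> r x \<in> carrier U" for x by (rule linear_mapsD(2)[OF rl])
  have z\<pi>: "\<pi> (\<alpha> u) = \<zero>\<^bsub>W\<^esub>" if "u \<in> carrier U" for u using exact that by blast
  have s0: "s \<zero>\<^bsub>W\<^esub> = \<zero>\<^bsub>V\<^esub>" by (rule linear_maps_zero[OF W.abelian_group_axioms V.abelian_group_axioms s])
  have r\<alpha>: "r (\<alpha> u) = u" if u: "u \<in> carrier U" for u
    using inj_onD[OF \<alpha>(2) _ r[OF al(2)[OF u]] u] \<alpha>r[OF al(2)[OF u]] al(2)[OF u] by (simp add: k_def z\<pi> u s0 V.sm)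
  have decomp: "x = \<alpha> (r x) \<oplus>\<^bsub>V\<^esub> s (\<pi> x)" if x: "x \<in> carrier V" for x
  proof -
    have c: "s (\<pi> x) \<in> carrier V" using sl(2) pl(2) x by auto
    have "\<alpha> (r x) \<oplus>\<^bsub>V\<^esub> s (\<pi> x) = x \<oplus>\<^bsub>V\<^esub> ((-1) \<odot>\<^bsub>V\<^esub> s (\<pi> x) \<oplus>\<^bsub>V\<^esub> s (\<pi> x))"
      using \<alpha>r[OF x] x c V.sm(1)[OF c] by (simp add: k_def V.a_assoc)
    also have "\<dots> = x" using c x by (simp add: V.sm(8) V.l_neg)
    finally show ?thesis by simp
  qed
  have 1: "(\<lambda>x. \<phi> (\<alpha> (r x))) \<in> linear_maps V V" "(\<lambda>x. \<phi> (s (\<pi> x))) \<in> linear_maps V V"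
    by (intro linear_maps_comp[OF _ \<phi>(2)] linear_maps_comp[OF rl \<alpha>(1)] linear_maps_comp[OF \<pi>(1) s])+
  have "trace_on V \<phi> = trace_on V (\<lambda>x. \<phi> (\<alpha> (r x)) \<oplus>\<^bsub>V\<^esub> \<phi> (s (\<pi> x)))"
  proof (rule trace_on_cong[OF V])
    fix x assume x: "x \<in> carrier V"
    show "\<phi> x = \<phi> (\<alpha> (r x)) \<oplus>\<^bsub>V\<^esub> \<phi> (s (\<pi> x))"
      using arg_cong[OF decomp[OF x], of \<phi>] linear_mapsD(3)[OF \<phi>(2), of "\<alpha> (r x)" "s (\<pi> x)"] al(2)[OF r[OF x]] sl(2)[OF pl(2)[OF x]]
      by simp
  qed
  also have "\<dots> = trace_on V (\<lambda>x. \<phi> (\<alpha> (r x))) + trace_on V (\<lambda>x. \<phi> (s (\<pi> x)))"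
    by (rule trace_on_add[OF V 1])
  also have "trace_on V (\<lambda>x. \<phi> (\<alpha> (r x))) = trace_on U (\<lambda>u. r (\<phi> (\<alpha> u)))"
    by (rule trace_on_swap[OF V U rl linear_maps_comp[OF \<alpha>(1) \<phi>(2)]])
  also have "\<dots> = trace_on U \<phi>\<^sub>U"
    by (rule trace_on_cong[OF U]) (simp add: comm(1)[symmetric] r\<alpha> linear_mapsD(2)[OF \<phi>(1)])
  also have "trace_on V (\<lambda>x. \<phi> (s (\<pi> x))) = trace_on W (\<lambda>y. \<pi> (\<phi> (s y)))"
    by (rule trace_on_swap[OF V W \<pi>(1) linear_maps_comp[OF s \<phi>(2)]])
  also have "\<dots> = trace_on W \<phi>\<^sub>W"
    by (rule trace_on_cong[OF W]) (simp add: comm(2) \<pi>s sl(2))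
  finally show ?thesis .
qed

section \<open>Characters of finite dimensional objects\<close>

context duality_category
begin

lemma obj_kspace: "V \<in> \<C> \<Longrightarrow> kspace V"
  using objD(1) by (simp add: kspace_def)

lemma lact_linear: "V \<in> \<C> \<Longrightarrow> lact V h \<in> linear_maps V V"
  by (rule linear_mapsI) (simp_all add: objD)

lemma trace_character_exact:
  assumes "U \<in> fin_obs" "V \<in> fin_obs" "W \<in> fin_obs" "short_exact U V W"
  shows "trace_character V = trace_character U + trace_character W"
proof
  fix h
  have C: "U \<in> \<C>" "V \<in> \<C>" "W \<in> \<C>" and fd: "fin_dim U" "fin_dim V" "fin_dim W"
    using assms by (auto simp: fin_objects_def)
  obtain \<alpha> \<pi> where a: "\<alpha> \<in> hom_H U V" "\<pi> \<in> hom_H V W" "inj_on \<alpha> (carrier U)"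
     "\<alpha> ` carrier U = {v \<in> carrier V. \<pi> v = \<zero>\<^bsub>W\<^esub>}" "\<pi> ` carrier V = carrier W"
    using assms(4) by (auto simp: short_exact_def)
  show "trace_character V h = (trace_character U + trace_character W) h"
    unfolding plus_fun_apply trace_character_def
    by (rule trace_on_exact[OF obj_kspace[OF C(1)] fd(1) obj_kspace[OF C(2)] fd(2) obj_kspace[OF C(3)] fd(3)
          module_homsD(1)[OF a(1)] a(3) module_homsD(1)[OF a(2)] a(5) a(4)])
      (simp_all add: lact_linear C module_homsD(5)[OF a(1)] module_homsD(5)[OF a(2)])
qed

text \<open>The trace is the sum over a basis of the coefficients of basis vector and coordinate
  functional. These functionals belong to \<open>star V\<close> because \<open>star\<close> is the
  full dual in finite dimension.\<close>

lemma trace_character_Hst: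
  assumes "V \<in> fin_obs"
  shows "trace_character V \<in> Hst star V"
proof -
  have V: "V \<in> \<C>" and fd: "fin_dim V" using assms by (auto simp: fin_objects_def)
  interpret kspace V by (rule obj_kspace[OF V])
  obtain B f where B: "finite_basis V B" "dual_system B (\<lambda>b. b) f" "\<And>\<phi>. trace_on V \<phi> = (\<Sum>b\<in>B. f b (\<phi> b))"
    by (rule fin_dim_trace[OF obj_kspace[OF V] fd]) blast
  have BV: "finite B" "B \<subseteq> carrier V" using B(1) by (auto simp: finite_basis_def)
  \<comment> \<open>Elements of \<open>dual_space\<close> vanish off the carrier, whereas the
    functionals of a dual system are unconstrained there.\<close>
  define g where "g b v = (if v \<in> carrier V then f b v else 0)" for b v
  have g: "g b \<in> star V" if "b \<in> B" for b
  proof -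
    have f: "f b \<in> linear_maps V ground_space" using B(2) that by (simp add: dual_system_def)
    have "g b \<in> linear_maps V ground_space"
      by (rule linear_mapsI) (use linear_mapsD[OF f] in \<open>auto simp: g_def sm\<close>)
    then have "g b \<in> carrier (dual_space V)" by (simp add: dual_space_def g_def)
    then show ?thesis using star_full_iff[OF V] fd by simp
  qed
  have "trace_character V = (\<Sum>b\<in>B. mcoeff V b (g b))"
  proof
    fix h
    have "(\<Sum>b\<in>K. mcoeff V b (g b)) h = (\<Sum>b\<in>K. mcoeff V b (g b) h)" for K
      by (induction K rule: infinite_finite_induct) (simp_all add: fun_pointwise)
    then show "trace_character V h = (\<Sum>b\<in>B. mcoeff V b (g b)) h"
      unfolding trace_character_def B(3) using BV(2) objD(3)[OF V]
      by (auto simp: mcoeff_def g_def intro!: sum.cong)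
  qed
  also have "\<dots> \<in> Hst star V"
    by (rule fs.subspace_sum[OF Hst_subspace[OF V]]) (use mcoeff_Hst[OF V] g BV in blast)
  finally show ?thesis .
qed

text \<open>Invariance of \<xi> amounts to \<open>\<xi> (x * h) = \<xi> (h * x)\<close>, the cyclic
  property of the trace.\<close>

lemma trace_character_inv:
  assumes "V \<in> fin_obs"
  shows "trace_character V \<in> HstC_inv \<C> star"
proof -
  have V: "V \<in> \<C>" and fd: "fin_dim V" using assms by (auto simp: fin_objects_def)
  note k = obj_kspace[OF V]
  have "trace_character V (x * h) = trace_character V (h * x)" for x h
  proof -
    have "trace_on V (lact V (x * h)) = trace_on V (\<lambda>v. lact V x (lact V h v))"
      by (rule trace_on_cong[OF k fd]) (rule objD(8)[OF V])
    also have "\<dots> = trace_on V (\<lambda>v. lact V h (lact V x v))"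
      by (rule trace_on_swap[OF k fd k fd lact_linear[OF V] lact_linear[OF V]])
    also have "\<dots> = trace_on V (lact V (h * x))"
      by (rule trace_on_cong[OF k fd]) (rule objD(8)[OF V, symmetric])
    finally show ?thesis by (simp add: trace_character_def)
  qed
  then show ?thesis
    using Hst_HstC[OF V trace_character_Hst[OF assms]] by (simp add: HstC_inv_def Hst_act_def)
qed

text \<open>The number is the size of the basis chosen by \<open>trace_on\<close>. It is kept as a
  natural number because positivity survives in the field only in characteristic 0.\<close>

lemma trace_character_one:
  assumes "V \<in> fin_obs" "carrier V \<noteq> {\<zero>\<^bsub>V\<^esub>}"
  shows "\<exists>n>0. trace_character V 1 = of_nat n"
proof -
  have V: "V \<in> \<C>" and fd: "fin_dim V" using assms by (auto simp: fin_objects_def)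
  interpret kspace V by (rule obj_kspace[OF V])
  let ?B = "SOME B. finite_basis V B"
  have B: "finite_basis V ?B" using fd unfolding fin_dim_def by (rule someI_ex)
  have BV: "finite ?B" "?B \<subseteq> carrier V" using B by (auto simp: finite_basis_def)
  have "coord ?B (lact V 1 b) b = 1" if b: "b \<in> ?B" for b
  proof -
    have "lact V 1 b = lc (\<lambda>b. b) ?B (\<lambda>i. if i = b then 1 else 0)"
      using lc_delta[OF BV(1) b, of "\<lambda>b. b"] BV(2) b objD(9)[OF V, of b] by auto
    from coord_eq[OF B this b] show ?thesis by simp
  qed
  then have "trace_character V 1 = of_nat (card ?B)"
    by (simp add: trace_character_def trace_on_def Let_def coord_def)
  moreover have "card ?B > 0"
  proof (rule ccontr)
    assume "\<not> ?thesis"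
    then have "?B = {}" using BV by simp
    then have "x = \<zero>\<^bsub>V\<^esub>" if "x \<in> carrier V" for x using coord(2)[OF B that] by (simp add: lc_empty)
    then show False using assms(2) obj_closed(1)[OF V] by blast
  qed
  ultimately show ?thesis by blast
qed

end

section \<open>The Grothendieck group\<close>

context duality_category
begin

definition exact_relators :: "(('k, 'h, 'v) hmod \<Rightarrow>\<^sub>0 int) set" where
  "exact_relators = {frag_of V - frag_of U - frag_of W | U V W.
     U \<in> fin_obs \<and> V \<in> fin_obs \<and> W \<in> fin_obs \<and> short_exact U V W}"

sublocale K: free_quotient "fin_obs" exact_relators
proof
  show "exact_relators \<subseteq> carrier (free_Abelian_group (fin_obs))"
    unfolding exact_relators_def by (intro subsetI; elim CollectE exE conjE; simp add: keys_diff_subset)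
qed

lemma K0_alt: "K0 \<C> = K.F Mod K.R"
  by (simp add: K0_def exact_relators_def)

text \<open>One representative for each class, so that distinct members are non-isomorphic, as
  \<open>Hst_independent\<close> requires.\<close>

definition simple_reps :: "('k, 'h, 'v) hmod set" where
  "simple_reps = {S \<in> class_rep ` simple_classes. fin_dim S}"

definition simply_generated :: "(('k, 'h, 'v) hmod \<Rightarrow>\<^sub>0 int) \<Rightarrow> bool" where
  "simply_generated x \<longleftrightarrow> (\<exists>y. keys y \<subseteq> simple_reps \<and> x - y \<in> K.R)"

lemma simply_generated_relation: "x \<in> K.R \<Longrightarrow> simply_generated x"
  unfolding simply_generated_def by (intro exI[of _ 0]) simp

lemma simply_generated_diff:
  assumes "simply_generated x" "simply_generated y"
  shows "simply_generated (x - y)"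
proof -
  obtain x' y' where a: "keys x' \<subseteq> simple_reps" "x - x' \<in> K.R"
    "keys y' \<subseteq> simple_reps" "y - y' \<in> K.R" using assms unfolding simply_generated_def by blast
  have "(x - y) - (x' - y') = (x - x') - (y - y')" by simp
  then have "(x - y) - (x' - y') \<in> K.R" using K.diff_in_R[OF a(2,4)] by (simp only:)
  moreover have "keys (x' - y') \<subseteq> simple_reps" using a by (intro keys_diff_subset)
  ultimately show ?thesis unfolding simply_generated_def by blast
qed

lemma simply_generated_add:
  assumes "simply_generated x" "simply_generated y"
  shows "simply_generated (x + y)"
proof -
  have "simply_generated 0" by (rule simply_generated_relation[OF K.zero_in_R])
  then have "simply_generated (x - (0 - y))" using assms simply_generated_diff by blast
  then show ?thesis by simp
qed

lemma exact_relation: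
  assumes "U \<in> fin_obs" "V \<in> fin_obs" "W \<in> fin_obs" "short_exact U V W"
  shows "frag_of V - frag_of U - frag_of W \<in> K.R"
  by (rule generate.incl) (use assms in \<open>auto simp: exact_relators_def\<close>)

lemma zero_submodule:
  assumes V: "V \<in> \<C>"
  shows "V\<lparr>carrier := {\<zero>\<^bsub>V\<^esub>}\<rparr> \<in> fin_obs"
proof -
  interpret abelian_group V by (rule objD(2)[OF V])
  have l: "lact V h \<zero>\<^bsub>V\<^esub> = \<zero>\<^bsub>V\<^esub>" for h
    by (rule linear_maps_zero[OF objD(2)[OF V] objD(2)[OF V] lact_linear[OF V]])
  have "left_submodule {\<zero>\<^bsub>V\<^esub>} V (lact V)"
    by (rule left_submoduleI[OF V]) (auto simp: obj_smult[OF V] l)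
  then have C: "V\<lparr>carrier := {\<zero>\<^bsub>V\<^esub>}\<rparr> \<in> \<C>" by (rule closed_submodule[OF V])
  interpret Z: kspace "V\<lparr>carrier := {\<zero>\<^bsub>V\<^esub>}\<rparr>" by (rule obj_kspace[OF C])
  have "Z.spanning {\<zero>\<^bsub>V\<^esub>} ({} :: 'v set) (\<lambda>b. b)" unfolding Z.spanning_def Z.lc_empty by simp
  then have "fin_dim (V\<lparr>carrier := {\<zero>\<^bsub>V\<^esub>}\<rparr>)" using Z.spanning_fin_dim by fastforce
  then show ?thesis using C by (simp add: fin_objects_def)
qed

text \<open>For a zero object, \<open>V\<close>, \<open>V\<close>, \<open>V\<close> with identity
  maps is exact, and the resulting relator is \<open>- frag_of V\<close>.\<close>

lemma zero_relation:
  assumes V: "V \<in> fin_obs" "carrier V = {\<zero>\<^bsub>V\<^esub>}"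
  shows "frag_of V \<in> K.R"
proof -
  have "(\<lambda>x. x) \<in> hom_H V V" by (rule module_homsI) auto
  then have "short_exact V V V" unfolding short_exact_def using V(2) by (intro bexI[of _ "\<lambda>x. x"]) auto
  from K.diff_in_R[OF K.zero_in_R exact_relation[OF V(1) V(1) V(1) this]] show ?thesis by simp
qed

text \<open>An isomorphism from \<open>V\<close> to \<open>W\<close> is exact with zero cokernel;
  the zero submodule of \<open>W\<close> provides the zero object inside the category.\<close>

lemma iso_relation:
  assumes V: "V \<in> fin_obs" and W: "W \<in> fin_obs" and iso: "isomorphic V W"
  shows "frag_of W - frag_of V \<in> K.R"
proof -
  let ?Z = "W\<lparr>carrier := {\<zero>\<^bsub>W\<^esub>}\<rparr>"
  have WC: "W \<in> \<C>" using W by (simp add: fin_objects_def)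
  have Z: "?Z \<in> fin_obs" by (rule zero_submodule[OF WC])
  have ZC: "?Z \<in> \<C>" using Z by (simp add: fin_objects_def)
  obtain \<alpha> where \<alpha>: "\<alpha> \<in> hom_H V W" "bij_betw \<alpha> (carrier V) (carrier W)"
    using iso by (auto simp: isomorphic_def module_isos_def)
  have l: "lact W h \<zero>\<^bsub>W\<^esub> = \<zero>\<^bsub>W\<^esub>" for h
    by (rule linear_maps_zero[OF objD(2)[OF WC] objD(2)[OF WC] lact_linear[OF WC]])
  interpret abelian_group W by (rule objD(2)[OF WC])
  have \<pi>: "(\<lambda>x. \<zero>\<^bsub>W\<^esub>) \<in> hom_H W ?Z"
    by (rule module_homsI) (auto simp: l obj_smult[OF WC])
  have "short_exact V W ?Z"
    unfolding short_exact_def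
    by (intro bexI[OF _ \<alpha>(1)] bexI[OF _ \<pi>]) (use \<alpha>(2) in \<open>auto simp: bij_betw_def\<close>)
  then have "frag_of W - frag_of V - frag_of ?Z \<in> K.R" by (rule exact_relation[OF V W Z])
  moreover have "frag_of ?Z \<in> K.R" by (rule zero_relation[OF Z]) simp
  ultimately show ?thesis using K.add_in_R by fastforce
qed

lemma fin_objectI:
  assumes "V \<in> \<C>" "kspace.spanning V (carrier V) I v"
  shows "V \<in> fin_obs"
  using kspace.spanning_fin_dim[OF obj_kspace[OF assms(1)] assms(2)] assms(1) by (simp add: fin_objects_def)

lemma fin_object_spanning:
  assumes "V \<in> fin_obs"
  shows "\<exists>I. kspace.spanning V (carrier V) I (\<lambda>b :: 'v. b)"
proof -
  have V: "V \<in> \<C>" using assms by (simp add: fin_objects_def)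
  interpret kspace V by (rule obj_kspace[OF V])
  obtain B where B: "finite_basis V B" using assms by (auto simp: fin_objects_def fin_dim_def)
  then have "spanning (carrier V) B (\<lambda>b. b)" using coord(2)[OF B] by (auto simp: spanning_def finite_basis_def)
  then show ?thesis by blast
qed

lemma fin_object_iso:
  assumes V: "V \<in> fin_obs" and W: "W \<in> \<C>" and iso: "isomorphic V W"
  shows "W \<in> fin_obs"
proof -
  have VC: "V \<in> \<C>" using V by (simp add: fin_objects_def)
  obtain \<alpha> where \<alpha>: "\<alpha> \<in> hom_H V W" "bij_betw \<alpha> (carrier V) (carrier W)"
    using iso by (auto simp: isomorphic_def module_isos_def)
  obtain I where "kspace.spanning V (carrier V) I (\<lambda>b :: 'v. b)" using fin_object_spanning[OF V] by blast
  from kspace.spanning_quotient(1)[OF obj_kspace[OF VC] this objD(1)[OF W] module_homsD(1)[OF \<alpha>(1)]]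
  show ?thesis using \<alpha>(2) fin_objectI[OF W] by (simp add: bij_betw_def)
qed

lemma simple_repsD:
  assumes "S \<in> simple_reps"
  shows "S \<in> fin_obs" "S \<in> \<C>" "simple_hmod S" "S = class_rep (iso_class \<C> S)"
proof -
  obtain c where c: "c \<in> simple_classes" "S = class_rep c" "fin_dim S"
    using assms by (auto simp: simple_reps_def)
  note r = simple_classD[OF c(1), folded c(2)]
  show "S \<in> fin_obs" "S \<in> \<C>" "simple_hmod S" using r(1,2) c(3) by (auto simp: fin_objects_def)
  show "S = class_rep (iso_class \<C> S)" using r(3) c(2) by simp
qed

lemma simply_generated_simple:
  assumes V: "V \<in> fin_obs" "simple_hmod V"
  shows "simply_generated (frag_of V)"
proof -
  have VC: "V \<in> \<C>" using V by (simp add: fin_objects_def)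
  let ?S = "class_rep (iso_class \<C> V)"
  have "?S \<in> fin_obs" by (rule fin_object_iso[OF V(1) class_rep_iso_class[OF VC]])
  then have S: "?S \<in> simple_reps" using V(2) VC by (auto simp: simple_reps_def simple_iso_classes_def fin_objects_def)
  have "isomorphic ?S V" by (rule isomorphic_sym[OF object[OF VC] class_rep_iso_class(2)[OF VC]])
  then have "frag_of V - frag_of ?S \<in> K.R" by (rule iso_relation[OF simple_repsD(1)[OF S] V(1)])
  then show ?thesis using S unfolding simply_generated_def by (intro exI[of _ "frag_of ?S"]) simp
qed

text \<open>Composition series by induction on the size of a spanning family. For a proper nonzero
  submodule, \<open>spanning_subspace\<close> gives it a smaller family and
  \<open>spanning_quotient\<close> gives one to the quotient; the class of \<open>V\<close> is the
  sum of the two.\<close>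

lemma simply_generated_object:
  fixes I :: "'v set"
  assumes "V \<in> \<C>" "kspace.spanning V (carrier V) I v"
  shows "simply_generated (frag_of V)"
  using assms
proof (induction "card I" arbitrary: V I v rule: less_induct)
  case less
  note V = less.prems(1)
  interpret kspace V by (rule obj_kspace[OF V])
  have VF: "V \<in> fin_obs" by (rule fin_objectI[OF less.prems])
  have I: "finite I" "v ` I \<subseteq> carrier V" "\<And>x. x \<in> carrier V \<Longrightarrow> \<exists>c. x = lc v I c"
    using less.prems(2) by (auto simp: spanning_def)
  consider "carrier V = {\<zero>\<^bsub>V\<^esub>}" | "simple_hmod V" |
    U where "left_submodule U V (lact V)" "U \<noteq> {\<zero>\<^bsub>V\<^esub>}" "U \<noteq> carrier V"
    unfolding simple_module_def by blast
  then show ?case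
  proof cases
    case 1
    then show ?thesis by (intro simply_generated_relation zero_relation[OF VF])
  next
    case 2
    then show ?thesis by (intro simply_generated_simple[OF VF])
  next
    case 3
    note u = left_submoduleD[OF V 3(1)]
    let ?U = "V\<lparr>carrier := U\<rparr>"
    have UC: "?U \<in> \<C>" by (rule closed_submodule[OF V 3(1)])
    interpret U: kspace ?U by (rule obj_kspace[OF UC])
    have incl: "(\<lambda>x. x) \<in> hom_H ?U V" by (rule module_homsI) (use u in auto)
    have "\<exists>J w. J \<subseteq> I \<and> spanning U J w \<and> (J = I \<longrightarrow> (\<forall>c. lc v I c \<in> U))"
      by (rule spanning_subspace[OF I(1,2)]) (use u I(3) in auto)
    then obtain J w where J: "J \<subseteq> I" "spanning U J w" "J = I \<Longrightarrow> \<forall>c. lc v I c \<in> U" by blast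
    have "J \<noteq> I"
    proof
      assume "J = I"
      then have "carrier V \<subseteq> U" using J(3) I(3) by fastforce
      then show False using u(1) 3(3) by blast
    qed
    then have cJ: "card J < card I" using J(1) I(1) by (intro psubset_card_mono) auto
    have Jw: "finite J" "w ` J \<subseteq> U" "\<And>x. x \<in> U \<Longrightarrow> \<exists>c. x = lc w J c" using J(2) by (auto simp: spanning_def)
    \<comment> \<open>Combinations formed in \<open>?U\<close> and in \<open>V\<close> agree because
      the inclusion is linear.\<close>
    have "U.lc w J c = lc w J c" for c
      using U.linear_lc[OF module_axioms module_homsD(1)[OF incl] Jw(1)] Jw(2) by simp
    then have spU: "U.spanning (carrier ?U) J w" using Jw by (simp add: U.spanning_def)
    have gU: "simply_generated (frag_of ?U)" by (rule less.hyps[OF cJ UC spU])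
    obtain Q \<pi> where Q: "Q \<in> \<C>" and \<pi>: "\<pi> \<in> hom_H V Q" "\<pi> ` carrier V = carrier Q"
      and ker: "{x \<in> carrier V. \<pi> x = \<zero>\<^bsub>Q\<^esub>} = U"
      using closed_quotient[OF V 3(1)] by blast
    obtain x where x: "x \<in> U" "x \<noteq> \<zero>\<^bsub>V\<^esub>" using 3(2) u(2) by blast
    have "x \<in> carrier V" "\<pi> x = \<zero>\<^bsub>Q\<^esub>" using x(1) ker by auto
    then obtain j where j: "j \<in> I" "kspace.spanning Q (carrier Q) (I - {j}) (\<lambda>i. \<pi> (v i))"
      using spanning_quotient(2)[OF less.prems(2) objD(1)[OF Q] module_homsD(1)[OF \<pi>(1)] \<pi>(2) _ x(2)] by blast
    have cj: "card (I - {j}) < card I" using j(1) I(1) by (rule card_Diff1_less[rotated])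
    have gQ: "simply_generated (frag_of Q)" by (rule less.hyps[OF cj Q j(2)])
    have "short_exact ?U V Q"
      unfolding short_exact_def by (intro bexI[OF _ incl] bexI[OF _ \<pi>(1)]) (use \<pi>(2) ker in auto)
    then have "frag_of V - frag_of ?U - frag_of Q \<in> K.R"
      by (rule exact_relation[OF fin_objectI[OF UC spU] VF fin_objectI[OF Q j(2)]])
    then have "simply_generated ((frag_of V - frag_of ?U - frag_of Q) + (frag_of ?U + frag_of Q))"
      by (intro simply_generated_add simply_generated_relation gU gQ)
    then show ?thesis by simp
  qed
qed

lemma simply_generated_all:
  assumes "x \<in> carrier K.F"
  shows "simply_generated x"
proof -
  have "keys x \<subseteq> fin_obs" using assms by simp
  then show ?thesis
  proof (induction rule: free_Abelian_group_induct[consumes 1, case_names zero diff gen])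
    case zero
    show ?case by (rule simply_generated_relation[OF K.zero_in_R])
  next
    case (diff x y)
    then show ?case by (intro simply_generated_diff)
  next
    case (gen V)
    then show ?case
      using simply_generated_object fin_object_spanning by (metis (no_types, lifting) fin_objects_def mem_Collect_eq)
  qed
qed

text \<open>The character before \<open>\<Phi>\<close> is applied. As \<open>ch\<close> is induced
  by \<open>\<Phi>\<close> after \<open>vchar\<close>, injectivity of \<open>\<Phi>\<close> reduces
  (c) to a statement about functions on \<open>H\<close>.\<close>

definition vchar :: "(('k, 'h, 'v) hmod \<Rightarrow>\<^sub>0 int) \<Rightarrow> 'h \<Rightarrow> 'k" where
  "vchar x = (\<Sum>V\<in>keys x. fun_scale (of_int (lookup x V)) (trace_character V))"

lemma vchar_superset:
  assumes "finite K" "keys x \<subseteq> K"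
  shows "vchar x = (\<Sum>V\<in>K. fun_scale (of_int (lookup x V)) (trace_character V))"
  unfolding vchar_def
  by (rule sum.mono_neutral_left) (use assms in \<open>auto simp: in_keys_iff\<close>)

lemma vchar_diff: "vchar (x - y) = vchar x - vchar y"
proof -
  let ?K = "keys x \<union> keys y"
  have k: "finite ?K" "keys (x - y) \<subseteq> ?K" using keys_diff[of x y] by auto
  have "vchar (x - y) = (\<Sum>V\<in>?K. fun_scale (of_int (lookup x V)) (trace_character V)
      - fun_scale (of_int (lookup y V)) (trace_character V))"
    unfolding vchar_superset[OF k] by (rule sum.cong) (simp_all add: lookup_minus fs.scale_left_diff_distrib)
  then show ?thesis
    using vchar_superset[OF k(1), of x] vchar_superset[OF k(1), of y]
    by (simp add: sum_subtractf)
qed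

lemma vchar_of: "vchar (frag_of V) = trace_character V"
  by (simp add: vchar_def fs.scale_one)

lemma vchar_relator: "r \<in> exact_relators \<Longrightarrow> vchar r = 0"
  unfolding exact_relators_def
  by (elim CollectE exE conjE) (simp only: vchar_diff vchar_of trace_character_exact, simp)

lemma vchar_relation:
  assumes "x \<in> K.R"
  shows "vchar x = 0"
  using assms
proof (induction)
  case one
  then show ?case by (simp add: vchar_def)
next
  case (incl r)
  then show ?case by (rule vchar_relator)
next
  case (inv r)
  have "inv\<^bsub>K.F\<^esub> r = 0 - r" using subsetD[OF K.rel inv] by simp
  moreover have "vchar 0 = 0" by (simp add: vchar_def)
  ultimately show ?case using vchar_relator[OF inv] by (simp only: vchar_diff diff_self)
next
  case (eng x y)
  have "vchar (x - (0 - y)) = 0"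
    unfolding vchar_diff eng by (simp add: vchar_def)
  then show ?case by simp
qed

text \<open>Modulo relations, \<open>x\<close> is a combination \<open>y\<close> of simple
  representatives. Its terms lie in independent coefficient spaces, so each vanishes separately, and
  evaluation at 1 then kills the integer coefficient.\<close>

lemma vchar_inj:
  assumes char: "CHAR('k) = 0" and x: "x \<in> carrier K.F" and z: "vchar x = 0"
  shows "x \<in> K.R"
proof -
  obtain y where y: "keys y \<subseteq> simple_reps" "x - y \<in> K.R"
    using simply_generated_all[OF x] unfolding simply_generated_def by blast
  have vy: "vchar y = 0"
    using vchar_relation[OF y(2)] z by (simp add: vchar_diff)
  have "V \<notin> keys y" for V
  proof
    assume V: "V \<in> keys y"
    let ?\<xi> = "\<lambda>V. fun_scale (of_int (lookup y V)) (trace_character V)"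
    note r = simple_repsD[OF subsetD[OF y(1)]]
    have "?\<xi> V = 0"
    proof (rule Hst_independent[where J = "keys y" and V = "\<lambda>V. V"])
      show "i = j" if "i \<in> keys y" "j \<in> keys y" "isomorphic i j" for i j
        using iso_class_eq[OF r(2) r(2)] r(4) that by metis
      show "?\<xi> j \<in> Hst star j" if "j \<in> keys y" for j
        by (rule Hst_scale[OF r(2)[OF that] trace_character_Hst[OF r(1)[OF that]]])
      show "sum ?\<xi> (keys y) = 0" using vy by (simp add: vchar_def)
    qed (use V r in auto)
    then have "?\<xi> V 1 = 0" by (simp only: zero_fun_apply)
    moreover obtain n where "n > 0" "trace_character V 1 = of_nat n"
      using trace_character_one[OF r(1)[OF V]] r(3)[OF V] by (auto simp: simple_module_def)
    \<comment> \<open>The value at 1 is the coefficient times the dimension; the dimension is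
      invertible in the field because the characteristic is 0.\<close>
    ultimately have "(of_int (lookup y V) :: 'k) = 0"
      using of_nat_eq_0_iff_char_dvd[where 'a = 'k, of n] char by (simp add: fun_scale_def)
    then have "lookup y V = 0"
      using of_int_eq_0_iff_char_dvd[where 'a = 'k] char by simp
    then show False using V by (simp add: in_keys_iff)
  qed
  then have "y = 0" by (metis keys_eq_empty equals0I)
  then show ?thesis using y(2) by simp
qed

end

lemma center_group_comm: "comm_group (center_group H)"
proof (rule comm_groupI)
  fix x :: 'a assume "x \<in> carrier (center_group H)"
  then have "- x \<in> carrier (center_group H)" "- x + x = 0" by (auto simp: center_group_def center_def)
  then show "\<exists>y\<in>carrier (center_group H). y \<otimes>\<^bsub>center_group H\<^esub> x = \<one>\<^bsub>center_group H\<^esub>"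
    by (intro bexI[of _ "- x"]) (auto simp: center_group_def)
qed (auto simp: center_group_def center_def distrib add_ac)

section \<open>Part (c): the character map on the Grothendieck group\<close>

context tensor_completion
begin

lemma vchar_HstC: "x \<in> carrier K.F \<Longrightarrow> vchar x \<in> HstAll"
  unfolding vchar_def HstC_def
  by (rule fs.span_sum, rule fs.span_scale)
    (use trace_character_Hst Hst_HstC in \<open>auto simp: HstC_def[symmetric] fin_objects_def subset_iff\<close>)

lemma ch_injective:
  assumes P: "P \<in> multiplicative0 H \<C> star T" and inj: "inj_on (\<Phi> T P) (HstAll)" and char: "CHAR('k) = 0"
  shows "ch H T P \<in> hom (K0 \<C>) (center_group H) \<and> inj_on (ch H T P) (carrier (K0 \<C>))"
proof -
  let ?G = "center_group H" and ?b = "\<lambda>V. \<Phi> T P (trace_character V)"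
  interpret comm_group ?G by (rule center_group_comm)
  have b: "?b \<in> fin_obs \<rightarrow> carrier ?G"
    using P trace_character_inv by (auto simp: multiplicative0_def center_group_def)
  have invG: "inv\<^bsub>?G\<^esub> z = - z" if "z \<in> carrier ?G" for z
    by (rule inv_equality) (use that in \<open>auto simp: center_group_def center_def\<close>)
  have \<Phi>_diff: "\<Phi> T P (f - g) = \<Phi> T P f - \<Phi> T P g" if "f \<in> HstAll" "g \<in> HstAll" for f g
  proof -
    have "f - g \<in> HstAll" using that unfolding HstC_def by (rule fs.span_diff)
    from \<Phi>_add[OF this that(2), of P] show ?thesis by (simp add: algebra_simps)
  qed
  \<comment> \<open>Both sides send differences to differences and agree on generators. As
    \<open>vchar\<close> kills relations, this shows that \<open>ch\<close> is well defined on
    \<open>K0\<close>, and it expresses \<open>ch\<close> on the class of \<open>x\<close>.\<close>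
  have ext: "frag_lift ?G ?b x = \<Phi> T P (vchar x)" if "x \<in> carrier K.F" for x
  proof -
    have "keys x \<subseteq> fin_obs" using that by simp
    then show ?thesis
    proof (induction rule: free_Abelian_group_induct[consumes 1, case_names zero diff gen])
      case zero
      show ?case
        using finprod_empty by (simp add: frag_lift_def vchar_def \<Phi>_zero) (simp add: center_group_def)
    next
      case (diff x y)
      have xy: "x \<in> carrier K.F" "y \<in> carrier K.F" using diff by auto
      have "frag_lift ?G ?b y \<in> carrier ?G" using hom_in_carrier[OF frag_lift_hom[OF b] xy(2)] .
      then have "frag_lift ?G ?b (x - y) = \<Phi> T P (vchar x) - \<Phi> T P (vchar y)"
        using frag_lift_diff[OF b xy] invG diff(3,4) by (simp add: center_group_def)
      then show ?case
        unfolding vchar_diff \<Phi>_diff[OF vchar_HstC[OF xy(1)] vchar_HstC[OF xy(2)]] .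
    next
      case (gen V)
      then show ?case using frag_lift_of[of ?b V] b by (auto simp: vchar_of)
    qed
  qed
  have kill: "frag_lift ?G ?b r = \<one>\<^bsub>?G\<^esub>" if "r \<in> exact_relators" for r
  proof -
    have "r \<in> K.R" using that by (rule generate.incl)
    then show ?thesis
      using ext[of r] vchar_relation[of r] K.R_carrier[of r] by (simp add: \<Phi>_zero center_group_def)
  qed
  have hom: "ch H T P \<in> hom (K0 \<C>) ?G"
    unfolding K0_alt ch_def by (rule K.coset_lift_hom[OF center_group_comm b kill])
  have grp: "group (K0 \<C>)" unfolding K0_alt using K.comm_quotient by (simp add: comm_group_def)
  interpret h: group_hom "K0 \<C>" ?G "ch H T P"
    using hom grp is_group by (simp add: group_hom_def group_hom_axioms_def)
  have "X = \<one>\<^bsub>K0 \<C>\<^esub>" if X: "X \<in> carrier (K0 \<C>)" "ch H T P X = \<one>\<^bsub>?G\<^esub>" for X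
  proof -
    obtain x where x: "x \<in> carrier K.F" "X = K.cls x"
      using X(1) unfolding K0_alt by (rule K.coset_cases)
    have "\<Phi> T P (vchar x) = \<Phi> T P 0"
      using X(2) K.coset_lift_coset[OF center_group_comm b kill x(1)] ext[OF x(1)]
      by (simp add: ch_def x(2) \<Phi>_zero center_group_def)
    then have "vchar x = 0"
      by (rule inj_onD[OF inj _ vchar_HstC[OF x(1)] HstC_zero])
    then have "x \<in> K.R" by (rule vchar_inj[OF char x(1)])
    then have "X = K.cls 0" unfolding x(2) using x(1) by (intro K.coset_eqI) auto
    then show ?thesis by (simp only: K0_alt K.cls_zero)
  qed
  then show ?thesis using hom h.inj_on_one_iff by blast
qed

end

theorem proposition1p7:
  fixes H :: "('k::field, 'h::ring_1) hopf"
    and \<C> :: "('k, 'h, 'v) hmod set"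
    and star :: "('k, 'h, 'v) hmod \<Rightarrow> ('v \<Rightarrow> 'k) set"
    and T :: "('k, 'h, 'c::ring_1) completion"
    and P :: 'c
  assumes "tensor_completion H \<C> star T"
    and "P \<in> adapted H T \<inter> multiplicative H \<C> star T"
    and "inj_on (\<Phi> T P) (HstC \<C> star)"
  shows
    "(\<forall>V\<in>\<C>. simple_coeff_bimodule star V \<longrightarrow>
        module_isos
          (coeff_space star V)
          (diamond_action H (coeff_space star V) (coeff_lact star V) (coeff_ract star V))
          (HVP H star T P V)
          (ad_action H (hspace H) (*) (*)) \<noteq> {}) \<and>
     (semisimple_category \<C> \<and> (\<forall>V\<in>\<C>. simple_hmod V \<longrightarrow> simple_coeff_bimodule star V) \<longrightarrow>
        is_internal_direct_sum (hspace H) (simple_iso_classes \<C>)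
          (\<lambda>c. carrier (HVP H star T P (class_rep c))) (\<Phi> T P ` HstC \<C> star)) \<and>
     (P \<in> multiplicative0 H \<C> star T \<and> CHAR('k) = 0 \<longrightarrow>
        ch H T P \<in> hom (K0 \<C>) (center_group H) \<and> inj_on (ch H T P) (carrier (K0 \<C>)))"
proof -
  interpret tensor_completion H \<C> star T by (rule assms(1))
  show ?thesis
    using coeff_space_iso_ad[of _ P] semisimple_direct_sum[of P] ch_injective[of P] assms(2,3) by blast
qed

end
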